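(* Consider a constrained discounted stochastic game ($CSG$) as described in the context, and assume the following. (A1) The functions $c_i^\ell(x,\cdot)$ are continuous on $A$ for all $x\in X$, $i\in\mathcal N$ and $\ell\in\mathcal L_0$. (A2) The transition probability has the form $p(B|x,\pmb a)=\int_B\delta(x,y,\pmb a)\,\mu(dy)$ for $B\in\mathcal F$, where $\mu$ is a probability measure on $\mathcal F$ and $\delta$ is a product measurable non-negative function such that, if $\pmb a^n\to\pmb a$ as $n\to\infty$, then $\int_X|\delta(x,y,\pmb a^n)-\delta(x,y,\pmb a)|\,\mu(dy)\to0$ (for each $x\in X$). (A3) For each stationary multi-strategy $\pmb\varphi\in\Phi$ and each player $i\in\mathcal N$ there exists $\pi_i\in\Pi_i$ such that $J_i^\ell([\pmb\varphi_{-i},\pi_i])\le\kappa_i^\ell$ for all $\ell\in\mathcal L$. Then, for each $\varepsilon>0$, the $CSG$ possesses a stationary approximate equilibrium for $\varepsilon$, that is, there is $\pmb\pi^*\in\Phi$ such that $J_i^\ell(\pmb\pi^* )\le\kappa_i^\ell+\varepsilon$ for every $i\in\mathcal N$, $\ell\in\mathcal L$, and $$J_i^0(\pmb\pi^* )-\varepsilon\le\inf_{\sigma_i\in\Delta_i(\pmb\pi^*_{-i})}J_i^0([\pmb\pi^*_{-i},\sigma_i])\quad\text{for every } i\in\mathcal N.$$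
   Context: Constrained stochastic game ($CSG$). $\mathcal N=\{1,\dots,N\}$ is the set of players. $X$ is a state space endowed with a countably generated $\sigma$-algebra $\mathcal F$. $A_i$ is a compact metric action space of player $i$ with its Borel $\sigma$-algebra; $A=\prod_{j\in\mathcal N}A_j$, $A_{-i}=\prod_{j\ne i}A_j$, $\mathbb K=\{(x,\pmb a):x\in X,\ \pmb a=(a_1,\dots,a_N)\in A\}$. Let $\mathcal L=\{1,\dots,L\}$, $\mathcal L_0=\mathcal L\cup\{0\}$. The functions $c_i^\ell:\mathbb K\to\mathbb R$ ($i\in\mathcal N$, $\ell\in\mathcal L_0$) are product measurable, and there is $b>0$ with $|c_i^\ell(x,\pmb a)|\le b$ for all $i,\ell,(x,\pmb a)$; $c_i^0$ is the cost-per-stage function of player $i$, and $c_i^\ell$, $\ell\in\mathcal L$, are used in the constraints. $p(dy|x,\pmb a)$ is the transition probability on $X$, $\eta$ is the initial state distribution (a probability measure on $\mathcal F$), $\alpha\in(0,1)$ is the discount factor, and $\kappa_i^\ell\in\mathbb R$ ($i\in\mathcal N,\ell\in\mathcal L$) are constraint constants. Strategies. $H^1=X$, and $H^t$ is the set of histories $h^t=(x^1,\pmb a^1,\dots,x^t)$ up to stage $t$, with $(x^k,\pmb a^k)\in\mathbb K$ for $k<t$. A strategy of player $i$ is a sequence $\pi_i=(\pi_i^t)_{t\in\mathbb N}$, each $\pi_i^t$ being a transition probability from $H^t$ to $A_i$; $\Pi_i$ is the set of all strategies of player $i$. $\Phi_i$ is the set of transition probabilities from $X$ to $A_i$; $\varphi_i\in\Phi_i$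 is identified with the stationary strategy using $\varphi_i(\cdot|x^t)$ at each stage $t$. $\Pi=\prod_i\Pi_i$, $\Phi=\prod_i\Phi_i$ (multi-strategies and stationary multi-strategies); players randomize independently given the history. For $\pmb\pi\in\Pi$, $\mathbb E_\eta^{\pmb\pi}$ is the expectation with respect to the unique (Ionescu-Tulcea) probability measure on infinite histories induced by $\pmb\pi$, $p$ and $\eta$. The discounted cost functionals are $$J_i^\ell(\pmb\pi)=(1-\alpha)\,\mathbb E_\eta^{\pmb\pi}\Big[\sum_{t=1}^\infty\alpha^{t-1}c_i^\ell(x^t,\pmb a^t)\Big],\quad i\in\mathcal N,\ \ell\in\mathcal L_0.$$ $\pmb\pi_{-i}$ is the profile of the strategies of all players but $i$, and $[\pmb\pi_{-i},\sigma_i]$ is the multi-strategy in which player $i$ uses $\sigma_i$ and every $j\ne i$ uses $\pi_j$. The set of feasible strategies of player $i$ against $\pmb\pi_{-i}$ is $\Delta_i(\pmb\pi_{-i})=\{\pi_i\in\Pi_i:\ J_i^\ell([\pmb\pi_{-i},\pi_i])\le\kappa_i^\ell\text{ for all }\ell\in\mathcal L\}$. *)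

theory Defs
  imports "HOL-Probability.Probability"
begin

text \<open>
  The players are \<open>1, \<dots>, n_players G\<close>, and constraint \<open>l\<close> ranges over \<open>1, \<dots>, n_constraints G\<close>;
  \<open>cost G i 0\<close> is the cost-per-stage function of player \<open>i\<close> and \<open>cost G i l\<close> with \<open>l \<ge> 1\<close> enters
  his \<open>l\<close>-th constraint. Only the measurable space underlying \<open>states G\<close> matters.
  The action spaces may differ from player to player: \<open>acts G i\<close> are subsets of one metric type,
  which can be taken to be the disjoint union of the given metric spaces.
\<close>

record ('x, 'a) csg =
  n_players :: nat
  n_constraints :: nat
  states :: "'x measure"
  acts :: "nat \<Rightarrow> 'a set"
  cost :: "nat \<Rightarrow> nat \<Rightarrow> 'x \<Rightarrow> (nat \<Rightarrow> 'a) \<Rightarrow> real"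
  transition :: "'x \<Rightarrow> (nat \<Rightarrow> 'a) \<Rightarrow> 'x measure"
  init :: "'x measure"
  discount :: real
  bound :: "nat \<Rightarrow> nat \<Rightarrow> real"

definition players :: "('x, 'a) csg \<Rightarrow> nat set" where
  "players G = {1..n_players G}"

definition constraints :: "('x, 'a) csg \<Rightarrow> nat set" where
  "constraints G = {1..n_constraints G}"

definition profiles :: "('x, 'a) csg \<Rightarrow> (nat \<Rightarrow> 'a) set" where
  "profiles G = (\<Pi>\<^sub>E i\<in>players G. acts G i)"

definition act_space :: "('x, 'a::metric_space) csg \<Rightarrow> nat \<Rightarrow> 'a measure" where
  "act_space G i = restrict_space borel (acts G i)"

definition profile_space :: "('x, 'a::metric_space) csg \<Rightarrow> (nat \<Rightarrow> 'a) measure" where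
  "profile_space G = (\<Pi>\<^sub>M i\<in>players G. act_space G i)"

definition stage_space :: "('x, 'a::metric_space) csg \<Rightarrow> ('x \<times> (nat \<Rightarrow> 'a)) measure" where
  "stage_space G = states G \<Otimes>\<^sub>M profile_space G"

definition countably_generated :: "'x measure \<Rightarrow> bool" where
  "countably_generated M \<longleftrightarrow>
    (\<exists>\<G>. countable \<G> \<and> \<G> \<subseteq> Pow (space M) \<and> sets M = sigma_sets (space M) \<G>)"

text \<open>
  A transition probability from \<open>M\<close> to \<open>N\<close> is a measurable map \<open>M \<rightarrow>\<^sub>M prob_algebra N\<close>.
\<close>

definition constrained_stochastic_game :: "('x, 'a::metric_space) csg \<Rightarrow> bool" where
  "constrained_stochastic_game G \<longleftrightarrow>
    countably_generated (states G) \<and>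
    (\<forall>i\<in>players G. compact (acts G i) \<and> acts G i \<noteq> {}) \<and>
    (\<forall>i\<in>players G. \<forall>l\<in>insert 0 (constraints G).
      (\<lambda>(x, a). cost G i l x a) \<in> borel_measurable (stage_space G)) \<and>
    (\<exists>b>0. \<forall>i\<in>players G. \<forall>l\<in>insert 0 (constraints G).
      \<forall>x\<in>space (states G). \<forall>a\<in>profiles G. \<bar>cost G i l x a\<bar> \<le> b) \<and>
    (\<lambda>(x, a). transition G x a) \<in> stage_space G \<rightarrow>\<^sub>M prob_algebra (states G) \<and>
    init G \<in> space (prob_algebra (states G)) \<and>
    0 < discount G \<and> discount G < 1"

text \<open>
  Stages are numbered from \<open>0\<close>. A history up to stage \<open>t\<close> is a pair \<open>(\<omega>, x)\<close>: the state-action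
  pairs \<open>\<omega> k\<close> of the stages \<open>k < t\<close>, and the current state \<open>x\<close>.
\<close>

type_synonym ('x, 'a) history = "(nat \<Rightarrow> 'x \<times> (nat \<Rightarrow> 'a)) \<times> 'x"
type_synonym ('x, 'a) strategy = "nat \<Rightarrow> ('x, 'a) history \<Rightarrow> 'a measure"

definition history_space :: "('x, 'a::metric_space) csg \<Rightarrow> nat \<Rightarrow> ('x, 'a) history measure" where
  "history_space G t = (\<Pi>\<^sub>M k\<in>{0..<t}. stage_space G) \<Otimes>\<^sub>M states G"

definition strategies :: "('x, 'a::metric_space) csg \<Rightarrow> nat \<Rightarrow> ('x, 'a) strategy set" where
  "strategies G i = {\<sigma>. \<forall>t. \<sigma> t \<in> history_space G t \<rightarrow>\<^sub>M prob_algebra (act_space G i)}"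

definition stationary_strategies :: "('x, 'a::metric_space) csg \<Rightarrow> nat \<Rightarrow> ('x \<Rightarrow> 'a measure) set" where
  "stationary_strategies G i = states G \<rightarrow>\<^sub>M prob_algebra (act_space G i)"

definition stationary :: "('x \<Rightarrow> 'a measure) \<Rightarrow> ('x, 'a) strategy" where
  "stationary \<phi> = (\<lambda>t (\<omega>, x). \<phi> x)"

text \<open>
  Conditional law of the state-action pair of stage \<open>t\<close> given the pairs \<open>\<omega>\<close> of the earlier stages;
  the product measure expresses that the players randomize independently given the history.
\<close>

definition stage_kernel ::
  "('x, 'a::metric_space) csg \<Rightarrow> (nat \<Rightarrow> ('x, 'a) strategy) \<Rightarrow> nat \<Rightarrow>
    (nat \<Rightarrow> 'x \<times> (nat \<Rightarrow> 'a)) \<Rightarrow> ('x \<times> (nat \<Rightarrow> 'a)) measure" where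
  "stage_kernel G \<pi> t \<omega> =
    (if t = 0 then init G else transition G (fst (\<omega> (t - 1))) (snd (\<omega> (t - 1)))) \<bind>
      (\<lambda>x. distr (\<Pi>\<^sub>M i\<in>players G. \<pi> i t (\<omega>, x)) (stage_space G) (\<lambda>a. (x, a)))"

definition play_measure ::
  "('x, 'a::metric_space) csg \<Rightarrow> (nat \<Rightarrow> ('x, 'a) strategy) \<Rightarrow> (nat \<Rightarrow> 'x \<times> (nat \<Rightarrow> 'a)) measure" where
  "play_measure G \<pi> =
    projective_family.lim UNIV
      (Ionescu_Tulcea.CI (stage_kernel G \<pi>) (\<lambda>_. stage_space G)) (\<lambda>_. stage_space G)"

text \<open>
  For all multi-strategies the stage kernels satisfy the assumptions of the Ionescu-Tulcea theorem,
  so that \<^const>\<open>play_measure\<close> is the limit measure constructed in that locale.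
\<close>

lemma measurable_PiM_kernel:
  assumes "finite I" and K: "\<And>i. i \<in> I \<Longrightarrow> K i \<in> M \<rightarrow>\<^sub>M prob_algebra (N i)"
  shows "(\<lambda>y. \<Pi>\<^sub>M i\<in>I. K i y) \<in> M \<rightarrow>\<^sub>M prob_algebra (\<Pi>\<^sub>M i\<in>I. N i)"
proof (rule measurable_prob_algebra_generated[OF sets_PiM Int_stable_prod_algebra])
  show "prod_algebra I N \<subseteq> Pow (\<Pi>\<^sub>E i\<in>I. space (N i))"
    by (rule prod_algebra_sets_into_space)
next
  fix y assume y: "y \<in> space M"
  have *: "prob_space (K i y)" "sets (K i y) = sets (N i)" if "i \<in> I" for i
    using measurable_space[OF K[OF that] y] by (auto simp: space_prob_algebra)
  show "prob_space (\<Pi>\<^sub>M i\<in>I. K i y)" by (intro prob_space_PiM *)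
  show "sets (\<Pi>\<^sub>M i\<in>I. K i y) = sets (PiM I N)" by (intro sets_PiM_cong refl *)
next
  fix A assume "A \<in> prod_algebra I N"
  then obtain E where A: "A = Pi\<^sub>E I E" and E: "\<And>i. i \<in> I \<Longrightarrow> E i \<in> sets (N i)"
    unfolding prod_algebra_eq_finite[OF \<open>finite I\<close>] by blast
  have "emeasure (\<Pi>\<^sub>M i\<in>I. K i y) A = (\<Prod>i\<in>I. emeasure (K i y) (E i))" if y: "y \<in> space M" for y
  proof -
    have *: "prob_space (K i y)" "sets (K i y) = sets (N i)" if "i \<in> I" for i
      using measurable_space[OF K[OF that] y] by (auto simp: space_prob_algebra)
    let ?K = "\<lambda>i. if i \<in> I then K i y else return (count_space UNIV) undefined"
    interpret product_prob_space ?K I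
      by (intro product_prob_spaceI) (auto simp: * prob_space_return)
    have "(\<Pi>\<^sub>M i\<in>I. K i y) = PiM I ?K" by (intro PiM_cong) auto
    with emeasure_PiM[OF \<open>finite I\<close>, of E] show ?thesis by (simp add: A * E)
  qed
  moreover have "(\<lambda>y. \<Prod>i\<in>I. emeasure (K i y) (E i)) \<in> borel_measurable M"
    using K E by (intro borel_measurable_prod_ennreal measurable_emeasure_kernel[OF measurable_prob_algebraD]) auto
  ultimately show "(\<lambda>y. emeasure (\<Pi>\<^sub>M i\<in>I. K i y) A) \<in> borel_measurable M"
    by (subst measurable_cong) auto
qed

lemma measurable_stage_kernel:
  assumes G: "constrained_stochastic_game G" and p: "\<pi> \<in> (\<Pi> i\<in>players G. strategies G i)"
  shows "stage_kernel G \<pi> t \<in> (\<Pi>\<^sub>M k\<in>{0..<t}. stage_space G) \<rightarrow>\<^sub>M prob_algebra (stage_space G)"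
  unfolding stage_kernel_def
proof (rule measurable_bind_prob_space2)
  let ?H = "\<Pi>\<^sub>M k\<in>{0..<t}. stage_space G"
  have tr[measurable]: "(\<lambda>(x, a). transition G x a) \<in> stage_space G \<rightarrow>\<^sub>M prob_algebra (states G)"
    and i: "init G \<in> space (prob_algebra (states G))"
    using G by (auto simp: constrained_stochastic_game_def)
  show "(\<lambda>\<omega>. if t = 0 then init G else transition G (fst (\<omega> (t - 1))) (snd (\<omega> (t - 1))))
      \<in> ?H \<rightarrow>\<^sub>M prob_algebra (states G)"
  proof (cases "t = 0")
    case False
    have "(\<lambda>\<omega>. \<omega> (t - 1)) \<in> ?H \<rightarrow>\<^sub>M stage_space G"
      using False by (intro measurable_component_singleton) auto
    from measurable_compose[OF this tr] False show ?thesis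
      by (simp add: case_prod_beta)
  qed (use i in simp)
  have "(\<lambda>h. \<Pi>\<^sub>M i\<in>players G. \<pi> i t h) \<in> history_space G t \<rightarrow>\<^sub>M prob_algebra (profile_space G)"
    unfolding profile_space_def
    using p by (intro measurable_PiM_kernel) (auto simp: players_def strategies_def)
  then show "(\<lambda>(\<omega>, x). distr (\<Pi>\<^sub>M i\<in>players G. \<pi> i t (\<omega>, x)) (stage_space G) (\<lambda>a. (x, a)))
      \<in> ?H \<Otimes>\<^sub>M states G \<rightarrow>\<^sub>M prob_algebra (stage_space G)"
    unfolding case_prod_beta
    by (intro measurable_distr_prob_space2[where M="profile_space G"])
      (auto simp: history_space_def stage_space_def case_prod_beta)
qed

lemma Ionescu_Tulcea_stage_kernel:
  assumes "constrained_stochastic_game G" and "\<pi> \<in> (\<Pi> i\<in>players G. strategies G i)"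
  shows "Ionescu_Tulcea (stage_kernel G \<pi>) (\<lambda>_. stage_space G)"
proof (rule Ionescu_Tulcea.intro)
  note * = measurable_stage_kernel[OF assms]
  show "stage_kernel G \<pi> t \<in> (\<Pi>\<^sub>M k\<in>{0..<t}. stage_space G) \<rightarrow>\<^sub>M subprob_algebra (stage_space G)" for t
    by (rule measurable_prob_algebraD[OF *])
  show "prob_space (stage_kernel G \<pi> t \<omega>)"
    if "\<omega> \<in> space (\<Pi>\<^sub>M k\<in>{0..<t}. stage_space G)" for t \<omega>
    using measurable_space[OF * that] by (simp add: space_prob_algebra)
qed

lemma stationary_in_strategies:
  "\<phi> \<in> stationary_strategies G i \<Longrightarrow> stationary \<phi> \<in> strategies G i"
  by (auto simp: stationary_strategies_def stationary_def strategies_def history_space_def case_prod_beta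
    intro!: measurable_compose[OF measurable_snd])

definition discounted_cost ::
  "('x, 'a::metric_space) csg \<Rightarrow> nat \<Rightarrow> nat \<Rightarrow> (nat \<Rightarrow> ('x, 'a) strategy) \<Rightarrow> real" where
  "discounted_cost G i l \<pi> =
    (1 - discount G) *
      (\<integral>\<omega>. (\<Sum>t. discount G ^ t * cost G i l (fst (\<omega> t)) (snd (\<omega> t))) \<partial>play_measure G \<pi>)"

text \<open>
  The multi-strategy \<open>[\<pi>\<^sub>-\<^sub>i, \<sigma>]\<close> is \<open>\<pi>(i := \<sigma>)\<close>; the set below does not depend on \<open>\<pi> i\<close>.
\<close>

definition feasible ::
  "('x, 'a::metric_space) csg \<Rightarrow> nat \<Rightarrow> (nat \<Rightarrow> ('x, 'a) strategy) \<Rightarrow> ('x, 'a) strategy set" where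
  "feasible G i \<pi> =
    {\<sigma> \<in> strategies G i. \<forall>l\<in>constraints G. discounted_cost G i l (\<pi>(i := \<sigma>)) \<le> bound G i l}"

definition stationary_approximate_equilibrium ::
  "('x, 'a::metric_space) csg \<Rightarrow> real \<Rightarrow> (nat \<Rightarrow> 'x \<Rightarrow> 'a measure) \<Rightarrow> bool" where
  "stationary_approximate_equilibrium G \<epsilon> \<phi> \<longleftrightarrow>
    \<phi> \<in> (\<Pi> i\<in>players G. stationary_strategies G i) \<and>
    (let \<pi> = (\<lambda>i. stationary (\<phi> i)) in
      \<forall>i\<in>players G.
        (\<forall>l\<in>constraints G. discounted_cost G i l \<pi> \<le> bound G i l + \<epsilon>) \<and>
        discounted_cost G i 0 \<pi> - \<epsilon> \<le> (INF \<sigma>\<in>feasible G i \<pi>. discounted_cost G i 0 (\<pi>(i := \<sigma>))))"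

end

theory Submission
  imports Defs
begin

text \<open>
  The constraints are replaced by a penalty. Player \<open>i\<close> minimizes
  \<open>J\<^sub>i\<^sup>0 + \<Sum>\<^sub>l \<lambda>\<^sub>i\<^sup>l (J\<^sub>i\<^sup>l - \<kappa>\<^sub>i\<^sup>l)\<close>, where the multiplier \<open>\<lambda>\<^sub>i\<^sup>l \<in> [0, M]\<close> is a continuous
  function of \<open>J\<^sub>i\<^sup>l\<close> that vanishes as long as the constraint holds and equals \<open>M\<close> once it is violated by \<open>\<epsilon>\<close>.
  Comparing with a strategy that is feasible by (A3), approximate optimality for this objective gives
  approximate optimality for \<open>J\<^sub>i\<^sup>0\<close>, and a violation by more than \<open>\<epsilon>\<close> would cost \<open>M \<epsilon> > 2 b + \<epsilon>\<close>.

  With fixed multipliers the players solve discounted Markov decision problems. Since \<open>L\<^sup>1(\<mu>)\<close> is separable,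
  the states fall into countably many measurable cells on which the costs and the density are almost
  constant; by compactness of the action spaces and by discounting, finitely many cells and finitely many
  actions matter. Brouwer's theorem, applied to finite tables of \<open>Q\<close>-values, yields a strategy that draws only actions
  that are almost optimal for its own \<open>Q\<close>-values. This one-step optimality is almost preserved on the whole
  cells and against all actions, and telescoping extends it to all history-dependent deviations.
\<close>

section \<open>Brouwer's theorem on a finite-dimensional box\<close>

text \<open>A fixed point in the space of all stationary strategies is blocked: in the usual weak
  topologies that make this space compact, the costs need not be jointly continuous in the
  strategies of several players. Hence only finitely many numbers enter Brouwer's theorem, at the
  price of approximate optimality. No auxiliary finite game is built: the tables merely determine a
  strategy of the original game, and costs and Q-values are always computed there, so two games
  never have to be compared. Since the multipliers are functions of the costs of that same strategy,
  one fixed point settles strategies and multipliers together; in the deviation estimate the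
  multipliers are then mere constants. A play may run through infinitely many cells, so the number
  of tabulated cells has to be chosen before the strategy is known, with an escape bound that is
  uniform over all actions.\<close>

lemma bounded_seq_finite_coords_convergent:
  fixes X :: "nat \<Rightarrow> 'i \<Rightarrow> real"
  assumes "finite I" and "\<And>m i. i \<in> I \<Longrightarrow> X m i \<in> {l..h}"
  shows "\<exists>r x. strict_mono r \<and> (\<forall>i\<in>I. (\<lambda>m. X (r m) i) \<longlonglongrightarrow> x i \<and> x i \<in> {l..h})"
  using assms
proof (induction I rule: finite_induct)
  case empty
  show ?case by (auto intro!: exI[of _ id] simp: strict_mono_def)
next
  case (insert j I)
  then obtain r x where r: "strict_mono r"
    and x: "\<And>i. i \<in> I \<Longrightarrow> (\<lambda>m. X (r m) i) \<longlonglongrightarrow> x i \<and> x i \<in> {l..h}"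
    using insert.IH[OF insert.prems[OF insertI2]] by blast
  have "\<forall>m. X (r m) j \<in> {l..h}" using insert.prems by auto
  then obtain y s where y: "y \<in> {l..h}" and s: "strict_mono (s::nat\<Rightarrow>nat)" "((\<lambda>m. X (r m) j) \<circ> s) \<longlonglongrightarrow> y"
    using compact_Icc[of l h] unfolding compact_eq_seq_compact_metric seq_compact_def by metis
  have "(\<lambda>m. X ((r \<circ> s) m) i) \<longlonglongrightarrow> (x(j := y)) i \<and> (x(j := y)) i \<in> {l..h}" if "i \<in> insert j I" for i
  proof (cases "i = j")
    case True with y s show ?thesis by (simp add: o_def)
  next
    case False
    with that have "i \<in> I" by auto
    from LIMSEQ_subseq_LIMSEQ[OF conjunct1[OF x[OF this]] s(1)] x[OF this] False
    show ?thesis by (simp add: o_def)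
  qed
  with strict_mono_o[OF r s(1)] show ?case by blast
qed

text \<open>The dimension is a number that arises in the course of the proof, so the box consists of
  functions on the naturals rather than vectors of a Euclidean type, and continuity is taken along
  sequences, coordinate by coordinate. Kuhn's combinatorial lemma is applied on finer and finer
  grids; the cells it yields shrink to a fixed point.\<close>

lemma brouwer_nat_box:
  fixes f :: "(nat \<Rightarrow> real) \<Rightarrow> nat \<Rightarrow> real"
  assumes lh: "l < h"
    and range: "\<And>x i. (\<And>j. j < n \<Longrightarrow> x j \<in> {l..h}) \<Longrightarrow> i < n \<Longrightarrow> f x i \<in> {l..h}"
    and cont: "\<And>X x i. (\<And>m j. j < n \<Longrightarrow> X m j \<in> {l..h}) \<Longrightarrow> (\<And>j. j < n \<Longrightarrow> x j \<in> {l..h}) \<Longrightarrow>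
      (\<And>j. j < n \<Longrightarrow> (\<lambda>m. X m j) \<longlonglongrightarrow> x j) \<Longrightarrow> i < n \<Longrightarrow> (\<lambda>m. f (X m) i) \<longlonglongrightarrow> f x i"
  shows "\<exists>x. (\<forall>j<n. x j \<in> {l..h}) \<and> (\<forall>i<n. f x i = x i)"
proof -
  define pt where "pt p q j = l + (h - l) * real (q j) / real p" for p :: nat and q :: "nat \<Rightarrow> nat" and j
  have pt: "pt p q j \<in> {l..h}" if "0 < p" "q j \<le> p" for p q j
  proof -
    have "real (q j) / real p \<le> 1" using that by simp
    then have "(h - l) * (real (q j) / real p) \<le> (h - l) * 1"
      using lh by (intro mult_left_mono) auto
    then show ?thesis using lh by (auto simp: pt_def)
  qed
  define near where "near q r \<longleftrightarrow> (\<forall>j<n. q j \<le> r j \<and> r j \<le> q j + 1)" for q r :: "nat \<Rightarrow> nat"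
  \<comment> \<open>A discrete form of \<open>f x i = x i\<close> on the grid cell at
    \<open>q\<close>: both inequalities occur, though at corners that may vary with
    \<open>i\<close>.\<close>
  define good where "good p q i \<longleftrightarrow> (\<exists>r s. near q r \<and> near q s \<and> pt p r i \<le> f (pt p r) i \<and> f (pt p s) i \<le> pt p s i)"
    for p q i
  have key: "\<exists>q. \<forall>i<n. q i < p \<and> good p q i"
    if p: "0 < p" for p :: nat
  proof -
    \<comment> \<open>Kuhn's lemma prescribes label 0 on the lower and label 1 on the upper face of
      each coordinate. Because \<open>f\<close> maps into the box, these labels agree with the
      direction in which \<open>f\<close> weakly moves the coordinate.\<close>
    define lab :: "(nat \<Rightarrow> nat) \<Rightarrow> nat \<Rightarrow> nat"
      where "lab x i = (if x i = p \<or> (x i \<noteq> 0 \<and> f (pt p x) i < pt p x i) then 1 else 0)" for x i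
    obtain q where q: "\<forall>i<n. q i < p" and rs: "\<forall>i<n. \<exists>r s. near q r \<and> near q s \<and> lab r i \<noteq> lab s i"
      unfolding near_def
      by (rule kuhn_lemma[of p n lab]) (use p in \<open>auto simp: lab_def\<close>)
    have lab0: "pt p x i \<le> f (pt p x) i" if "lab x i = 0" "\<forall>j<n. x j \<le> p" "i < n" for x i
    proof (cases "x i = 0")
      case True
      have "f (pt p x) i \<in> {l..h}" using that p by (intro range pt) auto
      with True show ?thesis by (simp add: pt_def)
    qed (use that in \<open>auto simp: lab_def split: if_splits\<close>)
    have lab1: "f (pt p x) i \<le> pt p x i" if "lab x i \<noteq> 0" "\<forall>j<n. x j \<le> p" "i < n" for x i
    proof (cases "x i = p")
      case True
      have "f (pt p x) i \<in> {l..h}" using that p by (intro range pt) auto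
      with True p show ?thesis by (simp add: pt_def)
    qed (use that in \<open>auto simp: lab_def split: if_splits\<close>)
    have "good p q i" if i: "i < n" for i
    proof -
      obtain r s where r: "near q r" and s: "near q s" and ne: "lab r i \<noteq> lab s i"
        using rs i by blast
      have r': "\<forall>j<n. r j \<le> p" and s': "\<forall>j<n. s j \<le> p" using q r s unfolding near_def by fastforce+
      show ?thesis
      proof (cases "lab r i = 0")
        case True
        with ne have "lab s i \<noteq> 0" by simp
        from lab0[OF True r' i] lab1[OF this s' i] r s show ?thesis unfolding good_def by blast
      next
        case False
        with ne have "lab s i = 0" by (auto simp: lab_def split: if_splits)
        from lab0[OF this s' i] lab1[OF False r' i] r s show ?thesis unfolding good_def by blast
      qed
    qed
    with q show ?thesis by blast
  qed
  have "\<forall>m. \<exists>q. \<forall>i<n. q i < Suc m \<and> good (Suc m) q i"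
    using key by blast
  from choice[OF this] obtain Q where Q: "\<And>m i. i < n \<Longrightarrow> Q m i < Suc m" and "\<And>m i. i < n \<Longrightarrow> good (Suc m) (Q m) i"
    by blast
  then have "\<forall>m i. \<exists>r s. i < n \<longrightarrow> near (Q m) r \<and> near (Q m) s \<and>
      pt (Suc m) r i \<le> f (pt (Suc m) r) i \<and> f (pt (Suc m) s) i \<le> pt (Suc m) s i"
    unfolding good_def by blast
  then obtain R S where "\<And>m i. i < n \<Longrightarrow> near (Q m) (R m i)" "\<And>m i. i < n \<Longrightarrow> near (Q m) (S m i)"
    and Rf: "\<And>m i. i < n \<Longrightarrow> pt (Suc m) (R m i) i \<le> f (pt (Suc m) (R m i)) i"
    and Sf: "\<And>m i. i < n \<Longrightarrow> f (pt (Suc m) (S m i)) i \<le> pt (Suc m) (S m i) i"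
    by metis
  then have R: "\<And>m i j. i < n \<Longrightarrow> j < n \<Longrightarrow> Q m j \<le> R m i j \<and> R m i j \<le> Q m j + 1"
    and S: "\<And>m i j. i < n \<Longrightarrow> j < n \<Longrightarrow> Q m j \<le> S m i j \<and> S m i j \<le> Q m j + 1"
    unfolding near_def by blast+
  have "pt (Suc m) (Q m) j \<in> {l..h}" if "j \<in> {..<n}" for m j
    using Q[of j m] that by (intro pt) auto
  then obtain r x where r: "strict_mono r"
    and x: "\<And>j. j < n \<Longrightarrow> (\<lambda>m. pt (Suc (r m)) (Q (r m)) j) \<longlonglongrightarrow> x j" "\<And>j. j < n \<Longrightarrow> x j \<in> {l..h}"
    using bounded_seq_finite_coords_convergent[of "{..<n}" "\<lambda>m. pt (Suc m) (Q m)" l h]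
    unfolding Ball_def lessThan_iff by blast
  \<comment> \<open>All corners of a cell share the limit of the base corner, since they differ from
    it by at most the mesh. The inequalities at the corners \<open>R\<close> and \<open>S\<close>
    therefore meet at the one point \<open>x\<close>.\<close>
  have close: "(\<lambda>m. pt (Suc (r m)) (T (r m)) j) \<longlonglongrightarrow> x j"
    if T: "\<And>m. Q m j \<le> T m j \<and> T m j \<le> Q m j + 1" and j: "j < n" for T :: "nat \<Rightarrow> nat \<Rightarrow> nat" and j
  proof -
    have "(\<lambda>m. (h - l) / real (Suc m)) \<longlonglongrightarrow> 0"
      using lim_const_over_n[of "h - l"] LIMSEQ_Suc by blast
    from LIMSEQ_subseq_LIMSEQ[OF this r] have 0: "(\<lambda>m. (h - l) / real (Suc (r m))) \<longlonglongrightarrow> 0"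
      by (simp add: o_def)
    have "(\<lambda>m. pt (Suc (r m)) (T (r m)) j - pt (Suc (r m)) (Q (r m)) j) \<longlonglongrightarrow> 0"
    proof (rule real_tendsto_sandwich[OF _ _ tendsto_const 0])
      have *: "pt (Suc m) (T m) j - pt (Suc m) (Q m) j = (h - l) / real (Suc m) * (real (T m j) - real (Q m j))" for m
        by (simp add: pt_def field_simps del: of_nat_Suc)
      have "0 \<le> real (T m j) - real (Q m j)" "real (T m j) - real (Q m j) \<le> 1" for m
        using T[of m] by auto
      then have "0 \<le> pt (Suc m) (T m) j - pt (Suc m) (Q m) j"
        "pt (Suc m) (T m) j - pt (Suc m) (Q m) j \<le> (h - l) / real (Suc m)" for m
        unfolding * using lh mult_left_le[of "real (T m j) - real (Q m j)" "(h - l) / real (Suc m)"]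
        by (auto simp del: of_nat_Suc times_divide_eq_left times_divide_eq_right intro!: mult_nonneg_nonneg)
      then show "\<forall>\<^sub>F m in sequentially. 0 \<le> pt (Suc (r m)) (T (r m)) j - pt (Suc (r m)) (Q (r m)) j"
        "\<forall>\<^sub>F m in sequentially. pt (Suc (r m)) (T (r m)) j - pt (Suc (r m)) (Q (r m)) j \<le> (h - l) / real (Suc (r m))"
        by auto
    qed
    from tendsto_add[OF this x(1)[OF j]] show ?thesis by simp
  qed
  have bnd: "pt (Suc m) (T m) j \<in> {l..h}" if "Q m j \<le> T m j \<and> T m j \<le> Q m j + 1" "j < n"
    for T :: "nat \<Rightarrow> nat \<Rightarrow> nat" and m j
    using Q[OF that(2), of m] that by (intro pt) auto
  have "f x i = x i" if i: "i < n" for i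
  proof (rule antisym)
    have R1: "(\<lambda>m. pt (Suc (r m)) (R (r m) i) j) \<longlonglongrightarrow> x j" if "j < n" for j
      using close[of j "\<lambda>m. R m i"] R i that by auto
    have "(\<lambda>m. f (pt (Suc (r m)) (R (r m) i)) i) \<longlonglongrightarrow> f x i"
      using R i by (intro cont x R1) (auto intro!: bnd[of _ _ "\<lambda>m. R m i"] simp del: atLeastAtMost_iff)
    from LIMSEQ_le[OF R1[OF i] this] Rf[OF i] show "x i \<le> f x i" by auto
    have S1: "(\<lambda>m. pt (Suc (r m)) (S (r m) i) j) \<longlonglongrightarrow> x j" if "j < n" for j
      using close[of j "\<lambda>m. S m i"] S i that by auto
    have "(\<lambda>m. f (pt (Suc (r m)) (S (r m) i)) i) \<longlonglongrightarrow> f x i"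
      using S i by (intro cont x S1) (auto intro!: bnd[of _ _ "\<lambda>m. S m i"] simp del: atLeastAtMost_iff)
    from LIMSEQ_le[OF this S1[OF i]] Sf[OF i] show "f x i \<le> x i" by auto
  qed
  with x(2) show ?thesis by blast
qed

lemma brouwer_finite_box:
  fixes f :: "('i \<Rightarrow> real) \<Rightarrow> 'i \<Rightarrow> real"
  assumes I: "finite I" and lh: "l < h"
    and range: "\<And>x i. (\<And>j. j \<in> I \<Longrightarrow> x j \<in> {l..h}) \<Longrightarrow> i \<in> I \<Longrightarrow> f x i \<in> {l..h}"
    and cont: "\<And>X x i. (\<And>m j. j \<in> I \<Longrightarrow> X m j \<in> {l..h}) \<Longrightarrow> (\<And>j. j \<in> I \<Longrightarrow> x j \<in> {l..h}) \<Longrightarrow>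
      (\<And>j. j \<in> I \<Longrightarrow> (\<lambda>m. X m j) \<longlonglongrightarrow> x j) \<Longrightarrow> i \<in> I \<Longrightarrow> (\<lambda>m. f (X m) i) \<longlonglongrightarrow> f x i"
  obtains x where "\<And>j. j \<in> I \<Longrightarrow> x j \<in> {l..h}" "\<And>i. i \<in> I \<Longrightarrow> f x i = x i"
proof -
  obtain e where e: "bij_betw e {..<card I} I"
    using bij_betw_from_nat_into_finite[OF I] by blast
  define d where "d = the_inv_into {..<card I} e"
  have d: "d i < card I" "e (d i) = i" if "i \<in> I" for i
    using bij_betw_the_inv_into[OF e] that e f_the_inv_into_f_bij_betw[OF e]
    by (auto simp: d_def bij_betw_def)
  have de: "d (e n) = n" "e n \<in> I" if "n < card I" for n
    using e that by (auto simp: d_def bij_betw_def the_inv_into_f_f)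
  define g where "g y n = f (\<lambda>i. y (d i)) (e n)" for y n
  have "\<exists>y. (\<forall>j<card I. y j \<in> {l..h}) \<and> (\<forall>n<card I. g y n = y n)"
    unfolding g_def
    by (rule brouwer_nat_box[OF lh]; (rule range cont)?) (use d de in auto)
  then obtain y where y: "\<And>j. j < card I \<Longrightarrow> y j \<in> {l..h}" "\<And>n. n < card I \<Longrightarrow> g y n = y n" by blast
  show ?thesis
  proof
    show "y (d j) \<in> {l..h}" if "j \<in> I" for j using y(1) d that by auto
    show "f (\<lambda>i. y (d i)) i = y (d i)" if "i \<in> I" for i
      using y(2)[of "d i"] d[OF that] by (simp add: g_def)
  qed
qed

section \<open>Separability in \<open>L\<^sup>1\<close> and countable partitions\<close>

text \<open>Off the integrable functions the Bochner integral is 0 by convention, so this is a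
  pseudometric only among integrable functions; hence the integrability assumptions of the triangle
  inequalities.\<close>

definition L1_dist :: "'y measure \<Rightarrow> ('y \<Rightarrow> real) \<Rightarrow> ('y \<Rightarrow> real) \<Rightarrow> real" where
  "L1_dist M f g = (\<integral>y. \<bar>f y - g y\<bar> \<partial>M)"

lemma L1_dist_nonneg [simp]: "0 \<le> L1_dist M f g"
  by (simp add: L1_dist_def)

lemma L1_dist_commute: "L1_dist M f g = L1_dist M g f"
  by (simp add: L1_dist_def abs_minus_commute)

lemma L1_dist_self [simp]: "L1_dist M f f = 0"
  by (simp add: L1_dist_def)

lemma L1_dist_triangle:
  assumes "integrable M f" "integrable M g" "integrable M h"
  shows "L1_dist M f h \<le> L1_dist M f g + L1_dist M g h"
proof -
  have "L1_dist M f h \<le> (\<integral>y. \<bar>f y - g y\<bar> + \<bar>g y - h y\<bar> \<partial>M)"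
    unfolding L1_dist_def using assms by (intro integral_mono) auto
  also have "\<dots> = L1_dist M f g + L1_dist M g h"
    unfolding L1_dist_def using assms by (intro Bochner_Integration.integral_add) auto
  finally show ?thesis .
qed

lemma L1_dist_triangle4:
  assumes "integrable M f" "integrable M g" "integrable M h" "integrable M k"
  shows "L1_dist M f k \<le> L1_dist M f g + L1_dist M g h + L1_dist M k h"
  using L1_dist_triangle[OF assms(1,2,4)] L1_dist_triangle[OF assms(2,3,4)] by (simp add: L1_dist_commute)

lemma L1_dist_add:
  assumes "integrable M f" "integrable M g" "integrable M f'" "integrable M g'"
  shows "L1_dist M (\<lambda>y. f y + g y) (\<lambda>y. f' y + g' y) \<le> L1_dist M f f' + L1_dist M g g'"
proof -
  have "L1_dist M (\<lambda>y. f y + g y) (\<lambda>y. f' y + g' y) \<le> (\<integral>y. \<bar>f y - f' y\<bar> + \<bar>g y - g' y\<bar> \<partial>M)"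
    unfolding L1_dist_def using assms by (intro integral_mono) auto
  also have "\<dots> = L1_dist M f f' + L1_dist M g g'"
    unfolding L1_dist_def using assms by (intro Bochner_Integration.integral_add) auto
  finally show ?thesis .
qed

lemma L1_dist_mult:
  "L1_dist M (\<lambda>y. c * f y) (\<lambda>y. c * g y) = \<bar>c\<bar> * L1_dist M f g"
  by (simp add: L1_dist_def abs_mult flip: right_diff_distrib)

lemma L1_dist_mult_left:
  "L1_dist M (\<lambda>y. c * f y) (\<lambda>y. d * f y) = \<bar>c - d\<bar> * (\<integral>y. \<bar>f y\<bar> \<partial>M)"
  by (simp add: L1_dist_def abs_mult flip: left_diff_distrib)

lemma integral_diff_le_L1_dist:
  assumes f: "integrable M f" "integrable M g" and h: "h \<in> borel_measurable M"
    and B: "\<And>y. y \<in> space M \<Longrightarrow> \<bar>h y\<bar> \<le> B"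
  shows "\<bar>(\<integral>y. f y * h y \<partial>M) - (\<integral>y. g y * h y \<partial>M)\<bar> \<le> B * L1_dist M f g"
proof -
  have i: "integrable M (\<lambda>y. u y * h y)" if "integrable M u" for u :: "_ \<Rightarrow> real"
  proof (rule Bochner_Integration.integrable_bound)
    show "integrable M (\<lambda>y. B * u y)" using that by simp
    show "(\<lambda>y. u y * h y) \<in> borel_measurable M" using that h by measurable
    show "AE y in M. norm (u y * h y) \<le> norm (B * u y)"
      by (rule AE_I2) (use B in \<open>force simp: abs_mult mult.commute intro: mult_right_mono\<close>)
  qed
  have "(\<integral>y. f y * h y \<partial>M) - (\<integral>y. g y * h y \<partial>M) = (\<integral>y. (f y - g y) * h y \<partial>M)"
    by (simp add: left_diff_distrib i f Bochner_Integration.integral_diff)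
  also have "\<bar>\<dots>\<bar> \<le> (\<integral>y. \<bar>(f y - g y) * h y\<bar> \<partial>M)"
    by (rule integral_abs_bound)
  also have "\<dots> \<le> (\<integral>y. B * \<bar>f y - g y\<bar> \<partial>M)"
  proof (rule integral_mono)
    show "integrable M (\<lambda>y. \<bar>(f y - g y) * h y\<bar>)" using i[of "\<lambda>y. f y - g y"] f by auto
    show "\<bar>(f y - g y) * h y\<bar> \<le> B * \<bar>f y - g y\<bar>" if "y \<in> space M" for y
      using B[OF that] by (simp add: abs_mult mult.commute mult_right_mono)
  qed (use f in auto)
  finally show ?thesis by (simp add: L1_dist_def)
qed

definition L1_approximable :: "'y measure \<Rightarrow> ('y \<Rightarrow> real) set \<Rightarrow> ('y \<Rightarrow> real) \<Rightarrow> bool" where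
  "L1_approximable M S f \<longleftrightarrow> integrable M f \<and> (\<forall>e>0. \<exists>s\<in>S. L1_dist M f s < e)"

lemma L1_approximable_limit:
  assumes f: "integrable M f" and S: "\<And>s. s \<in> S \<Longrightarrow> integrable M s"
    and g: "\<And>e. e > 0 \<Longrightarrow> \<exists>g. L1_approximable M S g \<and> L1_dist M f g < e"
  shows "L1_approximable M S f"
  unfolding L1_approximable_def
proof (intro conjI f allI impI)
  fix e :: real assume "0 < e"
  then obtain g where g: "L1_approximable M S g" "L1_dist M f g < e / 2"
    using g[of "e / 2"] by auto
  then obtain s where s: "s \<in> S" "L1_dist M g s < e / 2"
    using \<open>0 < e\<close> unfolding L1_approximable_def by (meson half_gt_zero)
  have "L1_dist M f s \<le> L1_dist M f g + L1_dist M g s"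
    using f g s S by (intro L1_dist_triangle) (auto simp: L1_approximable_def)
  with g s show "\<exists>s\<in>S. L1_dist M f s < e" by (intro bexI[of _ s]) auto
qed

lemma L1_approximable_add:
  assumes S: "\<And>s. s \<in> S \<Longrightarrow> integrable M s"
    and add: "\<And>s t. s \<in> S \<Longrightarrow> t \<in> S \<Longrightarrow> (\<lambda>y. s y + t y) \<in> S"
    and f: "L1_approximable M S f" and g: "L1_approximable M S g"
  shows "L1_approximable M S (\<lambda>y. f y + g y)"
  unfolding L1_approximable_def
proof (intro conjI allI impI)
  fix e :: real assume "0 < e"
  then obtain s t where s: "s \<in> S" "L1_dist M f s < e / 2" and t: "t \<in> S" "L1_dist M g t < e / 2"
    using f g unfolding L1_approximable_def by (meson half_gt_zero)
  have "L1_dist M (\<lambda>y. f y + g y) (\<lambda>y. s y + t y) \<le> L1_dist M f s + L1_dist M g t"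
    using f g s t S by (intro L1_dist_add) (auto simp: L1_approximable_def)
  with s t show "\<exists>s\<in>S. L1_dist M (\<lambda>y. f y + g y) s < e"
    by (intro bexI[OF _ add[OF s(1) t(1)]]) auto
qed (use f g in \<open>auto simp: L1_approximable_def\<close>)

text \<open>Since \<open>S\<close> admits only rational factors, \<open>c\<close> is first replaced
  by a rational \<open>q\<close>, with an error measured against the norm of \<open>f\<close>, and
  then \<open>f\<close> by \<open>s\<close>, with an error measured against \<open>q\<close>. The 1
  added in the denominators keeps them positive.\<close>

lemma L1_approximable_mult:
  assumes S: "\<And>s. s \<in> S \<Longrightarrow> integrable M s"
    and mult: "\<And>s q. s \<in> S \<Longrightarrow> q \<in> \<rat> \<Longrightarrow> (\<lambda>y. q * s y) \<in> S"
    and f: "L1_approximable M S f"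
  shows "L1_approximable M S (\<lambda>y. c * f y)"
  unfolding L1_approximable_def
proof (intro conjI allI impI)
  fix e :: real assume e: "0 < e"
  define n where "n = (\<integral>y. \<bar>f y\<bar> \<partial>M)"
  have n: "0 \<le> n" by (simp add: n_def)
  have "c < c + e / (2 * (n + 1))" using e n by (simp add: add_nonneg_pos)
  then obtain q where q: "q \<in> \<rat>" "c < q" "q < c + e / (2 * (n + 1))"
    using Rats_dense_in_real by blast
  have "0 < e / (2 * (\<bar>q\<bar> + 1))" using e by (simp add: add_nonneg_pos)
  with f obtain s where s: "s \<in> S" "L1_dist M f s < e / (2 * (\<bar>q\<bar> + 1))"
    unfolding L1_approximable_def by blast
  have "L1_dist M (\<lambda>y. c * f y) (\<lambda>y. q * s y)
      \<le> L1_dist M (\<lambda>y. c * f y) (\<lambda>y. q * f y) + L1_dist M (\<lambda>y. q * f y) (\<lambda>y. q * s y)"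
    using f s S by (intro L1_dist_triangle) (auto simp: L1_approximable_def)
  also have "\<dots> = (q - c) * n + \<bar>q\<bar> * L1_dist M f s"
    using q by (simp add: L1_dist_mult L1_dist_mult_left n_def)
  also have "\<dots> < e / 2 + e / 2"
  proof (rule add_le_less_mono)
    have "q - c \<le> e / (2 * (n + 1))" using q by simp
    then have "(q - c) * (2 * (n + 1)) \<le> e" using n by (subst (asm) pos_le_divide_eq) auto
    moreover have "(q - c) * (2 * n) \<le> (q - c) * (2 * (n + 1))" using q by (intro mult_left_mono) auto
    ultimately show "(q - c) * n \<le> e / 2" by simp
    have "\<bar>q\<bar> * L1_dist M f s \<le> (\<bar>q\<bar> + 1) * L1_dist M f s"
      by (intro mult_right_mono) auto
    also have "\<dots> < (\<bar>q\<bar> + 1) * (e / (2 * (\<bar>q\<bar> + 1)))"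
      by (intro mult_strict_left_mono s) auto
    also have "\<dots> = e / 2" by (simp add: field_simps)
    finally show "\<bar>q\<bar> * L1_dist M f s < e / 2" .
  qed
  finally show "\<exists>s\<in>S. L1_dist M (\<lambda>y. c * f y) s < e"
    by (intro bexI[OF _ mult[OF s(1) q(1)]]) simp
qed (use f in \<open>auto simp: L1_approximable_def\<close>)

lemma L1_approximable_dominated_limit:
  assumes S: "\<And>s. s \<in> S \<Longrightarrow> integrable M s"
    and s: "\<And>i. L1_approximable M S (s i)" and f: "integrable M f" and w: "integrable M w"
    and lim: "\<And>y. y \<in> space M \<Longrightarrow> (\<lambda>i. s i y) \<longlonglongrightarrow> f y"
    and dom: "\<And>i y. y \<in> space M \<Longrightarrow> \<bar>s i y\<bar> \<le> w y"
  shows "L1_approximable M S f"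
proof (rule L1_approximable_limit[OF f S])
  fix e :: real assume "0 < e"
  have [measurable]: "s i \<in> borel_measurable M" "f \<in> borel_measurable M" for i
    using s f by (auto simp: L1_approximable_def)
  have "(\<lambda>i. \<integral>y. \<bar>f y - s i y\<bar> \<partial>M) \<longlonglongrightarrow> (\<integral>y. 0 \<partial>M)"
  proof (rule integral_dominated_convergence[where w="\<lambda>y. \<bar>f y\<bar> + w y"])
    show "AE y in M. (\<lambda>i. \<bar>f y - s i y\<bar>) \<longlonglongrightarrow> 0"
      using lim by (intro AE_I2 tendsto_rabs_zero) (simp add: LIM_zero_iff tendsto_diff[of "\<lambda>_. f y" "f y" _ _ "f y" for y, simplified])
    show "AE y in M. norm \<bar>f y - s i y\<bar> \<le> \<bar>f y\<bar> + w y" for i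
      by (rule AE_I2) (use dom[of _ i] in force)
  qed (use f w in auto)
  then have "\<forall>\<^sub>F i in sequentially. L1_dist M f (s i) < e"
    using \<open>0 < e\<close> by (auto simp: L1_dist_def order_tendstoD)
  then obtain i where "L1_dist M f (s i) < e"
    by (meson eventually_happens trivial_limit_sequentially)
  with s show "\<exists>g. L1_approximable M S g \<and> L1_dist M f g < e" by blast
qed auto

text \<open>Finite intersections of the generators form a countable family stable under
  intersection. The L1-closure of their rational combinations contains all measurable indicators by
  Dynkin's argument, and then all integrable functions.\<close>

lemma countable_L1_dense:
  assumes "prob_space M" and "countably_generated M"
  obtains S where "countable S" "\<And>s. s \<in> S \<Longrightarrow> integrable M s"
    "\<And>f e. integrable M f \<Longrightarrow> 0 < e \<Longrightarrow> \<exists>s\<in>S. L1_dist M f s < e"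
proof -
  interpret prob_space M by fact
  obtain G where G: "countable G" "G \<subseteq> Pow (space M)" "sets M = sigma_sets (space M) G"
    using assms(2) by (auto simp: countably_generated_def)
  define P where "P = (\<lambda>F. space M \<inter> \<Inter>F) ` {F. finite F \<and> F \<subseteq> G}"
  have cP: "countable P"
    unfolding P_def by (intro countable_image countable_Collect_finite_subset G(1))
  have P_sets: "P \<subseteq> sets M"
  proof (safe elim!: P_def[THEN equalityD1, THEN subsetD, THEN imageE])
    fix F assume F: "finite F" "F \<subseteq> G"
    show "space M \<inter> \<Inter>F \<in> sets M"
    proof (cases "F = {}")
      case False
      have "F \<subseteq> sets M" using F G(3) by auto
      with F False have "(\<Inter>A\<in>F. A) \<in> sets M" by (intro sets.finite_INT) auto
      then show ?thesis by auto
    qed simp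
  qed
  have P_Int: "Int_stable P"
  proof (rule Int_stableI)
    fix a b assume "a \<in> P" "b \<in> P"
    then obtain F F' where F: "a = space M \<inter> \<Inter>F" "finite F" "F \<subseteq> G" "b = space M \<inter> \<Inter>F'" "finite F'" "F' \<subseteq> G"
      by (auto simp: P_def)
    then show "a \<inter> b \<in> P" unfolding P_def by (intro image_eqI[of _ _ "F \<union> F'"]) auto
  qed
  have "G \<subseteq> P"
  proof
    fix g assume "g \<in> G"
    with G(2) show "g \<in> P" unfolding P_def by (intro image_eqI[of _ _ "{g}"]) auto
  qed
  then have sP: "sets M = sigma_sets (space M) P"
    using G(3) P_sets sets.sigma_sets_subset[OF P_sets] sigma_sets_mono'[OF \<open>G \<subseteq> P\<close>, of "space M"] by auto
  \<comment> \<open>Combinations are coded by lists, so that addition is concatenation and scaling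
    maps over the list; repeated sets do no harm.\<close>
  define S where "S = (\<lambda>xs y. \<Sum>(q, A)\<leftarrow>xs. q * indicator A y :: real) ` lists (\<rat> \<times> P)"
  have cS: "countable S"
    unfolding S_def using cP by (intro countable_image countable_lists countable_SIGMA countable_rat)
  have "integrable M (\<lambda>y. \<Sum>(q, A)\<leftarrow>xs. q * indicator A y :: real)" if "xs \<in> lists (\<rat> \<times> P)" for xs
    using that
  proof (induction xs)
    case (Cons x xs)
    obtain q A where x: "x = (q, A)" by fastforce
    with Cons have "A \<in> sets M" using P_sets by auto
    then have "integrable M (\<lambda>y. q * indicator A y)"
      by (intro integrable_mult_right integrable_real_indicator) (auto simp: emeasure_eq_measure)
    with Cons x show ?case by simp
  qed simp
  then have iS: "integrable M s" if "s \<in> S" for s using that by (auto simp: S_def)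
  have aS: "(\<lambda>y. s y + t y) \<in> S" if st: "s \<in> S" "t \<in> S" for s t
  proof -
    obtain xs ys where "xs \<in> lists (\<rat> \<times> P)" "ys \<in> lists (\<rat> \<times> P)"
      "s = (\<lambda>y. \<Sum>(q, A)\<leftarrow>xs. q * indicator A y)" "t = (\<lambda>y. \<Sum>(q, A)\<leftarrow>ys. q * indicator A y)"
      using st by (auto simp: S_def)
    then show ?thesis unfolding S_def by (intro image_eqI[of _ _ "xs @ ys"]) auto
  qed
  have mS: "(\<lambda>y. q * s y) \<in> S" if s: "s \<in> S" "q \<in> \<rat>" for s q
  proof -
    obtain xs where xs: "xs \<in> lists (\<rat> \<times> P)" "s = (\<lambda>y. \<Sum>(q, A)\<leftarrow>xs. q * indicator A y)"
      using s by (auto simp: S_def)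
    have "q * (\<Sum>(q, A)\<leftarrow>xs. q * indicator A y) = (\<Sum>(q, A)\<leftarrow>map (\<lambda>(r, A). (q * r, A)) xs. q * indicator A y)" for y
      by (induction xs) (auto simp: algebra_simps)
    moreover have "map (\<lambda>(r, A). (q * r, A)) xs \<in> lists (\<rat> \<times> P)"
      using xs(1) s(2) by (auto simp: lists_eq_set intro!: Rats_mult)
    ultimately show ?thesis unfolding S_def xs(2) by (intro image_eqI[of _ _ "map (\<lambda>(r, A). (q * r, A)) xs"]) auto
  qed
  have P_S: "indicator A \<in> S" if "A \<in> P" for A
    unfolding S_def using that by (intro image_eqI[of _ _ "[(1, A)]"]) auto
  note approx = L1_approximable_add[OF iS aS] L1_approximable_mult[OF iS mS]
  have P_app: "L1_approximable M S (indicator A)" if "A \<in> P" for A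
    unfolding L1_approximable_def using P_S[OF that] iS[OF P_S[OF that]]
    by (auto intro!: bexI[of _ "indicator A"])
  have ind: "L1_approximable M S (indicator A)" if "A \<in> sets M" for A
    using P_Int sets.space_closed[of M, THEN order_trans[OF P_sets]] that[unfolded sP]
  proof (induction rule: sigma_sets_induct_disjoint)
    case (basic A) then show ?case by (rule P_app)
  next
    case empty
    have "L1_approximable M S (\<lambda>y. 0 * indicator (space M) y)"
      by (intro approx P_app) (auto simp: P_def intro: image_eqI[of _ _ "{}"])
    then show ?case by (simp add: indicator_def[abs_def])
  next
    case (compl A)
    then have A: "A \<in> sets M" using sP by auto
    have "L1_approximable M S (\<lambda>y. indicator (space M) y + (-1) * indicator A y)"
      by (intro approx P_app compl) (auto simp: P_def intro: image_eqI[of _ _ "{}"])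
    moreover have "L1_dist M f (\<lambda>y. indicator (space M) y + (-1) * indicator A y) = L1_dist M f (indicator (space M - A))" for f
      unfolding L1_dist_def by (intro Bochner_Integration.integral_cong) (auto split: split_indicator)
    ultimately show ?case using A
      unfolding L1_approximable_def L1_dist_commute[of M "indicator (space M - A)"] L1_dist_commute[of M "\<lambda>y. indicator (space M) y + (-1) * indicator A y"]
      by (auto simp: emeasure_eq_measure intro!: integrable_real_indicator)
  next
    case (union A)
    then have A: "A i \<in> sets M" for i using sP by auto
    have fin: "L1_approximable M S (\<lambda>y. \<Sum>i<n. indicator (A i) y)" for n
    proof (induction n)
      case 0
      have "L1_approximable M S (\<lambda>y. 0 * indicator (space M) y)"
        by (intro approx P_app) (auto simp: P_def intro: image_eqI[of _ _ "{}"])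
      then show ?case by simp
    next
      case (Suc n)
      then show ?case using union(3) by (auto intro!: approx)
    qed
    \<comment> \<open>By disjointness the partial sums are indicators themselves, so the constant 1
      dominates them.\<close>
    have eq: "(\<Sum>i<n. indicator (A i) y) = (indicator (\<Union>i<n. A i) y :: real)" for n y
      using union(1) by (subst indicator_UN_disjoint) (auto simp: disjoint_family_on_def)
    show ?case
    proof (rule L1_approximable_dominated_limit[OF iS fin, where w="\<lambda>_. 1"])
      show "integrable M (indicator (\<Union> (range A)) :: _ \<Rightarrow> real)"
        using A by (intro integrable_real_indicator) (auto simp: emeasure_eq_measure)
      show "(\<lambda>n. \<Sum>i<n. indicator (A i) y) \<longlonglongrightarrow> (indicator (\<Union> (range A)) y :: real)" for y
        unfolding eq by (rule LIMSEQ_indicator_UN)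
      show "\<bar>\<Sum>i<n. indicator (A i) y\<bar> \<le> (1::real)" for n y
        unfolding eq by (auto split: split_indicator)
    qed auto
  qed
  have "L1_approximable M S f" if "integrable M f" for f
    using that
  proof (induction rule: integrable_induct)
    case (base A c)
    have "L1_approximable M S (\<lambda>y. c * indicator A y)" by (intro approx ind base)
    then show ?case by (simp add: mult.commute)
  next
    case (add f g) then show ?case by (intro approx)
  next
    case (lim f s)
    show ?case
      by (rule L1_approximable_dominated_limit[OF iS, where s=s and w="\<lambda>y. 2 * \<bar>f y\<bar>"]) (use lim in auto)
  qed
  then show ?thesis
    by (intro that[OF cS iS]) (auto simp: L1_approximable_def)
qed

text \<open>Heine-Cantor for an L1-valued map: along a violating pair of sequences both members have
  a common limit in the compact set, which contradicts continuity at that limit.\<close>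

lemma L1_uniformly_continuous:
  fixes k :: "'b::metric_space \<Rightarrow> 'y \<Rightarrow> real"
  assumes "compact A" and int: "\<And>a. a \<in> A \<Longrightarrow> integrable M (k a)"
    and cont: "\<And>a s. a \<in> A \<Longrightarrow> (\<And>n. s n \<in> A) \<Longrightarrow> s \<longlonglongrightarrow> a \<Longrightarrow> (\<lambda>n. L1_dist M (k (s n)) (k a)) \<longlonglongrightarrow> 0"
    and e: "0 < e"
  shows "\<exists>d>0. \<forall>a\<in>A. \<forall>a'\<in>A. dist a a' < d \<longrightarrow> L1_dist M (k a) (k a') < e"
proof (rule ccontr)
  assume neg: "\<not> ?thesis"
  have "\<forall>n. \<exists>a a'. a \<in> A \<and> a' \<in> A \<and> dist a a' < 1 / real (Suc n) \<and> e \<le> L1_dist M (k a) (k a')"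
  proof (intro allI)
    fix n
    have "0 < 1 / real (Suc n)" by simp
    with neg show "\<exists>a a'. a \<in> A \<and> a' \<in> A \<and> dist a a' < 1 / real (Suc n) \<and> e \<le> L1_dist M (k a) (k a')"
      by (meson not_le)
  qed
  then obtain s t where s: "\<And>n. s n \<in> A" and t: "\<And>n. t n \<in> A"
    and st: "\<And>n. dist (s n) (t n) < 1 / real (Suc n)" "\<And>n. e \<le> L1_dist M (k (s n)) (k (t n))"
    by metis
  obtain a r where a: "a \<in> A" and r: "strict_mono (r::nat\<Rightarrow>nat)" "(s \<circ> r) \<longlonglongrightarrow> a"
    using \<open>compact A\<close> s unfolding compact_eq_seq_compact_metric seq_compact_def by metis
  have "(\<lambda>n. dist (s n) (t n)) \<longlonglongrightarrow> 0"
    by (rule real_tendsto_sandwich[OF _ _ tendsto_const LIMSEQ_Suc[OF lim_const_over_n[of 1]]])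
      (use st(1) in \<open>auto intro!: always_eventually less_imp_le simp del: of_nat_Suc\<close>)
  from LIMSEQ_subseq_LIMSEQ[OF this r(1)] have "(\<lambda>n. dist ((s \<circ> r) n) ((t \<circ> r) n)) \<longlonglongrightarrow> 0"
    by (simp add: o_def)
  from tendsto_add[OF this tendsto_dist_iff[THEN iffD1, OF r(2)]]
  have "(\<lambda>n. dist ((s \<circ> r) n) ((t \<circ> r) n) + dist ((s \<circ> r) n) a) \<longlonglongrightarrow> 0"
    by simp
  from real_tendsto_sandwich[OF always_eventually always_eventually tendsto_const this]
  have "(\<lambda>n. dist ((t \<circ> r) n) a) \<longlonglongrightarrow> 0"
    by (simp add: dist_triangle3)
  then have "(t \<circ> r) \<longlonglongrightarrow> a"
    by (rule tendsto_dist_iff[THEN iffD2])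
  from cont[OF a _ this] cont[OF a _ r(2)] s t
  have "(\<lambda>n. L1_dist M (k ((s \<circ> r) n)) (k a) + L1_dist M (k ((t \<circ> r) n)) (k a)) \<longlonglongrightarrow> 0 + 0"
    by (intro tendsto_add) auto
  then have "\<forall>\<^sub>F n in sequentially. L1_dist M (k ((s \<circ> r) n)) (k a) + L1_dist M (k ((t \<circ> r) n)) (k a) < e"
    using e by (intro order_tendstoD) auto
  then obtain n where "L1_dist M (k ((s \<circ> r) n)) (k a) + L1_dist M (k ((t \<circ> r) n)) (k a) < e"
    by (meson eventually_happens trivial_limit_sequentially)
  moreover have "L1_dist M (k (s (r n))) (k (t (r n))) \<le> L1_dist M (k (s (r n))) (k a) + L1_dist M (k a) (k (t (r n)))"
    using s t a by (intro L1_dist_triangle int)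
  ultimately show False
    using st(2)[of "r n"] by (simp add: L1_dist_commute[of M "k a"])
qed

lemma compact_finite_net:
  fixes A :: "'b::metric_space set"
  assumes "compact A" "0 < e"
  obtains F where "finite F" "F \<subseteq> A" "\<And>a. a \<in> A \<Longrightarrow> \<exists>b\<in>F. dist a b < e"
proof -
  have "A \<subseteq> (\<Union>a\<in>A. ball a e)" using \<open>0 < e\<close> by auto
  with \<open>compact A\<close> obtain F where F: "F \<subseteq> A" "finite F" "A \<subseteq> (\<Union>a\<in>F. ball a e)"
    by (elim compactE_image) auto
  then show thesis by (intro that[of F]) (auto simp: dist_commute[of a for a] subset_eq)
qed

text \<open>Each state is a continuous L1-valued function on the compact \<open>A\<close>, and such
  functions form a separable space. Concretely, a state is coded by a modulus of uniform continuity
  and by approximants from a countable dense set at the points of a finite net. The code rests on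
  choices and need not be measurable in the state; it only serves to produce countably many
  representatives. The cell index is the least representative close to the state, and this condition
  is measurable.\<close>

lemma L1_continuous_family_countable_partition:
  fixes k :: "'b::metric_space \<Rightarrow> 'x \<Rightarrow> 'y \<Rightarrow> real"
  assumes M: "prob_space M" "countably_generated M" and A: "compact A" and N: "space N \<noteq> {}"
    and meas: "\<And>a. a \<in> A \<Longrightarrow> (\<lambda>(x, y). k a x y) \<in> borel_measurable (N \<Otimes>\<^sub>M M)"
    and int: "\<And>x a. x \<in> space N \<Longrightarrow> a \<in> A \<Longrightarrow> integrable M (k a x)"
    and cont: "\<And>x a s. x \<in> space N \<Longrightarrow> a \<in> A \<Longrightarrow> (\<And>n. s n \<in> A) \<Longrightarrow> s \<longlonglongrightarrow> a \<Longrightarrow>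
      (\<lambda>n. L1_dist M (k (s n) x) (k a x)) \<longlonglongrightarrow> 0"
    and e: "0 < e"
  shows "\<exists>C. C \<in> N \<rightarrow>\<^sub>M count_space (UNIV :: nat set) \<and>
    (\<forall>x\<in>space N. \<forall>x'\<in>space N. C x = C x' \<longrightarrow> (\<forall>a\<in>A. L1_dist M (k a x) (k a x') \<le> e))"
proof -
  interpret prob_space M by fact
  obtain S where S: "countable S" "\<And>s. s \<in> S \<Longrightarrow> integrable M s"
    "\<And>f e. integrable M f \<Longrightarrow> 0 < e \<Longrightarrow> \<exists>s\<in>S. L1_dist M f s < e"
    using countable_L1_dense[OF M] by metis
  have "\<forall>n. \<exists>F. finite F \<and> F \<subseteq> A \<and> (\<forall>a\<in>A. \<exists>b\<in>F. dist a b < 1 / real (Suc n))"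
  proof (intro allI)
    fix n
    have "0 < 1 / real (Suc n)" by simp
    from compact_finite_net[OF A this] show "\<exists>F. finite F \<and> F \<subseteq> A \<and> (\<forall>a\<in>A. \<exists>b\<in>F. dist a b < 1 / real (Suc n))"
      by metis
  qed
  from choice[OF this] obtain net where net: "\<And>n. finite (net n)" "\<And>n. net n \<subseteq> A"
    "\<And>n a. a \<in> A \<Longrightarrow> \<exists>b\<in>net n. dist a b < 1 / real (Suc n)"
    by blast
  have unif: "\<exists>n. \<forall>a\<in>A. \<forall>a'\<in>A. dist a a' < 1 / real (Suc n) \<longrightarrow> L1_dist M (k a x) (k a' x) < d"
    if x: "x \<in> space N" and "0 < d" for x d
  proof -
    obtain r where r: "0 < r" "\<forall>a\<in>A. \<forall>a'\<in>A. dist a a' < r \<longrightarrow> L1_dist M (k a x) (k a' x) < d"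
      using L1_uniformly_continuous[OF A, of M "\<lambda>a. k a x", OF int[OF x] cont[OF x] \<open>0 < d\<close>] by blast
    obtain n where "1 / real (Suc n) < r" using nat_approx_posE[OF r(1)] by blast
    with r(2) show ?thesis by (meson less_trans)
  qed
  define A0 where "A0 = (\<Union>n. net n)"
  have A0: "countable A0" "A0 \<subseteq> A"
    unfolding A0_def using net by (auto intro: countable_finite)
  \<comment> \<open>Two states with equal codes differ by at most four errors of
    \<open>e / 8\<close>, that is by \<open>e / 2\<close>; two states of one cell are each within
    \<open>e / 2\<close> of the same representative.\<close>
  define e8 where "e8 = e / 8"
  have e8: "0 < e8" using e by (simp add: e8_def)
  have "\<forall>x\<in>space N. \<exists>n. \<forall>a\<in>A. \<forall>a'\<in>A. dist a a' < 1 / real (Suc n) \<longrightarrow> L1_dist M (k a x) (k a' x) < e8"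
    using unif e8 by blast
  from bchoice[OF this] obtain n where n: "\<And>x a a'. x \<in> space N \<Longrightarrow> a \<in> A \<Longrightarrow> a' \<in> A \<Longrightarrow>
      dist a a' < 1 / real (Suc (n x)) \<Longrightarrow> L1_dist M (k a x) (k a' x) < e8"
    by blast
  have "\<forall>x a. \<exists>s. x \<in> space N \<longrightarrow> a \<in> A \<longrightarrow> s \<in> S \<and> L1_dist M (k a x) s < e8"
    using S(3)[OF int e8] by blast
  then obtain s where s: "\<And>x a. x \<in> space N \<Longrightarrow> a \<in> A \<Longrightarrow> s x a \<in> S"
    "\<And>x a. x \<in> space N \<Longrightarrow> a \<in> A \<Longrightarrow> L1_dist M (k a x) (s x a) < e8"
    by metis
  define \<tau> where "\<tau> x = (n x, restrict (s x) (net (n x)))" for x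
  have close: "L1_dist M (k a x) (k a x') \<le> e / 2"
    if x: "x \<in> space N" "x' \<in> space N" and eq: "\<tau> x = \<tau> x'" and a: "a \<in> A" for x x' a
  proof -
    obtain b where b: "b \<in> net (n x)" "dist a b < 1 / real (Suc (n x))" using net(3)[OF a] by blast
    then have bA: "b \<in> A" using net(2) by auto
    have n': "n x = n x'" using eq by (simp add: \<tau>_def)
    have s': "s x b = s x' b"
      using eq b(1) unfolding \<tau>_def by (metis (no_types, lifting) prod.inject restrict_apply')
    have "L1_dist M (k a x) (k a x') \<le> L1_dist M (k a x) (k b x) + L1_dist M (k b x) (s x b) + L1_dist M (k a x') (s x b)"
      by (intro L1_dist_triangle4 int x a bA S s)
    also have "L1_dist M (k a x') (s x b) \<le> L1_dist M (k a x') (k b x') + L1_dist M (k b x') (s x' b)"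
      unfolding s' by (intro L1_dist_triangle int x a bA S s)
    also have "L1_dist M (k a x) (k b x) + L1_dist M (k b x) (s x b) +
        (L1_dist M (k a x') (k b x') + L1_dist M (k b x') (s x' b)) \<le> e8 + e8 + (e8 + e8)"
      by (intro add_mono less_imp_le n s x a bA) (use b n' in auto)
    finally show ?thesis by (simp add: e8_def)
  qed
  have "\<tau> ` space N \<subseteq> (SIGMA n:UNIV. PiE (net n) (\<lambda>_. S))"
    using s(1) subsetD[OF net(2)] by (auto simp: \<tau>_def)
  moreover have "countable (SIGMA n:UNIV. PiE (net n) (\<lambda>_. S))"
    using S(1) net(1) by (intro countable_SIGMA countable_PiE) auto
  ultimately have cT: "countable (\<tau> ` space N)" by (rule countable_subset)
  define rep where "rep m = (SOME x. x \<in> space N \<and> \<tau> x = from_nat_into (\<tau> ` space N) m)" for m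
  have rep: "rep m \<in> space N \<and> \<tau> (rep m) = from_nat_into (\<tau> ` space N) m" for m
  proof -
    have "from_nat_into (\<tau> ` space N) m \<in> \<tau> ` space N" using N by (intro from_nat_into) auto
    then have "\<exists>x. x \<in> space N \<and> \<tau> x = from_nat_into (\<tau> ` space N) m" by force
    then show ?thesis unfolding rep_def by (rule someI_ex)
  qed
  \<comment> \<open>Closeness is demanded only on the countable dense set \<open>A0\<close> of
    actions. This is a countable conjunction of conditions on parameter integrals, hence
    measurable.\<close>
  define P where "P m x \<longleftrightarrow> (\<forall>a\<in>A0. L1_dist M (k a x) (k a (rep m)) \<le> e / 2)" for m x
  define C where "C x = (LEAST m. P m x)" for x
  have [measurable]: "Measurable.pred N (P m)" for m
  proof -
    have "(\<lambda>x. L1_dist M (k a x) (k a (rep m))) \<in> borel_measurable N" if "a \<in> A0" for a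
    proof -
      have a: "a \<in> A" using that A0 by auto
      note [measurable] = meas[OF a]
      have [measurable]: "k a (rep m) \<in> borel_measurable M"
        using int[OF conjunct1[OF rep] a] by auto
      have "(\<lambda>(x, y). \<bar>k a x y - k a (rep m) y\<bar>) \<in> borel_measurable (N \<Otimes>\<^sub>M M)"
        by measurable
      then show ?thesis unfolding L1_dist_def by (rule borel_measurable_lebesgue_integral)
    qed
    then have "{x \<in> space N. L1_dist M (k a x) (k a (rep m)) \<le> e / 2} \<in> sets N" if "a \<in> A0" for a
      using that by measurable
    then show ?thesis
      unfolding P_def pred_def by (rule sets.sets_Collect_countable_All'[OF _ A0(1)])
  qed
  have "C \<in> N \<rightarrow>\<^sub>M count_space UNIV" unfolding C_def by measurable
  moreover have PC: "P (C x) x" if x: "x \<in> space N" for x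
  proof -
    obtain m where "from_nat_into (\<tau> ` space N) m = \<tau> x"
      using from_nat_into_surj[OF cT, of "\<tau> x"] x by blast
    with rep[of m] close[OF x, of "rep m"] A0(2) have "P m x" by (auto simp: P_def)
    then show ?thesis unfolding C_def by (rule LeastI)
  qed
  moreover have "L1_dist M (k a x) (k a x') \<le> e"
    if x: "x \<in> space N" "x' \<in> space N" and eq: "C x = C x'" and a: "a \<in> A" for x x' a
  proof (rule field_le_epsilon)
    \<comment> \<open>Closeness on \<open>A0\<close> extends to the action \<open>a\<close> by
      uniform continuity at both states; the net has to be fine enough for both moduli.\<close>
    fix d :: real assume "0 < d"
    then have d2: "0 < d / 2" by simp
    obtain n where n: "\<forall>a\<in>A. \<forall>a'\<in>A. dist a a' < 1 / real (Suc n) \<longrightarrow> L1_dist M (k a x) (k a' x) < d / 2"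
      using unif[OF x(1) d2] by blast
    obtain n' where n': "\<forall>a\<in>A. \<forall>a'\<in>A. dist a a' < 1 / real (Suc n') \<longrightarrow> L1_dist M (k a x') (k a' x') < d / 2"
      using unif[OF x(2) d2] by blast
    obtain b where b: "b \<in> net (max n n')" "dist a b < 1 / real (Suc (max n n'))" using net(3)[OF a] by blast
    then have bA: "b \<in> A" "b \<in> A0" using net(2) by (auto simp: A0_def)
    have db: "dist a b < 1 / real (Suc n)" "dist a b < 1 / real (Suc n')"
      using b(2) by (auto elim!: less_le_trans simp del: of_nat_Suc intro!: divide_left_mono)
    let ?r = "rep (C x)"
    have r: "?r \<in> space N" using rep by blast
    have "L1_dist M (k a x) (k a x') \<le> L1_dist M (k a x) (k b x) + L1_dist M (k b x) (k b ?r) + L1_dist M (k a x') (k b ?r)"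
      by (intro L1_dist_triangle4 int x a bA r)
    also have "L1_dist M (k a x') (k b ?r) \<le> L1_dist M (k a x') (k b x') + L1_dist M (k b x') (k b ?r)"
      by (intro L1_dist_triangle int x a bA r)
    also have "L1_dist M (k a x) (k b x) + L1_dist M (k b x) (k b ?r) +
        (L1_dist M (k a x') (k b x') + L1_dist M (k b x') (k b ?r)) \<le> d / 2 + e / 2 + (d / 2 + e / 2)"
    proof (intro add_mono)
      show "L1_dist M (k a x) (k b x) \<le> d / 2" "L1_dist M (k a x') (k b x') \<le> d / 2"
        using n n' a bA db by (auto intro: less_imp_le)
      show "L1_dist M (k b x) (k b ?r) \<le> e / 2" "L1_dist M (k b x') (k b ?r) \<le> e / 2"
        using PC[OF x(1)] PC[OF x(2)] bA unfolding eq[symmetric] P_def by blast+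
    qed
    finally show "L1_dist M (k a x) (k a x') \<le> e + d" by simp
  qed
  ultimately show ?thesis by blast
qed

lemma finite_common_refinement:
  assumes "finite J" and "\<And>j. j \<in> J \<Longrightarrow> C j \<in> N \<rightarrow>\<^sub>M count_space (UNIV :: nat set)"
  shows "\<exists>D. D \<in> N \<rightarrow>\<^sub>M count_space (UNIV :: nat set) \<and>
    (\<forall>x x'. D x = D x' \<longrightarrow> (\<forall>j\<in>J. C j x = C j x'))"
  using assms
proof (induction J rule: finite_induct)
  case (insert j J)
  then obtain D where [measurable]: "D \<in> N \<rightarrow>\<^sub>M count_space (UNIV :: nat set)"
    and D: "\<And>x x' j. D x = D x' \<Longrightarrow> j \<in> J \<Longrightarrow> C j x = C j x'"
    using insert.IH[OF insert.prems[OF insertI2]] by blast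
  have [measurable]: "C j \<in> N \<rightarrow>\<^sub>M count_space UNIV" using insert.prems by auto
  have "(\<lambda>x. prod_encode (C j x, D x)) \<in> N \<rightarrow>\<^sub>M count_space UNIV"
    by measurable
  moreover have "\<forall>x x'. prod_encode (C j x, D x) = prod_encode (C j x', D x') \<longrightarrow> (\<forall>j\<in>insert j J. C j x = C j x')"
  proof (intro allI impI ballI)
    fix x x' i
    assume "prod_encode (C j x, D x) = prod_encode (C j x', D x')" and i: "i \<in> insert j J"
    then have "C j x = C j x'" "D x = D x'" by (simp_all add: prod_encode_eq)
    with i D show "C i x = C i x'" by blast
  qed
  ultimately show ?case by blast
qed (auto intro!: exI[of _ "\<lambda>_. 0"])

section \<open>The law of a play\<close>

lemma bounded_integrable:
  fixes f :: "'a \<Rightarrow> real"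
  assumes "finite_measure M" "f \<in> borel_measurable M" "\<And>x. x \<in> space M \<Longrightarrow> \<bar>f x\<bar> \<le> B"
  shows "integrable M f"
proof -
  interpret finite_measure M by fact
  show ?thesis using assms by (intro integrable_const_bound[of _ B]) auto
qed

text \<open>For nonintegrable \<open>f\<close> the integral is 0 by convention, and \<open>B\<close>
  is nonnegative because a probability space has a point at which to evaluate the bound.\<close>

lemma abs_integral_le_bound:
  fixes f :: "'a \<Rightarrow> real"
  assumes "prob_space M" and "\<And>x. x \<in> space M \<Longrightarrow> \<bar>f x\<bar> \<le> B"
  shows "\<bar>\<integral>x. f x \<partial>M\<bar> \<le> B"
proof (cases "integrable M f")
  case True
  interpret prob_space M by fact
  have "\<bar>\<integral>x. f x \<partial>M\<bar> \<le> (\<integral>x. \<bar>f x\<bar> \<partial>M)" by (rule integral_abs_bound)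
  also have "\<dots> \<le> (\<integral>x. B \<partial>M)" using True assms(2) by (intro integral_mono) auto
  finally show ?thesis by (simp add: prob_space)
next
  case False
  interpret prob_space M by fact
  obtain x where "x \<in> space M" using not_empty by blast
  from order_trans[OF abs_ge_zero assms(2)[OF this]] False
  show ?thesis by (simp add: not_integrable_integral_eq)
qed

lemma integral_bind_bounded:
  fixes f :: "'b \<Rightarrow> real"
  assumes K: "K \<in> M \<rightarrow>\<^sub>M prob_algebra N" and M: "prob_space M"
    and f: "f \<in> borel_measurable N" and B: "\<And>y. y \<in> space N \<Longrightarrow> \<bar>f y\<bar> \<le> B"
  shows "(\<integral>y. f y \<partial>(M \<bind> K)) = (\<integral>x. (\<integral>y. f y \<partial>K x) \<partial>M)"
proof -
  interpret prob_space M by fact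
  have K': "K \<in> M \<rightarrow>\<^sub>M subprob_algebra N" by (rule measurable_prob_algebraD[OF K])
  show ?thesis
  proof (rule integral_bind[where B=B and B'=1, OF f _ K'])
    show "finite_measure M" by unfold_locales
    show "AE x in M. emeasure (K x) (space (K x)) \<le> ennreal 1"
    proof (rule AE_I2)
      fix x assume "x \<in> space M"
      from measurable_space[OF K this] have "prob_space (K x)" by (auto simp: space_prob_algebra)
      then show "emeasure (K x) (space (K x)) \<le> ennreal 1"
        by (simp add: prob_space.emeasure_space_1)
    qed
  qed (use B in auto)
qed

section \<open>One-step look-ahead in a constrained stochastic game\<close>

locale csg_game =
  fixes G :: "('x, 'a::metric_space) csg"
  assumes game: "constrained_stochastic_game G"
begin

abbreviation "\<X> \<equiv> space (states G)"

abbreviation "\<A> \<equiv> profiles G"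

abbreviation "\<K> \<equiv> stage_space G"

abbreviation "\<L> \<equiv> insert 0 (constraints G)"

abbreviation "stat \<phi> \<equiv> (\<lambda>i. stationary (\<phi> i))"

lemma finite_players [simp]: "finite (players G)"
  by (simp add: players_def)

lemma space_act_space [simp]: "space (act_space G i) = acts G i"
  by (simp add: act_space_def space_restrict_space)

lemma space_profile_space [simp]: "space (profile_space G) = \<A>"
  by (simp add: profile_space_def profiles_def space_PiM)

lemma space_stage_space [simp]: "space \<K> = \<X> \<times> \<A>"
  by (simp add: stage_space_def space_pair_measure)

lemma discount_pos: "0 < discount G" and discount_less_1: "discount G < 1"
  using game by (auto simp: constrained_stochastic_game_def)

lemma measurable_transition [measurable]:
  "(\<lambda>z. transition G (fst z) (snd z)) \<in> \<K> \<rightarrow>\<^sub>M prob_algebra (states G)"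
  using game by (simp add: constrained_stochastic_game_def case_prod_beta')

lemma transition_prob:
  assumes "x \<in> \<X>" "a \<in> \<A>"
  shows "prob_space (transition G x a)" "sets (transition G x a) = sets (states G)"
    "space (transition G x a) = \<X>"
  using measurable_space[OF measurable_transition, of "(x, a)"] assms
  by (auto simp: space_prob_algebra dest: sets_eq_imp_space_eq)

text \<open>The factor \<open>1 - discount G\<close> matches the normalization in
  \<open>discounted_cost\<close>: one step averages a present cost and a future value, so a bound on
  the costs is also a bound on the values.\<close>

definition lookahead :: "('x \<times> (nat \<Rightarrow> 'a) \<Rightarrow> real) \<Rightarrow> ('x \<Rightarrow> real) \<Rightarrow> 'x \<times> (nat \<Rightarrow> 'a) \<Rightarrow> real" where
  "lookahead c v z = (1 - discount G) * c z + discount G * (\<integral>y. v y \<partial>transition G (fst z) (snd z))"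

lemma abs_integral_transition_le:
  fixes v :: "'x \<Rightarrow> real"
  assumes "x \<in> \<X>" "a \<in> \<A>" "\<And>y. y \<in> \<X> \<Longrightarrow> \<bar>v y\<bar> \<le> B"
  shows "\<bar>\<integral>y. v y \<partial>transition G x a\<bar> \<le> B"
  by (rule abs_integral_le_bound[OF transition_prob(1)[OF assms(1,2)]])
    (simp add: transition_prob(3)[OF assms(1,2)] assms(3))

lemma measurable_lookahead:
  assumes "c \<in> borel_measurable \<K>" and v: "v \<in> borel_measurable (states G)"
  shows "lookahead c v \<in> borel_measurable \<K>"
proof -
  note [measurable] = assms(1)
  have [measurable]: "(\<lambda>z. \<integral>y. v y \<partial>transition G (fst z) (snd z)) \<in> borel_measurable \<K>"
    by (rule measurable_compose[OF measurable_prob_algebraD[OF measurable_transition] integral_measurable_subprob_algebra[OF v]])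
  show ?thesis unfolding lookahead_def[abs_def] by measurable
qed

lemma measurable_lookahead_state:
  assumes "c \<in> borel_measurable \<K>" "v \<in> borel_measurable (states G)" "a \<in> \<A>"
  shows "(\<lambda>x. lookahead c v (x, a)) \<in> borel_measurable (states G)"
  by (rule measurable_compose[OF _ measurable_lookahead[OF assms(1,2)]])
    (use assms(3) in \<open>simp add: stage_space_def\<close>)

lemma measurable_lookahead_act:
  assumes "c \<in> borel_measurable \<K>" "v \<in> borel_measurable (states G)" "x \<in> \<X>"
  shows "(\<lambda>a. lookahead c v (x, a)) \<in> borel_measurable (profile_space G)"
  by (rule measurable_compose[OF _ measurable_lookahead[OF assms(1,2)]])
    (use assms(3) in \<open>simp add: stage_space_def\<close>)

lemma abs_lookahead_le:
  assumes c: "\<And>z. z \<in> space \<K> \<Longrightarrow> \<bar>c z\<bar> \<le> b" and v: "\<And>y. y \<in> \<X> \<Longrightarrow> \<bar>v y\<bar> \<le> b"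
    and z: "x \<in> \<X>" "a \<in> \<A>"
  shows "\<bar>lookahead c v (x, a)\<bar> \<le> b"
proof -
  have "\<bar>lookahead c v (x, a)\<bar> \<le> (1 - discount G) * \<bar>c (x, a)\<bar> + discount G * \<bar>\<integral>y. v y \<partial>transition G x a\<bar>"
    using abs_triangle_ineq[of "(1 - discount G) * c (x, a)" "discount G * (\<integral>y. v y \<partial>transition G x a)"] discount_pos discount_less_1
    by (simp add: lookahead_def abs_mult)
  also have "\<dots> \<le> (1 - discount G) * b + discount G * b"
    using c[of "(x, a)"] z abs_integral_transition_le[OF z v] discount_pos discount_less_1
    by (intro add_mono mult_left_mono) auto
  finally show ?thesis by (simp add: algebra_simps)
qed

lemma init_prob: "prob_space (init G)" "sets (init G) = sets (states G)" "space (init G) = \<X>"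
  using game by (auto simp: constrained_stochastic_game_def space_prob_algebra dest: sets_eq_imp_space_eq)

lemma upd_profiles: "a \<in> \<A> \<Longrightarrow> i \<in> players G \<Longrightarrow> b \<in> acts G i \<Longrightarrow> a(i := b) \<in> \<A>"
  by (auto simp: profiles_def PiE_iff extensional_def)

lemma measurable_cost:
  "i \<in> players G \<Longrightarrow> l \<in> \<L> \<Longrightarrow>
    (\<lambda>z. cost G i l (fst z) (snd z)) \<in> borel_measurable \<K>"
  using game by (auto simp: constrained_stochastic_game_def case_prod_beta')

lemma integrable_transition:
  assumes "x \<in> \<X>" "a \<in> \<A>" "v \<in> borel_measurable (states G)" "\<And>y. y \<in> \<X> \<Longrightarrow> \<bar>v y\<bar> \<le> (B::real)"
  shows "integrable (transition G x a) v"
  using assms transition_prob[OF assms(1,2)]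
  by (intro bounded_integrable[of _ _ B]) (auto simp: measurable_cong_sets[OF transition_prob(2)[OF assms(1,2)] refl] prob_space.finite_measure)

lemma lookahead_sum:
  assumes x: "x \<in> \<X>" "a \<in> \<A>"
    and v: "\<And>l. l \<in> L \<Longrightarrow> v l \<in> borel_measurable (states G)" "\<And>l y. l \<in> L \<Longrightarrow> y \<in> \<X> \<Longrightarrow> \<bar>v l y\<bar> \<le> b"
    and u: "\<And>y. y \<in> \<X> \<Longrightarrow> u y = (\<Sum>l\<in>L. w l * v l y)"
  shows "lookahead (\<lambda>z. \<Sum>l\<in>L. w l * c l z) u (x, a) = (\<Sum>l\<in>L. w l * lookahead (c l) (v l) (x, a))"
proof -
  have "(\<integral>y. u y \<partial>transition G x a) = (\<integral>y. (\<Sum>l\<in>L. w l * v l y) \<partial>transition G x a)"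
    using u transition_prob(3)[OF x] by (intro Bochner_Integration.integral_cong) auto
  also have "\<dots> = (\<Sum>l\<in>L. w l * (\<integral>y. v l y \<partial>transition G x a))"
    using integrable_transition[OF x v] by simp
  finally show ?thesis
    by (simp add: lookahead_def sum_distrib_left sum.distrib distrib_left mult_ac)
qed

end

section \<open>Stage marginals of the play measure and discounted sums\<close>

locale csg_play = csg_game G for G :: "('x, 'a::metric_space) csg" +
  fixes \<pi> :: "nat \<Rightarrow> ('x, 'a) strategy"
  assumes strategies: "\<pi> \<in> (\<Pi> i\<in>players G. strategies G i)"
begin

sublocale IT: Ionescu_Tulcea "stage_kernel G \<pi>" "\<lambda>_. \<K>"
  by (rule Ionescu_Tulcea_stage_kernel[OF game strategies])

abbreviation "play \<equiv> play_measure G \<pi>"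

abbreviation "hist t \<equiv> PiM {0..<t} (\<lambda>_. \<K>)"

abbreviation "act_kernel t h \<equiv> PiM (players G) (\<lambda>i. \<pi> i t h)"

lemma sets_play [measurable_cong]: "sets play = sets (PiM UNIV (\<lambda>_. \<K>))"
  by (simp add: play_measure_def)

text \<open>The limit measure is known through its finite-dimensional marginals
  \<open>IT.CI\<close>. For an initial segment the horizon \<open>IT.up_to\<close> is
  \<open>t\<close> itself and the restriction acts as the identity, which leaves the composition of
  the first \<open>t\<close> kernels.\<close>

lemma distr_play: "distr play (hist t) (\<lambda>\<omega>. restrict \<omega> {0..<t}) = IT.C 0 t (\<lambda>_. undefined)"
proof -
  have "IT.up_to {0..<t} = t"
  proof (rule antisym)
    show "IT.up_to {0..<t} \<le> t" by (subst IT.up_to_iff) auto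
    show "t \<le> IT.up_to {0..<t}"
      using IT.up_to[of "{0..<t}"] by (auto simp: subset_eq)
  qed
  then have "IT.CI {0..<t} = distr (IT.C 0 t (\<lambda>_. undefined)) (hist t) (\<lambda>f. restrict f {0..<t})"
    by (simp add: IT.CI_def)
  also have "\<dots> = distr (IT.C 0 t (\<lambda>_. undefined)) (hist t) (\<lambda>f. f)"
    by (rule distr_cong) (use IT.space_C[of "\<lambda>_. undefined" 0 t] in \<open>auto simp: space_PiM\<close>)
  also have "\<dots> = IT.C 0 t (\<lambda>_. undefined)"
    by (rule distr_id2) (use IT.sets_C[of "\<lambda>_. undefined" 0 t] in \<open>auto simp: space_PiM\<close>)
  finally show ?thesis
    using IT.distr_lim[of "{0..<t}"] by (simp add: play_measure_def)
qed

lemma measurable_restrict_play [measurable]: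
  "(\<lambda>\<omega>. restrict \<omega> {0..<t}) \<in> play \<rightarrow>\<^sub>M hist t"
  by (rule measurable_restrict) measurable

sublocale play: prob_space play
proof -
  have "prob_space (distr play (hist 0) (\<lambda>\<omega>. restrict \<omega> {0..<0}))"
    unfolding distr_play by (rule IT.prob_space_C) simp
  then show "prob_space play" by (rule prob_space_distrD[rotated]) (rule measurable_restrict_play)
qed

text \<open>The law of the first \<open>Suc t\<close> stages is the law of the first
  \<open>t\<close> stages composed with \<open>IT.eP t\<close>, which appends to a history a pair
  drawn from the stage kernel.\<close>

lemma integral_play_stage:
  fixes f :: "_ \<Rightarrow> real"
  assumes f[measurable]: "f \<in> borel_measurable \<K>" and B: "\<And>z. z \<in> space \<K> \<Longrightarrow> \<bar>f z\<bar> \<le> B"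
  shows "(\<integral>\<omega>. f (\<omega> t) \<partial>play) = (\<integral>\<omega>. (\<integral>z. f z \<partial>stage_kernel G \<pi> t (restrict \<omega> {0..<t})) \<partial>play)"
proof -
  let ?C = "IT.C 0 t (\<lambda>_. undefined)"
  have sC: "sets ?C = sets (hist t)" "space ?C = space (hist t)" "prob_space ?C"
    using IT.sets_C[of "\<lambda>_. undefined" 0 t] IT.space_C[of "\<lambda>_. undefined" 0 t] IT.prob_space_C[of "\<lambda>_. undefined" 0 t]
    by (auto simp: space_PiM)
  have K[measurable]: "stage_kernel G \<pi> t \<in> hist t \<rightarrow>\<^sub>M prob_algebra \<K>"
    by (rule measurable_stage_kernel[OF game strategies])
  have [measurable]: "(\<lambda>\<omega>. \<integral>z. f z \<partial>stage_kernel G \<pi> t \<omega>) \<in> borel_measurable (hist t)"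
    by (rule measurable_compose[OF measurable_prob_algebraD[OF K] integral_measurable_subprob_algebra[OF f]])
  have c: "(\<lambda>\<omega>. f (\<omega> t)) \<in> borel_measurable (hist (Suc t))" by measurable
  have "(\<integral>\<omega>. f (\<omega> t) \<partial>play) = (\<integral>\<omega>. f (\<omega> t) \<partial>distr play (hist (Suc t)) (\<lambda>\<omega>. restrict \<omega> {0..<Suc t}))"
    by (subst integral_distr[OF measurable_restrict_play c]) simp
  also have "\<dots> = (\<integral>\<omega>. f (\<omega> t) \<partial>(?C \<bind> IT.eP t))"
    unfolding distr_play by simp
  also have "\<dots> = (\<integral>\<omega>. (\<integral>\<omega>'. f (\<omega>' t) \<partial>IT.eP t \<omega>) \<partial>?C)"
  proof (rule integral_bind_bounded[OF _ sC(3) c])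
    have "IT.eP t \<in> hist t \<rightarrow>\<^sub>M prob_algebra (hist (Suc t))"
      using IT.prob_space_eP[of _ t] IT.measurable_eP[of t]
      by (auto simp: prob_algebra_def intro!: measurable_restrict_space2)
    then show "IT.eP t \<in> ?C \<rightarrow>\<^sub>M prob_algebra (hist (Suc t))"
      by (simp add: measurable_cong_sets[OF sC(1) refl])
    show "\<bar>f (\<omega> t)\<bar> \<le> B" if "\<omega> \<in> space (hist (Suc t))" for \<omega>
      using that by (intro B) (auto simp: space_PiM PiE_iff)
  qed
  also have "\<dots> = (\<integral>\<omega>. (\<integral>z. f z \<partial>stage_kernel G \<pi> t \<omega>) \<partial>?C)"
  proof (rule Bochner_Integration.integral_cong[OF refl])
    fix \<omega> assume "\<omega> \<in> space ?C"
    then have \<omega>: "\<omega> \<in> space (hist t)" using sC by simp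
    have [measurable]: "fun_upd \<omega> t \<in> stage_kernel G \<pi> t \<omega> \<rightarrow>\<^sub>M hist (Suc t)"
      unfolding measurable_cong_sets[OF IT.sets_P[OF \<omega>] refl]
      using \<omega> by (intro measurable_fun_upd[where J="{0..<t}"]) auto
    show "(\<integral>\<omega>'. f (\<omega>' t) \<partial>IT.eP t \<omega>) = (\<integral>z. f z \<partial>stage_kernel G \<pi> t \<omega>)"
      unfolding IT.eP_def by (subst integral_distr) (auto simp: c)
  qed
  also have "\<dots> = (\<integral>\<omega>. (\<integral>z. f z \<partial>stage_kernel G \<pi> t \<omega>) \<partial>distr play (hist t) (\<lambda>\<omega>. restrict \<omega> {0..<t}))"
    by (simp add: distr_play)
  also have "\<dots> = (\<integral>\<omega>. (\<integral>z. f z \<partial>stage_kernel G \<pi> t (restrict \<omega> {0..<t})) \<partial>play)"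
    by (subst integral_distr) auto
  finally show ?thesis .
qed

definition state_law :: "nat \<Rightarrow> (nat \<Rightarrow> 'x \<times> (nat \<Rightarrow> 'a)) \<Rightarrow> 'x measure" where
  "state_law t \<omega> = (if t = 0 then init G else transition G (fst (\<omega> (t - 1))) (snd (\<omega> (t - 1))))"

lemma measurable_state_law: "state_law t \<in> hist t \<rightarrow>\<^sub>M prob_algebra (states G)"
proof (cases "t = 0")
  case True
  then show ?thesis using game by (simp add: state_law_def[abs_def] constrained_stochastic_game_def)
next
  case False
  then have "(\<lambda>\<omega>. \<omega> (t - 1)) \<in> hist t \<rightarrow>\<^sub>M \<K>"
    by (intro measurable_component_singleton) auto
  from measurable_compose[OF this measurable_transition] False show ?thesis
    by (simp add: state_law_def[abs_def])
qed

lemma measurable_act_kernel: "(\<lambda>h. act_kernel t h) \<in> history_space G t \<rightarrow>\<^sub>M prob_algebra (profile_space G)"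
  unfolding profile_space_def
  using strategies by (intro measurable_PiM_kernel) (auto simp: players_def strategies_def)

lemma integral_stage_kernel:
  fixes f :: "_ \<Rightarrow> real"
  assumes \<omega>: "\<omega> \<in> space (hist t)"
    and f[measurable]: "f \<in> borel_measurable \<K>" and B: "\<And>z. z \<in> space \<K> \<Longrightarrow> \<bar>f z\<bar> \<le> B"
  shows "(\<integral>z. f z \<partial>stage_kernel G \<pi> t \<omega>) = (\<integral>x. (\<integral>a. f (x, a) \<partial>act_kernel t (\<omega>, x)) \<partial>state_law t \<omega>)"
proof -
  have s: "sets (state_law t \<omega>) = sets (states G)" "prob_space (state_law t \<omega>)"
    using measurable_space[OF measurable_state_law \<omega>] by (auto simp: space_prob_algebra)
  have "Pair \<omega> \<in> states G \<rightarrow>\<^sub>M history_space G t"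
    unfolding history_space_def using \<omega> by (intro measurable_Pair1')
  from measurable_compose[OF this measurable_act_kernel]
  have a: "(\<lambda>x. act_kernel t (\<omega>, x)) \<in> states G \<rightarrow>\<^sub>M prob_algebra (profile_space G)" .
  have d: "(\<lambda>x. distr (act_kernel t (\<omega>, x)) \<K> (\<lambda>a. (x, a))) \<in> states G \<rightarrow>\<^sub>M prob_algebra \<K>"
    by (rule measurable_distr_prob_space2[where M="profile_space G", OF a]) (simp add: stage_space_def)
  have "(\<integral>z. f z \<partial>stage_kernel G \<pi> t \<omega>) =
      (\<integral>z. f z \<partial>(state_law t \<omega> \<bind> (\<lambda>x. distr (act_kernel t (\<omega>, x)) \<K> (\<lambda>a. (x, a)))))"
    by (simp add: stage_kernel_def state_law_def)
  also have "\<dots> = (\<integral>x. (\<integral>z. f z \<partial>distr (act_kernel t (\<omega>, x)) \<K> (\<lambda>a. (x, a))) \<partial>state_law t \<omega>)"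
    using d unfolding measurable_cong_sets[OF s(1)[symmetric] refl] by (rule integral_bind_bounded[OF _ s(2) f B])
  also have "\<dots> = (\<integral>x. (\<integral>a. f (x, a) \<partial>act_kernel t (\<omega>, x)) \<partial>state_law t \<omega>)"
  proof (rule Bochner_Integration.integral_cong[OF refl])
    fix x assume "x \<in> space (state_law t \<omega>)"
    then have x: "x \<in> \<X>" using sets_eq_imp_space_eq[OF s(1)] by simp
    have s: "sets (act_kernel t (\<omega>, x)) = sets (profile_space G)"
      using measurable_space[OF a x] by (auto simp: space_prob_algebra)
    have "Pair x \<in> act_kernel t (\<omega>, x) \<rightarrow>\<^sub>M \<K>"
      unfolding stage_space_def measurable_cong_sets[OF s refl] using x by (rule measurable_Pair1')
    then show "(\<integral>z. f z \<partial>distr (act_kernel t (\<omega>, x)) \<K> (\<lambda>a. (x, a))) = (\<integral>a. f (x, a) \<partial>act_kernel t (\<omega>, x))"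
      by (subst integral_distr) auto
  qed
  finally show ?thesis .
qed

lemma restrict_play_in_hist: "\<omega> \<in> space play \<Longrightarrow> restrict \<omega> {0..<t} \<in> space (hist t)"
  by (rule measurable_space[OF measurable_restrict_play])

lemma component_play: "\<omega> \<in> space play \<Longrightarrow> \<omega> t \<in> space \<K>"
  using sets_eq_imp_space_eq[OF sets_play] by (auto simp: space_PiM)

lemma integrable_play:
  fixes f :: "_ \<Rightarrow> real"
  assumes [measurable]: "f \<in> borel_measurable \<K>" and B: "\<And>z. z \<in> space \<K> \<Longrightarrow> \<bar>f z\<bar> \<le> B"
  shows "integrable play (\<lambda>\<omega>. f (\<omega> t))"
  by (rule bounded_integrable[OF play.finite_measure_axioms]) (measurable, rule B[OF component_play])

text \<open>The tower property in the form used for telescoping: a sign that holds conditionally on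
  every history and state survives integration over them.\<close>

lemma integral_play_nonneg:
  fixes f :: "_ \<Rightarrow> real"
  assumes f: "f \<in> borel_measurable \<K>" and B: "\<And>z. z \<in> space \<K> \<Longrightarrow> \<bar>f z\<bar> \<le> B"
    and nonneg: "\<And>\<omega> x. \<omega> \<in> space (hist t) \<Longrightarrow> x \<in> \<X> \<Longrightarrow> 0 \<le> (\<integral>a. f (x, a) \<partial>act_kernel t (\<omega>, x))"
  shows "0 \<le> (\<integral>\<omega>. f (\<omega> t) \<partial>play)"
proof -
  have *: "0 \<le> (\<integral>z. f z \<partial>stage_kernel G \<pi> t \<omega>)" if \<omega>: "\<omega> \<in> space (hist t)" for \<omega>
  proof -
    have s: "sets (state_law t \<omega>) = sets (states G)"
      using measurable_space[OF measurable_state_law \<omega>] by (auto simp: space_prob_algebra)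
    have "0 \<le> (\<integral>x. (\<integral>a. f (x, a) \<partial>act_kernel t (\<omega>, x)) \<partial>state_law t \<omega>)"
      by (rule Bochner_Integration.integral_nonneg) (use sets_eq_imp_space_eq[OF s] nonneg[OF \<omega>] in simp)
    also have "\<dots> = (\<integral>z. f z \<partial>stage_kernel G \<pi> t \<omega>)"
      by (rule integral_stage_kernel[OF \<omega> f B, symmetric])
    finally show ?thesis .
  qed
  have "0 \<le> (\<integral>\<omega>. (\<integral>z. f z \<partial>stage_kernel G \<pi> t (restrict \<omega> {0..<t})) \<partial>play)"
    by (rule Bochner_Integration.integral_nonneg) (rule *[OF restrict_play_in_hist])
  also have "\<dots> = (\<integral>\<omega>. f (\<omega> t) \<partial>play)"
    by (rule integral_play_stage[OF f B, symmetric])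
  finally show ?thesis .
qed

lemma integral_play_state:
  fixes V :: "'x \<Rightarrow> real"
  assumes V[measurable]: "V \<in> borel_measurable (states G)" and B: "\<And>x. x \<in> \<X> \<Longrightarrow> \<bar>V x\<bar> \<le> B"
  shows "(\<integral>\<omega>. V (fst (\<omega> t)) \<partial>play) = (\<integral>\<omega>. (\<integral>x. V x \<partial>state_law t \<omega>) \<partial>play)"
proof -
  have f: "(\<lambda>z. V (fst z)) \<in> borel_measurable \<K>" unfolding stage_space_def by measurable
  have fB: "\<bar>V (fst z)\<bar> \<le> B" if "z \<in> space \<K>" for z
    using that by (intro B) (auto simp: stage_space_def space_pair_measure)
  have "(\<integral>\<omega>. V (fst (\<omega> t)) \<partial>play) = (\<integral>\<omega>. (\<integral>z. V (fst z) \<partial>stage_kernel G \<pi> t (restrict \<omega> {0..<t})) \<partial>play)"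
    by (rule integral_play_stage[OF f fB])
  also have "\<dots> = (\<integral>\<omega>. (\<integral>x. V x \<partial>state_law t \<omega>) \<partial>play)"
  proof (rule Bochner_Integration.integral_cong[OF refl])
    fix \<omega> assume "\<omega> \<in> space play"
    then have \<omega>: "restrict \<omega> {0..<t} \<in> space (hist t)" by (rule restrict_play_in_hist)
    have s: "sets (state_law t (restrict \<omega> {0..<t})) = sets (states G)"
      using measurable_space[OF measurable_state_law \<omega>] by (auto simp: space_prob_algebra)
    have "(\<integral>z. V (fst z) \<partial>stage_kernel G \<pi> t (restrict \<omega> {0..<t})) =
      (\<integral>x. (\<integral>a. V x \<partial>act_kernel t (restrict \<omega> {0..<t}, x)) \<partial>state_law t (restrict \<omega> {0..<t}))"
      by (subst integral_stage_kernel[OF \<omega> f fB]) simp_all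
    also have "\<dots> = (\<integral>x. V x \<partial>state_law t (restrict \<omega> {0..<t}))"
    proof (rule Bochner_Integration.integral_cong[OF refl])
      fix x assume "x \<in> space (state_law t (restrict \<omega> {0..<t}))"
      then have "(restrict \<omega> {0..<t}, x) \<in> space (history_space G t)"
        using \<omega> sets_eq_imp_space_eq[OF s] by (simp add: history_space_def space_pair_measure)
      from measurable_space[OF measurable_act_kernel this] interpret prob_space "act_kernel t (restrict \<omega> {0..<t}, x)"
        by (simp add: space_prob_algebra)
      show "(\<integral>a. V x \<partial>act_kernel t (restrict \<omega> {0..<t}, x)) = V x" by (simp add: prob_space)
    qed
    also have "state_law t (restrict \<omega> {0..<t}) = state_law t \<omega>" by (simp add: state_law_def)
    finally show "(\<integral>z. V (fst z) \<partial>stage_kernel G \<pi> t (restrict \<omega> {0..<t})) = (\<integral>x. V x \<partial>state_law t \<omega>)" .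
  qed
  finally show ?thesis .
qed

lemma integral_play_init:
  fixes V :: "'x \<Rightarrow> real"
  assumes "V \<in> borel_measurable (states G)" and "\<And>x. x \<in> \<X> \<Longrightarrow> \<bar>V x\<bar> \<le> B"
  shows "(\<integral>\<omega>. V (fst (\<omega> 0)) \<partial>play) = (\<integral>x. V x \<partial>init G)"
  using integral_play_state[OF assms, of 0] by (simp add: state_law_def play.prob_space)

lemma integral_play_Suc:
  fixes V :: "'x \<Rightarrow> real"
  assumes "V \<in> borel_measurable (states G)" and "\<And>x. x \<in> \<X> \<Longrightarrow> \<bar>V x\<bar> \<le> B"
  shows "(\<integral>\<omega>. V (fst (\<omega> (Suc t))) \<partial>play) = (\<integral>\<omega>. (\<integral>x. V x \<partial>transition G (fst (\<omega> t)) (snd (\<omega> t))) \<partial>play)"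
  using integral_play_state[OF assms, of "Suc t"] by (simp add: state_law_def)

text \<open>A geometric series dominates, so sum and expectation commute, and only the expected
  costs of the single stages matter from here on.\<close>

lemma discounted_cost_sums:
  assumes c: "(\<lambda>z. cost G i l (fst z) (snd z)) \<in> borel_measurable \<K>"
    and b: "\<And>z. z \<in> space \<K> \<Longrightarrow> \<bar>cost G i l (fst z) (snd z)\<bar> \<le> b"
  shows "(\<lambda>t. (1 - discount G) * (discount G ^ t * (\<integral>\<omega>. cost G i l (fst (\<omega> t)) (snd (\<omega> t)) \<partial>play))) sums
    discounted_cost G i l \<pi>"
proof -
  define c' where "c' z = cost G i l (fst z) (snd z)" for z
  have b': "\<bar>c' (\<omega> t)\<bar> \<le> b" if "\<omega> \<in> space play" for \<omega> t
    unfolding c'_def by (rule b[OF component_play[OF that]])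
  have int: "integrable play (\<lambda>\<omega>. c' (\<omega> t))" for t
    unfolding c'_def by (rule integrable_play[OF c b])
  have sg: "summable (\<lambda>t. discount G ^ t * b)"
    using discount_pos discount_less_1 by (intro summable_mult2 summable_geometric) auto
  have le: "\<bar>discount G ^ t * c' (\<omega> t)\<bar> \<le> discount G ^ t * b" if "\<omega> \<in> space play" for \<omega> t
    using b'[OF that, of t] discount_pos by (simp add: abs_mult mult_left_mono)
  have "(\<lambda>t. \<integral>\<omega>. discount G ^ t * c' (\<omega> t) \<partial>play) sums (\<integral>\<omega>. (\<Sum>t. discount G ^ t * c' (\<omega> t)) \<partial>play)"
  proof (rule sums_integral)
    show "integrable play (\<lambda>\<omega>. discount G ^ t * c' (\<omega> t))" for t using int by simp
    show "AE \<omega> in play. summable (\<lambda>t. norm (discount G ^ t * c' (\<omega> t)))"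
    proof (rule AE_I2)
      fix \<omega> assume \<omega>: "\<omega> \<in> space play"
      show "summable (\<lambda>t. norm (discount G ^ t * c' (\<omega> t)))"
        by (rule summable_comparison_test'[OF sg, of 0]) (use le[OF \<omega>] in simp)
    qed
    show "summable (\<lambda>t. \<integral>\<omega>. norm (discount G ^ t * c' (\<omega> t)) \<partial>play)"
    proof (rule summable_comparison_test'[OF sg, of 0])
      fix t :: nat
      show "norm (\<integral>\<omega>. norm (discount G ^ t * c' (\<omega> t)) \<partial>play) \<le> discount G ^ t * b"
        using abs_integral_le_bound[OF play.prob_space_axioms, of "\<lambda>\<omega>. norm (discount G ^ t * c' (\<omega> t))"] le
        by simp
    qed
  qed
  then show ?thesis
    unfolding discounted_cost_def by (intro sums_mult) (simp add: c'_def)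
qed

text \<open>
  Telescoping of \<open>discount\<^sup>t V(x\<^sub>t)\<close>: a one-step inequality for \<open>V\<close> against all actions of the players
  turns into an inequality for the discounted cost.
\<close>

lemma discounted_cost_ge:
  fixes V :: "'x \<Rightarrow> real" and c :: "'x \<times> (nat \<Rightarrow> 'a) \<Rightarrow> real" and J :: real
  assumes V: "V \<in> borel_measurable (states G)" "\<And>x. x \<in> \<X> \<Longrightarrow> \<bar>V x\<bar> \<le> b"
    and r: "r \<in> borel_measurable (states G)" "\<And>x. x \<in> \<X> \<Longrightarrow> \<bar>r x\<bar> \<le> R"
    and c: "c \<in> borel_measurable \<K>" "\<And>z. z \<in> space \<K> \<Longrightarrow> \<bar>c z\<bar> \<le> b"
    and J: "(\<lambda>t. (1 - discount G) * (discount G ^ t * (\<integral>\<omega>. c (\<omega> t) \<partial>play))) sums J"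
    and step: "\<And>t \<omega> x. \<omega> \<in> space (hist t) \<Longrightarrow> x \<in> \<X> \<Longrightarrow>
      V x \<le> (\<integral>a. lookahead c V (x, a) \<partial>act_kernel t (\<omega>, x)) + r x"
    and res: "(\<lambda>t. discount G ^ t * (\<integral>\<omega>. r (fst (\<omega> t)) \<partial>play)) sums D"
  shows "(\<integral>x. V x \<partial>init G) \<le> J + D"
proof -
  note [measurable] = V(1) r(1) c(1)
  let ?h = "lookahead c V"
  have V': "(\<lambda>z. \<integral>y. V y \<partial>transition G (fst z) (snd z)) \<in> borel_measurable \<K>"
    by (rule measurable_compose[OF measurable_prob_algebraD[OF measurable_transition] integral_measurable_subprob_algebra[OF V(1)]])
  have V'b: "\<bar>\<integral>y. V y \<partial>transition G (fst z) (snd z)\<bar> \<le> b" if z: "z \<in> space \<K>" for z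
    using z by (intro abs_integral_transition_le V(2)) auto
  have [measurable]: "(\<lambda>z. V (fst z)) \<in> borel_measurable \<K>" "(\<lambda>z. r (fst z)) \<in> borel_measurable \<K>"
    unfolding stage_space_def by measurable
  have fst_st: "fst z \<in> \<X>" if "z \<in> space \<K>" for z
    using that by auto
  have h[measurable]: "?h \<in> borel_measurable \<K>" by (rule measurable_lookahead[OF c(1) V(1)])
  have hb: "\<bar>?h z\<bar> \<le> b" if "z \<in> space \<K>" for z
    using abs_lookahead_le[OF c(2) V(2), where x="fst z" and a="snd z"] that by auto
  define e where "e t = (\<integral>\<omega>. V (fst (\<omega> t)) \<partial>play)" for t
  define q where "q t = (\<integral>\<omega>. c (\<omega> t) \<partial>play)" for t
  define \<rho> where "\<rho> t = (\<integral>\<omega>. r (fst (\<omega> t)) \<partial>play)" for t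
  have iV: "integrable play (\<lambda>\<omega>. V (fst (\<omega> t)))" for t
    by (rule integrable_play[of "\<lambda>z. V (fst z)" b]) (auto intro!: V(2) fst_st)
  have ir: "integrable play (\<lambda>\<omega>. r (fst (\<omega> t)))" for t
    by (rule integrable_play[of "\<lambda>z. r (fst z)" R]) (auto intro!: r(2) fst_st)
  have ic: "integrable play (\<lambda>\<omega>. c (\<omega> t))" for t
    by (rule integrable_play[OF c])
  have iV': "integrable play (\<lambda>\<omega>. \<integral>y. V y \<partial>transition G (fst (\<omega> t)) (snd (\<omega> t)))" for t
    by (rule integrable_play[OF V' V'b])
  have e_Suc: "e (Suc t) = (\<integral>\<omega>. (\<integral>y. V y \<partial>transition G (fst (\<omega> t)) (snd (\<omega> t))) \<partial>play)" for t
    unfolding e_def by (rule integral_play_Suc[OF V])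
  \<comment> \<open>In expectation the transition integral inside \<open>lookahead\<close> is the
    value of the next state, which turns the look-ahead into a combination of \<open>q t\<close> and
    \<open>e (Suc t)\<close>.\<close>
  have e_step: "e t \<le> (1 - discount G) * q t + discount G * e (Suc t) + \<rho> t" for t
  proof -
    let ?f = "\<lambda>z. ?h z + r (fst z) - V (fst z)"
    have "0 \<le> (\<integral>\<omega>. ?f (\<omega> t) \<partial>play)"
    proof (rule integral_play_nonneg)
      show "?f \<in> borel_measurable \<K>" by measurable
      show "\<bar>?f z\<bar> \<le> b + R + b" if "z \<in> space \<K>" for z
        using hb[OF that] r(2)[OF fst_st[OF that]] V(2)[OF fst_st[OF that]] by linarith
      fix \<omega> x assume \<omega>: "\<omega> \<in> space (hist t)" and x: "x \<in> \<X>"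
      then have "(\<omega>, x) \<in> space (history_space G t)" by (simp add: history_space_def space_pair_measure)
      from measurable_space[OF measurable_act_kernel this]
      have s: "sets (act_kernel t (\<omega>, x)) = sets (profile_space G)" and p: "prob_space (act_kernel t (\<omega>, x))"
        by (auto simp: space_prob_algebra)
      interpret prob_space "act_kernel t (\<omega>, x)" by fact
      have "integrable (act_kernel t (\<omega>, x)) (\<lambda>a. ?h (x, a))"
      proof (rule bounded_integrable[OF finite_measure_axioms])
        have "Pair x \<in> act_kernel t (\<omega>, x) \<rightarrow>\<^sub>M \<K>"
          unfolding stage_space_def measurable_cong_sets[OF s refl] using x by (rule measurable_Pair1')
        then show "(\<lambda>a. ?h (x, a)) \<in> borel_measurable (act_kernel t (\<omega>, x))" by measurable
        show "\<bar>?h (x, a)\<bar> \<le> b" if "a \<in> space (act_kernel t (\<omega>, x))" for a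
          using that x sets_eq_imp_space_eq[OF s] by (intro hb) auto
      qed
      then have "(\<integral>a. ?f (x, a) \<partial>act_kernel t (\<omega>, x)) = (\<integral>a. ?h (x, a) \<partial>act_kernel t (\<omega>, x)) + r x - V x"
        by (simp add: Bochner_Integration.integral_diff Bochner_Integration.integral_add prob_space)
      with step[OF \<omega> x] show "0 \<le> (\<integral>a. ?f (x, a) \<partial>act_kernel t (\<omega>, x))"
        by simp
    qed
    also have "(\<integral>\<omega>. ?f (\<omega> t) \<partial>play) = (1 - discount G) * q t + discount G * e (Suc t) + \<rho> t - e t"
      unfolding lookahead_def e_def q_def \<rho>_def e_Suc[unfolded e_def]
      using iV ir ic iV' by (simp add: Bochner_Integration.integral_diff Bochner_Integration.integral_add)
    finally show ?thesis by simp
  qed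
  have part: "e 0 \<le> (\<Sum>t<n. (1 - discount G) * (discount G ^ t * q t)) + (\<Sum>t<n. discount G ^ t * \<rho> t) + discount G ^ n * e n" for n
  proof (induction n)
    case (Suc n)
    have "discount G ^ n * e n \<le> discount G ^ n * ((1 - discount G) * q n + discount G * e (Suc n) + \<rho> n)"
      using e_step[of n] discount_pos by (intro mult_left_mono) auto
    with Suc show ?case by (simp add: algebra_simps)
  qed simp
  have "(\<lambda>n. discount G ^ n * e n) \<longlonglongrightarrow> 0"
  proof (rule Lim_null_comparison)
    have "\<bar>e n\<bar> \<le> b" for n
      unfolding e_def by (rule abs_integral_le_bound[OF play.prob_space_axioms]) (auto intro!: V(2) fst_st component_play)
    then show "\<forall>\<^sub>F n in sequentially. norm (discount G ^ n * e n) \<le> discount G ^ n * b"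
      using discount_pos by (auto simp: abs_mult intro!: always_eventually mult_left_mono)
    show "(\<lambda>n. discount G ^ n * b) \<longlonglongrightarrow> 0"
      using discount_pos discount_less_1 by (intro tendsto_mult_left_zero LIMSEQ_power_zero) auto
  qed
  then have "(\<lambda>n. (\<Sum>t<n. (1 - discount G) * (discount G ^ t * q t)) + (\<Sum>t<n. discount G ^ t * \<rho> t) + discount G ^ n * e n) \<longlonglongrightarrow> J + D + 0"
    using J res unfolding sums_def q_def \<rho>_def by (intro tendsto_add)
  then have "e 0 \<le> J + D + 0"
    by (rule LIMSEQ_le_const) (use part in blast)
  moreover have "e 0 = (\<integral>x. V x \<partial>init G)"
    unfolding e_def by (rule integral_play_init[OF V])
  ultimately show ?thesis by simp
qed

end

section \<open>Products of finitely supported laws\<close>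

text \<open>The default value only makes the map total: it is a null event for \<open>set_pmf p \<subseteq> space N\<close>.\<close>

definition pmf_distr :: "'a measure \<Rightarrow> 'a pmf \<Rightarrow> 'a measure" where
  "pmf_distr N p = distr (measure_pmf p) N (\<lambda>x. if x \<in> space N then x else (SOME z. z \<in> space N))"

lemma pmf_distr_measurable:
  assumes "set_pmf p \<subseteq> space N"
  shows "(\<lambda>x. if x \<in> space N then x else (SOME z. z \<in> space N)) \<in> measure_pmf p \<rightarrow>\<^sub>M N"
proof -
  have "\<exists>z. z \<in> space N" using assms set_pmf_not_empty by fastforce
  then have "(SOME z. z \<in> space N) \<in> space N" by (rule someI_ex)
  then show ?thesis by (auto simp: measurable_def)
qed

lemma sets_pmf_distr [simp, measurable_cong]: "sets (pmf_distr N p) = sets N"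
  by (simp add: pmf_distr_def)

lemma space_pmf_distr [simp]: "space (pmf_distr N p) = space N"
  by (simp add: pmf_distr_def)

lemma prob_space_pmf_distr: "set_pmf p \<subseteq> space N \<Longrightarrow> prob_space (pmf_distr N p)"
  unfolding pmf_distr_def
  by (intro prob_space.prob_space_distr pmf_distr_measurable) unfold_locales

lemma emeasure_pmf_distr:
  assumes p: "set_pmf p \<subseteq> space N" and A: "A \<in> sets N"
  shows "emeasure (pmf_distr N p) A = emeasure (measure_pmf p) A"
proof -
  have "emeasure (pmf_distr N p) A =
      emeasure (measure_pmf p) ((\<lambda>x. if x \<in> space N then x else (SOME z. z \<in> space N)) -` A)"
    unfolding pmf_distr_def by (subst emeasure_distr[OF pmf_distr_measurable[OF p] A]) simp
  also have "\<dots> = emeasure (measure_pmf p) A"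
    by (rule emeasure_eq_AE) (use p sets.sets_into_space[OF A] in \<open>auto simp: AE_measure_pmf_iff subset_eq\<close>)
  finally show ?thesis .
qed

lemma integral_pmf_distr:
  fixes f :: "'a \<Rightarrow> real"
  assumes S: "finite S" "set_pmf p \<subseteq> S" "S \<subseteq> space N" and f: "f \<in> borel_measurable N"
  shows "(\<integral>x. f x \<partial>pmf_distr N p) = (\<Sum>x\<in>S. pmf p x * f x)"
proof -
  have p: "set_pmf p \<subseteq> space N" using S by auto
  have "(\<integral>x. f x \<partial>pmf_distr N p) = (\<integral>x. f (if x \<in> space N then x else (SOME z. z \<in> space N)) \<partial>measure_pmf p)"
    unfolding pmf_distr_def by (rule integral_distr[OF pmf_distr_measurable[OF p] f])
  also have "\<dots> = (\<Sum>x\<in>S. f (if x \<in> space N then x else (SOME z. z \<in> space N)) * pmf p x)"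
    using S by (intro integral_measure_pmf_real) auto
  also have "\<dots> = (\<Sum>x\<in>S. pmf p x * f x)"
    using S by (intro sum.cong) auto
  finally show ?thesis .
qed

text \<open>Both sides live on the same product sigma-algebra, so agreement on rectangles suffices.
  The default \<open>undefined\<close> of \<open>Pi_pmf\<close> is the value that extensional
  functions take outside \<open>I\<close>.\<close>

lemma PiM_pmf_distr:
  assumes I: "finite I" and p: "\<And>i. i \<in> I \<Longrightarrow> set_pmf (p i) \<subseteq> space (N i)"
  shows "PiM I (\<lambda>i. pmf_distr (N i) (p i)) = pmf_distr (PiM I N) (Pi_pmf I undefined p)"
proof -
  \<comment> \<open>\<open>product_prob_space\<close> asks for a probability measure at every index;
    those outside \<open>I\<close> receive a point mass.\<close>
  let ?K = "\<lambda>i. if i \<in> I then pmf_distr (N i) (p i) else return (count_space UNIV) undefined"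
  interpret product_prob_space ?K I
    by (intro product_prob_spaceI) (auto simp: prob_space_pmf_distr[OF p] prob_space_return)
  have "set_pmf (Pi_pmf I undefined p) \<subseteq> PiE_dflt I undefined (\<lambda>i. set_pmf (p i))"
    using set_Pi_pmf_subset'[OF I, of undefined p] by (simp add: o_def)
  then have P: "set_pmf (Pi_pmf I undefined p) \<subseteq> space (PiM I N)"
    using p by (fastforce simp: space_PiM PiE_dflt_def PiE_def extensional_def Pi_def)
  have "pmf_distr (PiM I N) (Pi_pmf I undefined p) = PiM I ?K"
  proof (rule PiM_eqI[OF I])
    show "sets (pmf_distr (PiM I N) (Pi_pmf I undefined p)) = sets (PiM I ?K)"
      by (simp, rule sets_PiM_cong) auto
    fix A assume A: "\<And>i. i \<in> I \<Longrightarrow> A i \<in> sets (?K i)"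
    have PA: "Pi\<^sub>E I A = PiE_dflt I undefined A"
      by (auto simp: PiE_dflt_def PiE_def extensional_def)
    have "Pi\<^sub>E I A \<in> sets (PiM I N)" using I A by (intro sets_PiM_I_finite) auto
    then have "emeasure (pmf_distr (PiM I N) (Pi_pmf I undefined p)) (Pi\<^sub>E I A) =
        emeasure (measure_pmf (Pi_pmf I undefined p)) (Pi\<^sub>E I A)"
      by (rule emeasure_pmf_distr[OF P])
    also have "\<dots> = (\<Prod>i\<in>I. emeasure (measure_pmf (p i)) (A i))"
      unfolding PA using I by (simp add: measure_pmf.emeasure_eq_measure measure_Pi_pmf_PiE_dflt prod_ennreal)
    also have "\<dots> = (\<Prod>i\<in>I. emeasure (?K i) (A i))"
      using A p by (intro prod.cong) (auto simp: emeasure_pmf_distr)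
    finally show "emeasure (pmf_distr (PiM I N) (Pi_pmf I undefined p)) (Pi\<^sub>E I A) = (\<Prod>i\<in>I. emeasure (?K i) (A i))" .
  qed
  also have "PiM I ?K = PiM I (\<lambda>i. pmf_distr (N i) (p i))" by (rule PiM_cong) auto
  finally show ?thesis ..
qed

lemma integral_PiM_pmf_distr:
  fixes f :: "_ \<Rightarrow> real"
  assumes I: "finite I" and S: "\<And>i. i \<in> I \<Longrightarrow> finite (S i)" "\<And>i. i \<in> I \<Longrightarrow> set_pmf (p i) \<subseteq> S i"
      "\<And>i. i \<in> I \<Longrightarrow> S i \<subseteq> space (N i)"
    and f: "f \<in> borel_measurable (PiM I N)"
  shows "(\<integral>a. f a \<partial>PiM I (\<lambda>i. pmf_distr (N i) (p i))) = (\<Sum>a\<in>PiE I S. (\<Prod>i\<in>I. pmf (p i) (a i)) * f a)"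
proof -
  have p: "set_pmf (p i) \<subseteq> space (N i)" if "i \<in> I" for i using S(2,3)[OF that] by auto
  have "set_pmf (Pi_pmf I undefined p) \<subseteq> PiE_dflt I undefined (\<lambda>i. set_pmf (p i))"
    using set_Pi_pmf_subset'[OF I, of undefined p] by (simp add: o_def)
  then have "set_pmf (Pi_pmf I undefined p) \<subseteq> PiE I S"
    using S(2) by (fastforce simp: PiE_dflt_def PiE_def extensional_def Pi_def)
  moreover have "PiE I S \<subseteq> space (PiM I N)"
    using S(3) by (auto simp: space_PiM PiE_def Pi_def)
  ultimately have "(\<integral>a. f a \<partial>pmf_distr (PiM I N) (Pi_pmf I undefined p)) = (\<Sum>a\<in>PiE I S. pmf (Pi_pmf I undefined p) a * f a)"
    using I S(1) f by (intro integral_pmf_distr finite_PiE) auto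
  also have "\<dots> = (\<Sum>a\<in>PiE I S. (\<Prod>i\<in>I. pmf (p i) (a i)) * f a)"
  proof (rule sum.cong[OF refl])
    fix a assume "a \<in> PiE I S"
    then show "pmf (Pi_pmf I undefined p) a * f a = (\<Prod>i\<in>I. pmf (p i) (a i)) * f a"
      using I by (subst pmf_Pi') (auto simp: PiE_def extensional_def)
  qed
  finally show ?thesis using PiM_pmf_distr[OF I p] by simp
qed

lemma sum_prod_pmf_eq_1:
  assumes "finite I" "\<And>i. i \<in> I \<Longrightarrow> finite (S i)" "\<And>i. i \<in> I \<Longrightarrow> set_pmf (p i) \<subseteq> S i"
  shows "(\<Sum>a\<in>PiE I S. \<Prod>i\<in>I. pmf (p i) (a i)) = 1"
proof -
  have "(\<Sum>a\<in>PiE I S. \<Prod>i\<in>I. pmf (p i) (a i)) = (\<Prod>i\<in>I. \<Sum>x\<in>S i. pmf (p i) x)"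
    using assms by (simp add: prod_sum_PiE)
  also have "\<dots> = 1" using assms by (intro prod.neutral) (auto intro!: sum_pmf_eq_1)
  finally show ?thesis .
qed

text \<open>This isolates the deviation of one player. A profile drawn from \<open>K\<close> whose
  coordinate \<open>i\<close> is overwritten by an independent draw from \<open>\<sigma>\<close> has
  the product law with factor \<open>i\<close> exchanged. Overwriting keeps the index set, so no
  product over \<open>I - {i}\<close> has to be split off and reassembled.\<close>

lemma integral_PiM_fun_upd:
  fixes f :: "_ \<Rightarrow> real"
  assumes I: "finite I" "i \<in> I" and K: "\<And>j. j \<in> I \<Longrightarrow> K j \<in> space (prob_algebra (N j))"
    and \<sigma>: "\<sigma> \<in> space (prob_algebra (N i))"
    and f: "f \<in> borel_measurable (PiM I N)" and B: "\<And>a. a \<in> space (PiM I N) \<Longrightarrow> \<bar>f a\<bar> \<le> B"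
  shows "(\<integral>a. f a \<partial>PiM I (K(i := \<sigma>))) = (\<integral>b. (\<integral>a. f (a(i := b)) \<partial>PiM I K) \<partial>\<sigma>)"
proof -
  have Ks: "prob_space (K j)" "sets (K j) = sets (N j)" "space (K j) = space (N j)" if "j \<in> I" for j
    using K[OF that] by (auto simp: space_prob_algebra dest: sets_eq_imp_space_eq)
  have \<sigma>s: "prob_space \<sigma>" "sets \<sigma> = sets (N i)" "space \<sigma> = space (N i)"
    using \<sigma> by (auto simp: space_prob_algebra dest: sets_eq_imp_space_eq)
  let ?d = "return (count_space UNIV) undefined"
  let ?K = "\<lambda>j. if j \<in> I then K j else ?d"
  let ?L = "\<lambda>j. if j \<in> I then (K(i := \<sigma>)) j else ?d"
  interpret A: product_prob_space ?K I
    by (intro product_prob_spaceI) (auto intro: Ks prob_space_return)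
  interpret B: product_prob_space ?L I
    by (intro product_prob_spaceI) (use Ks \<sigma>s in \<open>auto intro: prob_space_return\<close>)
  have eqK: "PiM I K = PiM I ?K" and eqL: "PiM I (K(i := \<sigma>)) = PiM I ?L"
    by (auto intro!: PiM_cong)
  have sK: "sets (PiM I K) = sets (PiM I N)" using Ks by (intro sets_PiM_cong) auto
  have sL: "sets (PiM I ?L) = sets (PiM I N)" using Ks \<sigma>s by (intro sets_PiM_cong) auto
  interpret P: prob_space "PiM I K" by (intro prob_space_PiM Ks)
  interpret S: prob_space \<sigma> by (rule \<sigma>s)
  interpret PS: pair_prob_space \<sigma> "PiM I K" ..
  have meas: "(\<lambda>(b, a). a(i := b)) \<in> \<sigma> \<Otimes>\<^sub>M PiM I K \<rightarrow>\<^sub>M PiM I N"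
  proof -
    have "(\<lambda>x. (snd x)(i := fst x)) \<in> N i \<Otimes>\<^sub>M PiM I N \<rightarrow>\<^sub>M PiM I N"
      by (rule measurable_fun_upd[where J=I]) (use I in auto)
    then show ?thesis
      by (simp add: case_prod_beta' measurable_cong_sets[OF sets_pair_measure_cong[OF \<sigma>s(2) sK] refl])
  qed
  have "distr (\<sigma> \<Otimes>\<^sub>M PiM I K) (PiM I N) (\<lambda>(b, a). a(i := b)) = PiM I ?L"
  proof (rule B.PiM_eqI[OF I(1)])
    show "sets (distr (\<sigma> \<Otimes>\<^sub>M PiM I K) (PiM I N) (\<lambda>(b, a). a(i := b))) = sets (PiM I ?L)"
      by (simp add: sL)
    fix A assume A: "\<And>j. j \<in> I \<Longrightarrow> A j \<in> sets (?L j)"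
    then have AN: "A j \<in> sets (N j)" if "j \<in> I" for j
      using A[OF that] Ks(2)[OF that] \<sigma>s that by (cases "j = i") auto
    have AK: "(A(i := space (N i))) j \<in> sets (?K j)" if "j \<in> I" for j
      using AN Ks that by auto
    \<comment> \<open>Before the update coordinate \<open>i\<close> is unconstrained; its factor is
      the mass of a whole probability space, that is 1.\<close>
    have "(\<lambda>(b, a). a(i := b)) -` (Pi\<^sub>E I A) \<inter> space (\<sigma> \<Otimes>\<^sub>M PiM I K) = A i \<times> Pi\<^sub>E I (A(i := space (N i)))"
      using I(2) Ks \<sigma>s sets.sets_into_space[OF AN]
      by (auto simp: space_pair_measure space_PiM PiE_iff extensional_def split: if_splits) blast+
    then have "emeasure (distr (\<sigma> \<Otimes>\<^sub>M PiM I K) (PiM I N) (\<lambda>(b, a). a(i := b))) (Pi\<^sub>E I A) =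
        emeasure (\<sigma> \<Otimes>\<^sub>M PiM I K) (A i \<times> Pi\<^sub>E I (A(i := space (N i))))"
      using AN I(1) by (subst emeasure_distr[OF meas]) (auto intro!: sets_PiM_I_finite)
    also have "\<dots> = emeasure \<sigma> (A i) * emeasure (PiM I K) (Pi\<^sub>E I (A(i := space (N i))))"
      using AN[OF I(2)] AN I \<sigma>s by (intro P.emeasure_pair_measure_Times) (auto simp: sK intro!: sets_PiM_I_finite)
    also have "emeasure (PiM I K) (Pi\<^sub>E I (A(i := space (N i)))) = (\<Prod>j\<in>I. emeasure (?K j) ((A(i := space (N i))) j))"
      unfolding eqK by (rule A.emeasure_PiM[OF I(1) AK])
    also have "\<dots> = (\<Prod>j\<in>I - {i}. emeasure (?L j) (A j))"
      using I Ks(3)[OF I(2)] prob_space.emeasure_space_1[OF Ks(1)[OF I(2)]]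
      by (subst prod.remove[OF I]) (auto intro!: prod.cong)
    also have "emeasure \<sigma> (A i) * \<dots> = (\<Prod>j\<in>I. emeasure (?L j) (A j))"
      using I by (subst prod.remove[OF I]) auto
    finally show "emeasure (distr (\<sigma> \<Otimes>\<^sub>M PiM I K) (PiM I N) (\<lambda>(b, a). a(i := b))) (Pi\<^sub>E I A) = (\<Prod>j\<in>I. emeasure (?L j) (A j))" .
  qed
  then have "(\<integral>a. f a \<partial>PiM I (K(i := \<sigma>))) = (\<integral>a. f a \<partial>distr (\<sigma> \<Otimes>\<^sub>M PiM I K) (PiM I N) (\<lambda>(b, a). a(i := b)))"
    by (simp add: eqL)
  also have "\<dots> = (\<integral>z. f ((\<lambda>(b, a). a(i := b)) z) \<partial>(\<sigma> \<Otimes>\<^sub>M PiM I K))"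
    by (rule integral_distr[OF meas f])
  also have "\<dots> = (\<integral>z. (\<lambda>(b, a). f (a(i := b))) z \<partial>(\<sigma> \<Otimes>\<^sub>M PiM I K))"
    by (simp add: case_prod_beta')
  also have "\<dots> = (\<integral>b. (\<integral>a. f (a(i := b)) \<partial>PiM I K) \<partial>\<sigma>)"
  proof (rule PS.integral_fst[symmetric])
    show "integrable (\<sigma> \<Otimes>\<^sub>M PiM I K) (\<lambda>(b, a). f (a(i := b)))"
    proof (rule bounded_integrable[of _ _ B])
      show "finite_measure (\<sigma> \<Otimes>\<^sub>M PiM I K)" by unfold_locales
      show "(\<lambda>(b, a). f (a(i := b))) \<in> borel_measurable (\<sigma> \<Otimes>\<^sub>M PiM I K)"
        using measurable_compose[OF meas f] by (simp add: case_prod_beta')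
      show "\<bar>(\<lambda>(b, a). f (a(i := b))) z\<bar> \<le> B" if "z \<in> space (\<sigma> \<Otimes>\<^sub>M PiM I K)" for z
        using B[OF measurable_space[OF meas that]] by (simp add: case_prod_beta')
    qed
  qed
  finally show ?thesis .
qed

section \<open>Values of finitely supported stationary strategies\<close>

text \<open>
  The cells \<open>{x. C x = k}\<close> partition the state space. A stationary multi-strategy that is constant on them
  is given by laws \<open>p k i\<close> on the finite sets \<open>S i\<close> of actions.
\<close>

locale csg_cells = csg_game G for G :: "('x, 'a::metric_space) csg" +
  fixes C :: "'x \<Rightarrow> nat" and S :: "nat \<Rightarrow> 'a set"
  assumes C[measurable]: "C \<in> states G \<rightarrow>\<^sub>M count_space UNIV"
    and finite_S: "\<And>i. i \<in> players G \<Longrightarrow> finite (S i)"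
    and S_acts: "\<And>i. i \<in> players G \<Longrightarrow> S i \<subseteq> acts G i"
begin

definition mixed :: "(nat \<Rightarrow> nat \<Rightarrow> 'a pmf) set" where
  "mixed = {p. \<forall>k. \<forall>i\<in>players G. set_pmf (p k i) \<subseteq> S i}"

definition policy :: "(nat \<Rightarrow> nat \<Rightarrow> 'a pmf) \<Rightarrow> nat \<Rightarrow> 'x \<Rightarrow> 'a measure" where
  "policy p i x = pmf_distr (act_space G i) (p (C x) i)"

definition weight :: "(nat \<Rightarrow> nat \<Rightarrow> 'a pmf) \<Rightarrow> 'x \<Rightarrow> (nat \<Rightarrow> 'a) \<Rightarrow> real" where
  "weight p x a = (\<Prod>i\<in>players G. pmf (p (C x) i) (a i))"

definition nets :: "(nat \<Rightarrow> 'a) set" where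
  "nets = PiE (players G) S"

definition bellman :: "('x \<times> (nat \<Rightarrow> 'a) \<Rightarrow> real) \<Rightarrow> (nat \<Rightarrow> nat \<Rightarrow> 'a pmf) \<Rightarrow> ('x \<Rightarrow> real) \<Rightarrow> 'x \<Rightarrow> real" where
  "bellman c p v x = (\<Sum>a\<in>nets. weight p x a * lookahead c v (x, a))"

definition value_iter :: "('x \<times> (nat \<Rightarrow> 'a) \<Rightarrow> real) \<Rightarrow> (nat \<Rightarrow> nat \<Rightarrow> 'a pmf) \<Rightarrow> nat \<Rightarrow> 'x \<Rightarrow> real" where
  "value_iter c p n = (bellman c p ^^ n) (\<lambda>_. 0)"

text \<open>The limit is taken pointwise, so that measurability and bounds are inherited from the
  iterates; the fixed-point equation is derived afterwards from the contraction estimate.\<close>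

definition val :: "('x \<times> (nat \<Rightarrow> 'a) \<Rightarrow> real) \<Rightarrow> (nat \<Rightarrow> nat \<Rightarrow> 'a pmf) \<Rightarrow> 'x \<Rightarrow> real" where
  "val c p x = lim (\<lambda>n. value_iter c p n x)"

lemma finite_nets [simp]: "finite nets"
  unfolding nets_def by (intro finite_PiE finite_S) simp

lemma nets_profiles: "nets \<subseteq> \<A>"
  using S_acts by (auto simp: nets_def profiles_def)

lemma policy_stationary:
  assumes p: "p \<in> mixed" and i: "i \<in> players G"
  shows "policy p i \<in> stationary_strategies G i"
  unfolding stationary_strategies_def policy_def[abs_def]
proof (rule measurable_compose[OF C])
  have "pmf_distr (act_space G i) (p k i) \<in> space (prob_algebra (act_space G i))" for k
  proof -
    have "set_pmf (p k i) \<subseteq> acts G i" using p i S_acts[OF i] by (auto simp: mixed_def)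
    then show ?thesis by (simp add: space_prob_algebra prob_space_pmf_distr)
  qed
  then show "(\<lambda>k. pmf_distr (act_space G i) (p k i)) \<in> count_space UNIV \<rightarrow>\<^sub>M prob_algebra (act_space G i)"
    by simp
qed

lemma policy_strategies:
  "p \<in> mixed \<Longrightarrow> stat (policy p) \<in> (\<Pi> i\<in>players G. strategies G i)"
  by (intro Pi_I stationary_in_strategies policy_stationary)

lemma integral_policy:
  fixes f :: "_ \<Rightarrow> real"
  assumes p: "p \<in> mixed" and f: "f \<in> borel_measurable (profile_space G)"
  shows "(\<integral>a. f a \<partial>PiM (players G) (\<lambda>i. policy p i x)) = (\<Sum>a\<in>nets. weight p x a * f a)"
  unfolding policy_def weight_def nets_def
  using p f finite_S S_acts by (intro integral_PiM_pmf_distr) (auto simp: mixed_def profile_space_def)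

lemma weight_nonneg: "0 \<le> weight p x a"
  unfolding weight_def by (intro prod_nonneg) simp

lemma sum_weight: "p \<in> mixed \<Longrightarrow> (\<Sum>a\<in>nets. weight p x a) = 1"
  unfolding weight_def nets_def using finite_S by (intro sum_prod_pmf_eq_1) (auto simp: mixed_def)

lemma abs_sum_weight_le:
  assumes p: "p \<in> mixed" and B: "\<And>a. a \<in> nets \<Longrightarrow> \<bar>f a\<bar> \<le> B"
  shows "\<bar>\<Sum>a\<in>nets. weight p x a * f a\<bar> \<le> B"
proof -
  have "\<bar>\<Sum>a\<in>nets. weight p x a * f a\<bar> \<le> (\<Sum>a\<in>nets. weight p x a * B)"
    by (rule order_trans[OF sum_abs]) (auto intro!: sum_mono mult_left_mono B simp: abs_mult weight_nonneg)
  also have "\<dots> = B" by (simp add: sum_weight[OF p] flip: sum_distrib_right)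
  finally show ?thesis .
qed

lemma measurable_weight [measurable]: "(\<lambda>x. weight p x a) \<in> borel_measurable (states G)"
proof -
  have "(\<lambda>k. \<Prod>i\<in>players G. pmf (p k i) (a i)) \<in> count_space UNIV \<rightarrow>\<^sub>M borel" by simp
  from measurable_compose[OF C this] show ?thesis by (simp add: weight_def[abs_def])
qed

lemma measurable_bellman:
  assumes "c \<in> borel_measurable \<K>" "v \<in> borel_measurable (states G)"
  shows "bellman c p v \<in> borel_measurable (states G)"
  unfolding bellman_def[abs_def]
  using nets_profiles by (intro borel_measurable_sum borel_measurable_times measurable_weight measurable_lookahead_state[OF assms]) auto

lemma abs_bellman_le:
  assumes p: "p \<in> mixed" and c: "\<And>z. z \<in> space \<K> \<Longrightarrow> \<bar>c z\<bar> \<le> b"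
    and v: "\<And>y. y \<in> \<X> \<Longrightarrow> \<bar>v y\<bar> \<le> b" and x: "x \<in> \<X>"
  shows "\<bar>bellman c p v x\<bar> \<le> b"
  unfolding bellman_def using nets_profiles
  by (intro abs_sum_weight_le p abs_lookahead_le c v x) auto

lemma bellman_contraction:
  assumes p: "p \<in> mixed"
    and u: "u \<in> borel_measurable (states G)" "\<And>y. y \<in> \<X> \<Longrightarrow> \<bar>u y\<bar> \<le> b"
    and v: "v \<in> borel_measurable (states G)" "\<And>y. y \<in> \<X> \<Longrightarrow> \<bar>v y\<bar> \<le> b"
    and uv: "\<And>y. y \<in> \<X> \<Longrightarrow> \<bar>u y - v y\<bar> \<le> e" and x: "x \<in> \<X>"
  shows "\<bar>bellman c p u x - bellman c p v x\<bar> \<le> discount G * e"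
proof -
  have "bellman c p u x - bellman c p v x = (\<Sum>a\<in>nets. weight p x a * (discount G * (\<integral>y. u y - v y \<partial>transition G x a)))"
    unfolding bellman_def sum_subtractf[symmetric]
  proof (rule sum.cong[OF refl])
    fix a assume "a \<in> nets"
    then have a: "a \<in> \<A>" using nets_profiles by auto
    interpret prob_space "transition G x a" by (rule transition_prob[OF x a])
    have "integrable (transition G x a) w" if "w \<in> borel_measurable (states G)" "\<And>y. y \<in> \<X> \<Longrightarrow> \<bar>w y\<bar> \<le> b" for w
      using that transition_prob[OF x a]
      by (intro bounded_integrable[OF finite_measure_axioms, of _ b])
        (auto simp: measurable_cong_sets[OF transition_prob(2)[OF x a] refl])
    from this[OF u] this[OF v]
    show "weight p x a * lookahead c u (x, a) - weight p x a * lookahead c v (x, a) =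
        weight p x a * (discount G * (\<integral>y. u y - v y \<partial>transition G x a))"
      by (simp add: lookahead_def Bochner_Integration.integral_diff algebra_simps)
  qed
  also have "\<bar>\<dots>\<bar> \<le> discount G * e"
  proof (rule abs_sum_weight_le[OF p])
    fix a assume "a \<in> nets"
    then have a: "a \<in> \<A>" using nets_profiles by auto
    show "\<bar>discount G * (\<integral>y. u y - v y \<partial>transition G x a)\<bar> \<le> discount G * e"
      using discount_pos abs_integral_transition_le[OF x a uv] by (simp add: abs_mult)
  qed
  finally show ?thesis .
qed

context
  fixes c :: "'x \<times> (nat \<Rightarrow> 'a) \<Rightarrow> real" and b :: real
  assumes c: "c \<in> borel_measurable \<K>" and b: "\<And>z. z \<in> space \<K> \<Longrightarrow> \<bar>c z\<bar> \<le> b" and b0: "0 \<le> b"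
begin

lemma value_iter_Suc: "value_iter c p (Suc n) = bellman c p (value_iter c p n)"
  by (simp add: value_iter_def)

lemma measurable_value_iter: "value_iter c p n \<in> borel_measurable (states G)"
  by (induction n) (simp_all add: value_iter_Suc measurable_bellman[OF c], simp add: value_iter_def)

lemma abs_value_iter_le: "p \<in> mixed \<Longrightarrow> x \<in> \<X> \<Longrightarrow> \<bar>value_iter c p n x\<bar> \<le> b"
proof (induction n arbitrary: x)
  case 0 then show ?case using b0 by (simp add: value_iter_def)
next
  case (Suc n) then show ?case unfolding value_iter_Suc by (intro abs_bellman_le b)
qed

text \<open>The distance between the \<open>m\<close>-th iterate and the starting function 0 is at
  most \<open>b\<close>, and it is contracted \<open>n\<close> times. The rate does not depend on
  \<open>p\<close>, which is what makes the values continuous in \<open>p\<close>.\<close>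

lemma value_iter_diff:
  "p \<in> mixed \<Longrightarrow> x \<in> \<X> \<Longrightarrow> \<bar>value_iter c p (n + m) x - value_iter c p n x\<bar> \<le> discount G ^ n * b"
proof (induction n arbitrary: x)
  case 0 then show ?case using abs_value_iter_le[of p x m] by (simp add: value_iter_def)
next
  case (Suc n)
  then have "\<bar>bellman c p (value_iter c p (n + m)) x - bellman c p (value_iter c p n) x\<bar> \<le> discount G * (discount G ^ n * b)"
    by (intro bellman_contraction[where b=b] measurable_value_iter abs_value_iter_le)
  then show ?case by (simp add: value_iter_Suc mult.assoc)
qed

lemma discount_power_lim: "(\<lambda>n. discount G ^ n * K) \<longlonglongrightarrow> 0"
  using discount_pos discount_less_1 by (intro tendsto_mult_left_zero LIMSEQ_power_zero) auto

lemma value_iter_lim: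
  assumes p: "p \<in> mixed" and x: "x \<in> \<X>"
  shows "(\<lambda>n. value_iter c p n x) \<longlonglongrightarrow> val c p x"
proof -
  have "Cauchy (\<lambda>n. value_iter c p n x)"
  proof (rule metric_CauchyI)
    fix e :: real assume "0 < e"
    then have "\<forall>\<^sub>F n in sequentially. discount G ^ n * (2 * b) < e"
      using discount_power_lim by (rule order_tendstoD[rotated])
    then obtain M where M: "discount G ^ M * (2 * b) < e" by (meson eventually_happens trivial_limit_sequentially)
    have near: "\<bar>value_iter c p n x - value_iter c p M x\<bar> \<le> discount G ^ M * b" if "M \<le> n" for n
      using value_iter_diff[OF p x, of M "n - M"] that by simp
    then have "dist (value_iter c p n x) (value_iter c p m x) < e" if "M \<le> n" "M \<le> m" for n m
      using M near[OF that(1)] near[OF that(2)] by (simp add: dist_real_def)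
    then show "\<exists>M. \<forall>m\<ge>M. \<forall>n\<ge>M. dist (value_iter c p m x) (value_iter c p n x) < e" by blast
  qed
  then show ?thesis unfolding val_def by (simp add: Cauchy_convergent_iff convergent_LIMSEQ_iff)
qed

lemma abs_val_diff_value_iter:
  assumes p: "p \<in> mixed" and x: "x \<in> \<X>"
  shows "\<bar>val c p x - value_iter c p n x\<bar> \<le> discount G ^ n * b"
proof (rule LIMSEQ_le_const2)
  show "(\<lambda>m. \<bar>value_iter c p (m + n) x - value_iter c p n x\<bar>) \<longlonglongrightarrow> \<bar>val c p x - value_iter c p n x\<bar>"
    by (intro tendsto_rabs tendsto_diff tendsto_const LIMSEQ_ignore_initial_segment value_iter_lim p x)
  show "\<exists>N. \<forall>m\<ge>N. \<bar>value_iter c p (m + n) x - value_iter c p n x\<bar> \<le> discount G ^ n * b"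
    using value_iter_diff[OF p x, of n] by (auto simp: add.commute)
qed

lemma measurable_val: "p \<in> mixed \<Longrightarrow> val c p \<in> borel_measurable (states G)"
  by (rule borel_measurable_LIMSEQ_real[OF value_iter_lim measurable_value_iter])

lemma abs_val_le:
  assumes p: "p \<in> mixed" and x: "x \<in> \<X>"
  shows "\<bar>val c p x\<bar> \<le> b"
  using abs_val_diff_value_iter[OF p x, of 0] by (simp add: value_iter_def)

lemma val_fixed_point:
  assumes p: "p \<in> mixed" and x: "x \<in> \<X>"
  shows "val c p x = bellman c p (val c p) x"
proof -
  have "\<bar>bellman c p (value_iter c p n) x - bellman c p (val c p) x\<bar> \<le> discount G ^ n * (discount G * b)" for n
    using bellman_contraction[OF p measurable_value_iter abs_value_iter_le[OF p] measurable_val[OF p] abs_val_le[OF p] _ x,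
        of n "discount G ^ n * b" c] abs_val_diff_value_iter[OF p]
    by (simp add: abs_minus_commute mult_ac)
  then have "(\<lambda>n. value_iter c p (Suc n) x - bellman c p (val c p) x) \<longlonglongrightarrow> 0"
    unfolding value_iter_Suc by (intro Lim_null_comparison[OF _ discount_power_lim]) (auto intro!: always_eventually)
  then have "(\<lambda>n. value_iter c p (Suc n) x) \<longlonglongrightarrow> bellman c p (val c p) x"
    by (simp add: LIM_zero_iff)
  with LIMSEQ_Suc[OF value_iter_lim[OF p x]] show ?thesis by (rule LIMSEQ_unique)
qed

lemma integral_transition_lim:
  assumes x: "x \<in> \<X>" "a \<in> \<A>" and v: "\<And>m. v m \<in> borel_measurable (states G)" "w \<in> borel_measurable (states G)"
    and B: "\<And>m y. y \<in> \<X> \<Longrightarrow> \<bar>v m y\<bar> \<le> B"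
    and lim: "\<And>y. y \<in> \<X> \<Longrightarrow> (\<lambda>m. v m y) \<longlonglongrightarrow> w y"
  shows "(\<lambda>m. \<integral>y. v m y \<partial>transition G x a) \<longlonglongrightarrow> (\<integral>y. (w y :: real) \<partial>transition G x a)"
proof (rule integral_dominated_convergence[where w="\<lambda>_. B"])
  note t = transition_prob[OF x]
  interpret prob_space "transition G x a" by (rule t)
  show "w \<in> borel_measurable (transition G x a)" "\<And>m. v m \<in> borel_measurable (transition G x a)"
    using v unfolding measurable_cong_sets[OF t(2) refl] by auto
qed (use B lim transition_prob[OF x] in \<open>auto simp: prob_space.finite_measure finite_measure.integrable_const intro!: AE_I2\<close>)

text \<open>For a finite horizon, continuity passes through the finite sums over \<open>nets\<close>
  and, by dominated convergence, through the transition integrals; hence convergence pointwise in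
  the state is enough for the induction. The horizon is then cut with an error uniform in the
  strategies.\<close>

lemma val_continuous:
  assumes p: "\<And>m. P m \<in> mixed" "p \<in> mixed"
    and lim: "\<And>k i a. i \<in> players G \<Longrightarrow> a \<in> S i \<Longrightarrow> (\<lambda>m. pmf (P m k i) a) \<longlonglongrightarrow> pmf (p k i) a"
    and x: "x \<in> \<X>"
  shows "(\<lambda>m. val c (P m) x) \<longlonglongrightarrow> val c p x"
proof -
  have w: "(\<lambda>m. weight (P m) x a) \<longlonglongrightarrow> weight p x a" if "a \<in> nets" for x a
    unfolding weight_def using that by (intro tendsto_prod lim) (auto simp: nets_def)
  have it: "(\<lambda>m. value_iter c (P m) n x) \<longlonglongrightarrow> value_iter c p n x" if "x \<in> \<X>" for n x
    using that
  proof (induction n arbitrary: x)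
    case (Suc n)
    have "(\<lambda>m. lookahead c (value_iter c (P m) n) (x, a)) \<longlonglongrightarrow> lookahead c (value_iter c p n) (x, a)" if "a \<in> nets" for a
      unfolding lookahead_def fst_conv snd_conv using that nets_profiles Suc p
      by (intro tendsto_intros integral_transition_lim[where B=b] measurable_value_iter abs_value_iter_le) auto
    then show ?case unfolding value_iter_Suc bellman_def
      by (intro tendsto_sum tendsto_mult w)
  qed (simp add: value_iter_def)
  show ?thesis
  proof (rule LIMSEQ_I)
    fix e :: real assume e: "0 < e"
    then have "\<forall>\<^sub>F n in sequentially. discount G ^ n * b < e / 4"
      by (intro order_tendstoD[OF discount_power_lim]) auto
    then obtain n where n: "discount G ^ n * b < e / 4" by (meson eventually_happens trivial_limit_sequentially)
    obtain M where M: "\<forall>m\<ge>M. norm (value_iter c (P m) n x - value_iter c p n x) < e / 2"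
      using LIMSEQ_D[OF it[OF x, of n], of "e / 2"] e by auto
    have "norm (val c (P m) x - val c p x) < e" if "M \<le> m" for m
      using abs_val_diff_value_iter[OF p(1) x, of m n] abs_val_diff_value_iter[OF p(2) x, of n] M that n
      by (force simp: abs_if split: if_splits)
    then show "\<exists>M. \<forall>m\<ge>M. norm (val c (P m) x - val c p x) < e" by blast
  qed
qed

lemma lookahead_continuous:
  assumes p: "\<And>m. P m \<in> mixed" "p \<in> mixed"
    and lim: "\<And>k i a. i \<in> players G \<Longrightarrow> a \<in> S i \<Longrightarrow> (\<lambda>m. pmf (P m k i) a) \<longlonglongrightarrow> pmf (p k i) a"
    and x: "x \<in> \<X>" "a \<in> \<A>"
  shows "(\<lambda>m. lookahead c (val c (P m)) (x, a)) \<longlonglongrightarrow> lookahead c (val c p) (x, a)"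
  unfolding lookahead_def fst_conv snd_conv using p x
  by (intro tendsto_intros integral_transition_lim[where B=b] measurable_val val_continuous lim) (auto intro!: abs_val_le)

lemma integral_init_continuous:
  assumes p: "\<And>m. P m \<in> mixed" "p \<in> mixed"
    and lim: "\<And>k i a. i \<in> players G \<Longrightarrow> a \<in> S i \<Longrightarrow> (\<lambda>m. pmf (P m k i) a) \<longlonglongrightarrow> pmf (p k i) a"
  shows "(\<lambda>m. \<integral>x. val c (P m) x \<partial>init G) \<longlonglongrightarrow> (\<integral>x. val c p x \<partial>init G)"
proof (rule integral_dominated_convergence[where w="\<lambda>_. b"])
  show "val c p \<in> borel_measurable (init G)" "\<And>m. val c (P m) \<in> borel_measurable (init G)"
    unfolding measurable_cong_sets[OF init_prob(2) refl] using p by (auto intro: measurable_val)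
  show "integrable (init G) (\<lambda>_. b)"
    using init_prob(1) by (simp add: prob_space.finite_measure finite_measure.integrable_const)
  show "AE x in init G. (\<lambda>m. val c (P m) x) \<longlonglongrightarrow> val c p x"
    using val_continuous[OF p lim] init_prob(3) by (intro AE_I2) auto
  show "AE x in init G. norm (val c (P m) x) \<le> b" for m
    using abs_val_le[OF p(1)] init_prob(3) by (intro AE_I2) auto
qed

text \<open>Telescoping in both directions identifies \<open>val\<close> with the discounted cost of the policy.\<close>

lemma integral_val_policy:
  assumes p: "p \<in> mixed"
    and J: "(\<lambda>t. (1 - discount G) * (discount G ^ t * (\<integral>\<omega>. c (\<omega> t) \<partial>play_measure G (stat (policy p))))) sums J"
  shows "(\<integral>x. val c p x \<partial>init G) = J"
proof -
  interpret csg_play G "stat (policy p)"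
    by unfold_locales (rule policy_strategies[OF p])
  note V = measurable_val[OF p] abs_val_le[OF p]
  have look: "(\<integral>a. lookahead c (val c p) (x, a) \<partial>act_kernel t (\<omega>, x)) = val c p x"
    if x: "x \<in> \<X>" for t \<omega> x
    unfolding val_fixed_point[OF p x] bellman_def
    using integral_policy[OF p measurable_lookahead_act[OF c V(1) x]] by (simp add: stationary_def)
  have zero: "(\<lambda>t. discount G ^ t * (\<integral>\<omega>. 0 \<partial>play)) sums 0" by simp
  have "(\<integral>x. val c p x \<partial>init G) \<le> J + 0"
    by (rule discounted_cost_ge[where c=c and r="\<lambda>_. 0" and R=0, OF V _ _ c b J _ zero])
      (use look in auto)
  moreover have "(\<integral>x. - val c p x \<partial>init G) \<le> - J + 0"
  proof (rule discounted_cost_ge[where V="\<lambda>x. - val c p x" and c="\<lambda>z. - c z" and r="\<lambda>_. 0" and R=0 and b=b])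
    show "(\<lambda>t. (1 - discount G) * (discount G ^ t * (\<integral>\<omega>. - c (\<omega> t) \<partial>play))) sums (- J)"
      using sums_minus[OF J] by simp
    show "- val c p x \<le> (\<integral>a. lookahead (\<lambda>z. - c z) (\<lambda>x. - val c p x) (x, a) \<partial>act_kernel t (\<omega>, x)) + 0"
      if x: "x \<in> \<X>" for t \<omega> x
    proof -
      have "(\<integral>a. lookahead (\<lambda>z. - c z) (\<lambda>x. - val c p x) (x, a) \<partial>act_kernel t (\<omega>, x))
        = (\<integral>a. - lookahead c (val c p) (x, a) \<partial>act_kernel t (\<omega>, x))"
        by (simp add: lookahead_def)
      then show ?thesis using look[OF x] by simp
    qed
  qed (use V c b zero in auto)
  ultimately show ?thesis by simp
qed

end

end

section \<open>Deviations and exit probabilities\<close>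

text \<open>A union bound over time that is valid for arbitrary history-dependent play: either the
  state is already in the bad set of its stage, or it enters the next bad set with probability at
  most \<open>\<theta>\<close>, whatever the actions.\<close>

lemma (in csg_play) exit_probability_le:
  fixes U :: "nat \<Rightarrow> 'x set"
  assumes U: "\<And>t. U t \<in> sets (states G)"
    and init: "measure (init G) (U 0) \<le> \<theta>"
    and trans: "\<And>t x a. x \<in> \<X> \<Longrightarrow> x \<notin> U t \<Longrightarrow> a \<in> \<A> \<Longrightarrow> measure (transition G x a) (U (Suc t)) \<le> \<theta>"
    and \<theta>: "0 \<le> \<theta>"
  shows "(\<integral>\<omega>. indicator (U t) (fst (\<omega> t)) \<partial>play) \<le> real (Suc t) * \<theta>"
proof (induction t)
  case 0
  have "(\<integral>\<omega>. indicator (U 0) (fst (\<omega> 0)) \<partial>play) = (\<integral>x. (indicator (U 0) x :: real) \<partial>init G)"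
    by (rule integral_play_init[where B=1]) (use U in \<open>auto split: split_indicator\<close>)
  also have "\<dots> = measure (init G) (U 0)"
  proof -
    have "space (init G) = \<X>"
      using init_prob by (auto simp: space_prob_algebra dest: sets_eq_imp_space_eq)
    then show ?thesis using sets.sets_into_space[OF U] by (simp add: Int_absorb2)
  qed
  finally show ?case using init by simp
next
  case (Suc t)
  let ?I = "\<lambda>t. indicator (U t) :: 'x \<Rightarrow> real"
  have I[measurable]: "?I t \<in> borel_measurable (states G)" for t using U by simp
  have st: "fst z \<in> \<X>" "snd z \<in> \<A>" if "z \<in> space \<K>" for z
    using that by (auto simp: stage_space_def space_pair_measure profile_space_def space_PiM profiles_def act_space_def space_restrict_space)
  have m1: "(\<lambda>z. \<integral>y. ?I (Suc t) y \<partial>transition G (fst z) (snd z)) \<in> borel_measurable \<K>"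
    by (rule measurable_compose[OF measurable_prob_algebraD[OF measurable_transition] integral_measurable_subprob_algebra[OF I]])
  have m2: "(\<lambda>z. \<theta> + ?I t (fst z)) \<in> borel_measurable \<K>"
    unfolding stage_space_def by measurable
  have t: "prob_space (transition G (fst z) (snd z))" "sets (transition G (fst z) (snd z)) = sets (states G)"
    if z: "z \<in> space \<K>" for z
    using measurable_space[OF measurable_transition z] by (auto simp: space_prob_algebra)
  have le: "(\<integral>y. ?I (Suc t) y \<partial>transition G (fst z) (snd z)) \<le> \<theta> + ?I t (fst z)" if z: "z \<in> space \<K>" for z
  proof -
    have "(\<integral>y. ?I (Suc t) y \<partial>transition G (fst z) (snd z)) = measure (transition G (fst z) (snd z)) (U (Suc t))"
      using sets_eq_imp_space_eq[OF t(2)[OF z]] sets.sets_into_space[OF U] by (simp add: Int_absorb2)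
    moreover have "measure (transition G (fst z) (snd z)) (U (Suc t)) \<le> 1"
      using t(1)[OF z] by (rule prob_space.prob_le_1)
    ultimately show ?thesis
      using trans[of "fst z" t "snd z"] st[OF z] \<theta> by (auto split: split_indicator)
  qed
  have "(\<integral>\<omega>. ?I (Suc t) (fst (\<omega> (Suc t))) \<partial>play) = (\<integral>\<omega>. (\<integral>y. ?I (Suc t) y \<partial>transition G (fst (\<omega> t)) (snd (\<omega> t))) \<partial>play)"
    by (rule integral_play_Suc[where B=1]) (use U in \<open>auto split: split_indicator\<close>)
  also have "\<dots> \<le> (\<integral>\<omega>. \<theta> + ?I t (fst (\<omega> t)) \<partial>play)"
  proof (rule integral_mono)
    show "integrable play (\<lambda>\<omega>. \<integral>y. ?I (Suc t) y \<partial>transition G (fst (\<omega> t)) (snd (\<omega> t)))"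
      by (rule integrable_play[OF m1, of 1], rule abs_integral_le_bound[OF t(1)]) (auto split: split_indicator)
    show "integrable play (\<lambda>\<omega>. \<theta> + ?I t (fst (\<omega> t)))"
      by (rule integrable_play[OF m2, of "\<theta> + 1"]) (use \<theta> in \<open>auto split: split_indicator\<close>)
    show "(\<integral>y. ?I (Suc t) y \<partial>transition G (fst (\<omega> t)) (snd (\<omega> t))) \<le> \<theta> + ?I t (fst (\<omega> t))" if "\<omega> \<in> space play" for \<omega>
      by (rule le[OF component_play[OF that]])
  qed
  also have "\<dots> = \<theta> + (\<integral>\<omega>. ?I t (fst (\<omega> t)) \<partial>play)"
  proof -
    have "integrable play (\<lambda>\<omega>. ?I t (fst (\<omega> t)))"
      by (rule integrable_play[of "\<lambda>z. ?I t (fst z)" 1]) (auto simp: stage_space_def split: split_indicator)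
    then show ?thesis by (simp add: play.prob_space)
  qed
  finally show ?case using Suc by (simp add: algebra_simps)
qed

text \<open>
  Up to stage \<open>T\<close> the state has entered the exceptional set \<open>U T\<close> only with small probability; the later stages are negligible
  because of discounting.
\<close>

lemma (in csg_play) discounted_exit_le:
  fixes U :: "nat \<Rightarrow> 'x set"
  assumes U: "\<And>t. U t \<in> sets (states G)" and mono: "\<And>t. t \<le> T \<Longrightarrow> U T \<subseteq> U t"
    and init: "measure (init G) (U 0) \<le> \<theta>"
    and trans: "\<And>t x a. x \<in> \<X> \<Longrightarrow> x \<notin> U t \<Longrightarrow> a \<in> \<A> \<Longrightarrow> measure (transition G x a) (U (Suc t)) \<le> \<theta>"
    and \<theta>: "0 \<le> \<theta>" and \<gamma>: "0 \<le> \<gamma>" and B: "0 \<le> B"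
  shows "\<exists>D. (\<lambda>t. discount G ^ t * (\<integral>\<omega>. \<gamma> + B * indicator (U T) (fst (\<omega> t)) \<partial>play)) sums D \<and>
    D \<le> (\<gamma> + B * (real (Suc T) * \<theta>) + B * discount G ^ Suc T) / (1 - discount G)"
proof -
  let ?\<alpha> = "discount G"
  \<comment> \<open>The set is \<open>U T\<close> at every stage. For \<open>t \<le> T\<close> it
    lies inside \<open>U t\<close>, and the probability of \<open>U t\<close> at stage
    \<open>t\<close> is the one under control.\<close>
  define q :: "nat \<Rightarrow> real" where "q t = (\<integral>\<omega>. indicator (U T) (fst (\<omega> t)) \<partial>play)" for t
  have [measurable]: "(\<lambda>z. indicator (U T) (fst z) :: real) \<in> borel_measurable \<K>"
    using U[of T] unfolding stage_space_def by measurable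
  have [measurable]: "(\<lambda>z. indicator (U t) (fst z) :: real) \<in> borel_measurable \<K>" for t
    using U[of t] unfolding stage_space_def by measurable
  have int: "integrable play (\<lambda>\<omega>. indicator (U s) (fst (\<omega> t)) :: real)" for s t
    by (rule integrable_play[of "\<lambda>z. indicator (U s) (fst z)" 1]) (auto split: split_indicator)
  have q01: "0 \<le> q t" "q t \<le> 1" for t
    using abs_integral_le_bound[OF play.prob_space_axioms, of "\<lambda>\<omega>. indicator (U T) (fst (\<omega> t))" 1]
    by (auto simp: q_def split: split_indicator)
  have qT: "q t \<le> real (Suc T) * \<theta>" if "t \<le> T" for t
  proof -
    have "q t \<le> (\<integral>\<omega>. indicator (U t) (fst (\<omega> t)) \<partial>play)"
      unfolding q_def using mono[OF that] by (intro integral_mono int) (auto split: split_indicator)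
    also have "\<dots> \<le> real (Suc t) * \<theta>" by (rule exit_probability_le[OF U init trans \<theta>])
    also have "\<dots> \<le> real (Suc T) * \<theta>" using that \<theta> by (intro mult_right_mono) auto
    finally show ?thesis .
  qed
  have eq: "(\<integral>\<omega>. \<gamma> + B * indicator (U T) (fst (\<omega> t)) \<partial>play) = \<gamma> + B * q t" for t
    using int[of T t] by (simp add: q_def play.prob_space)
  define f where "f t = ?\<alpha> ^ t * (\<gamma> + B * q t)" for t
  \<comment> \<open>Majorant of the summands: up to stage \<open>T\<close> the exit bound applies;
    for the later stages the trivial bound 1 on the probability is added.\<close>
  define g where "g t = ?\<alpha> ^ t * (\<gamma> + B * (real (Suc T) * \<theta>)) + B * (if t < Suc T then 0 else ?\<alpha> ^ t)" for t
  have sg: "(\<lambda>t. ?\<alpha> ^ t) sums (1 / (1 - ?\<alpha>))"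
    using discount_pos discount_less_1 by (intro geometric_sums) auto
  have "(\<lambda>t. ?\<alpha> ^ Suc T * ?\<alpha> ^ t) sums (?\<alpha> ^ Suc T * (1 / (1 - ?\<alpha>)))"
    by (rule sums_mult[OF sg])
  then have "(\<lambda>t. if t + Suc T < Suc T then 0 else ?\<alpha> ^ (t + Suc T)) sums (?\<alpha> ^ Suc T * (1 / (1 - ?\<alpha>)))"
    by (simp add: power_add mult_ac)
  then have s2: "(\<lambda>t. if t < Suc T then 0 else ?\<alpha> ^ t) sums (?\<alpha> ^ Suc T * (1 / (1 - ?\<alpha>)))"
    by (subst (asm) sums_iff_shift) simp
  have sums_g: "g sums ((1 / (1 - ?\<alpha>)) * (\<gamma> + B * (real (Suc T) * \<theta>)) + B * (?\<alpha> ^ Suc T * (1 / (1 - ?\<alpha>))))"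
    unfolding g_def[abs_def] by (intro sums_add sums_mult sums_mult2 sg s2)
  have fg: "f t \<le> g t" for t
  proof (cases "t < Suc T")
    case True
    then show ?thesis using qT[of t] B discount_pos by (auto simp: f_def g_def intro!: mult_left_mono)
  next
    case False
    have "f t \<le> ?\<alpha> ^ t * (\<gamma> + B * 1)"
      unfolding f_def using q01 B discount_pos by (intro mult_left_mono add_left_mono) auto
    also have "\<dots> \<le> ?\<alpha> ^ t * (\<gamma> + B * (real (Suc T) * \<theta>)) + B * ?\<alpha> ^ t"
      using \<theta> B discount_pos by (simp add: algebra_simps)
    finally show ?thesis using False by (simp add: g_def)
  qed
  have f0: "0 \<le> f t" for t
    using q01 B \<gamma> discount_pos by (simp add: f_def)
  have "summable f"
    by (rule summable_comparison_test'[OF sums_summable[OF sums_g], of 0]) (use f0 fg in simp)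
  then have "f sums suminf f" by (rule summable_sums)
  moreover have "suminf f \<le> (1 / (1 - ?\<alpha>)) * (\<gamma> + B * (real (Suc T) * \<theta>)) + B * (?\<alpha> ^ Suc T * (1 / (1 - ?\<alpha>)))"
    using suminf_le[OF fg \<open>summable f\<close> sums_summable[OF sums_g]] sums_unique[OF sums_g] by simp
  ultimately show ?thesis
    unfolding eq f_def[symmetric] by (intro exI[of _ "suminf f"]) (auto simp: add_divide_distrib f_def[abs_def])
qed

section \<open>Q-values of a policy and deviations of one player\<close>

context csg_cells
begin

text \<open>Coordinate \<open>i\<close> of the profile is overwritten by \<open>b\<close>, so the
  probabilities of player \<open>i\<close> in \<open>weight\<close> sum out while the others draw
  from \<open>p\<close>. From the next stage on everybody follows \<open>p\<close>, player
  \<open>i\<close> included.\<close>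

definition Qval :: "('x \<times> (nat \<Rightarrow> 'a) \<Rightarrow> real) \<Rightarrow> (nat \<Rightarrow> nat \<Rightarrow> 'a pmf) \<Rightarrow> nat \<Rightarrow> 'x \<Rightarrow> 'a \<Rightarrow> real" where
  "Qval c p i x b = (\<Sum>a\<in>nets. weight p x a * lookahead c (val c p) (x, a(i := b)))"

context
  fixes c :: "'x \<times> (nat \<Rightarrow> 'a) \<Rightarrow> real" and b :: real and p
  assumes c: "c \<in> borel_measurable \<K>" and b: "\<And>z. z \<in> space \<K> \<Longrightarrow> \<bar>c z\<bar> \<le> b" and b0: "0 \<le> b"
    and p: "p \<in> mixed"
begin

lemmas V = measurable_val[OF c b b0 p] abs_val_le[OF c b b0 p]

lemma abs_lookahead_val_le:
  assumes "x \<in> \<X>" "a \<in> \<A>"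
  shows "\<bar>lookahead c (val c p) (x, a)\<bar> \<le> b"
  by (rule abs_lookahead_le[OF b V(2) assms])

lemma abs_Qval_le:
  assumes "x \<in> \<X>" "i \<in> players G" "d \<in> acts G i"
  shows "\<bar>Qval c p i x d\<bar> \<le> b"
  unfolding Qval_def using nets_profiles assms
  by (intro abs_sum_weight_le p abs_lookahead_val_le upd_profiles) auto

lemma measurable_Qval:
  assumes x: "x \<in> \<X>" and i: "i \<in> players G"
  shows "Qval c p i x \<in> borel_measurable (act_space G i)"
  unfolding Qval_def[abs_def]
proof (intro borel_measurable_sum borel_measurable_times borel_measurable_const)
  fix a assume "a \<in> nets"
  then have a: "a \<in> \<A>" using nets_profiles by auto
  have "(\<lambda>d. a(i := d)) \<in> act_space G i \<rightarrow>\<^sub>M profile_space G"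
    unfolding profile_space_def
    using a i by (intro measurable_fun_upd[where J="players G"]) (auto simp: profiles_def space_PiM)
  from measurable_compose[OF this measurable_lookahead_act[OF c V(1) x]]
  show "(\<lambda>d. lookahead c (val c p) (x, a(i := d))) \<in> borel_measurable (act_space G i)" .
qed

lemma integral_lookahead_deviation:
  assumes x: "x \<in> \<X>" and i: "i \<in> players G" and \<sigma>: "\<sigma> \<in> space (prob_algebra (act_space G i))"
  shows "(\<integral>a. lookahead c (val c p) (x, a) \<partial>PiM (players G) ((\<lambda>j. policy p j x)(i := \<sigma>))) = (\<integral>d. Qval c p i x d \<partial>\<sigma>)"
proof -
  have "(\<integral>a. lookahead c (val c p) (x, a) \<partial>PiM (players G) ((\<lambda>j. policy p j x)(i := \<sigma>))) =
      (\<integral>d. (\<integral>a. lookahead c (val c p) (x, a(i := d)) \<partial>PiM (players G) (\<lambda>j. policy p j x)) \<partial>\<sigma>)"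
  proof (rule integral_PiM_fun_upd[where N="act_space G", OF finite_players i _ \<sigma>])
    show "policy p j x \<in> space (prob_algebra (act_space G j))" if "j \<in> players G" for j
      using measurable_space[OF policy_stationary[OF p that, unfolded stationary_strategies_def] x] .
    show "(\<lambda>a. lookahead c (val c p) (x, a)) \<in> borel_measurable (PiM (players G) (act_space G))"
      using measurable_lookahead_act[OF c V(1) x] by (simp add: profile_space_def)
    show "\<bar>lookahead c (val c p) (x, a)\<bar> \<le> b" if "a \<in> space (PiM (players G) (act_space G))" for a
      using that space_profile_space by (intro abs_lookahead_val_le x) (simp add: profile_space_def)
  qed
  also have "\<dots> = (\<integral>d. Qval c p i x d \<partial>\<sigma>)"
  proof (rule Bochner_Integration.integral_cong[OF refl])
    fix d assume "d \<in> space \<sigma>"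
    then have d: "d \<in> acts G i" using \<sigma> by (auto simp: space_prob_algebra dest: sets_eq_imp_space_eq)
    have "(\<lambda>a. a(i := d)) \<in> profile_space G \<rightarrow>\<^sub>M profile_space G"
      unfolding profile_space_def
      using d i by (intro measurable_fun_upd[where J="players G"]) auto
    from measurable_compose[OF this measurable_lookahead_act[OF c V(1) x]]
    show "(\<integral>a. lookahead c (val c p) (x, a(i := d)) \<partial>PiM (players G) (\<lambda>j. policy p j x)) = Qval c p i x d"
      unfolding Qval_def by (rule integral_policy[OF p])
  qed
  finally show ?thesis .
qed

text \<open>A deviation of player \<open>i\<close> to his own policy changes nothing.\<close>

lemma val_eq_sum_Qval:
  assumes x: "x \<in> \<X>" and i: "i \<in> players G"
  shows "val c p x = (\<Sum>d\<in>S i. pmf (p (C x) i) d * Qval c p i x d)"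
proof -
  have "val c p x = (\<integral>a. lookahead c (val c p) (x, a) \<partial>PiM (players G) ((\<lambda>j. policy p j x)(i := policy p i x)))"
    using val_fixed_point[OF c b b0 p x] integral_policy[OF p measurable_lookahead_act[OF c V(1) x]]
    by (simp add: bellman_def fun_upd_idem)
  also have "\<dots> = (\<integral>d. Qval c p i x d \<partial>policy p i x)"
    using measurable_space[OF policy_stationary[OF p i, unfolded stationary_strategies_def] x]
    by (rule integral_lookahead_deviation[OF x i])
  also have "\<dots> = (\<Sum>d\<in>S i. pmf (p (C x) i) d * Qval c p i x d)"
    unfolding policy_def using p i finite_S S_acts
    by (intro integral_pmf_distr measurable_Qval x) (auto simp: mixed_def)
  finally show ?thesis .
qed

text \<open>At each history the deviating strategy is only a mixture of actions, so an inequality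
  for all single actions integrates to one for the mixture. The comparison function
  \<open>val c p\<close> sees the current state alone, and this is why history-dependent strategies
  gain nothing over one-step deviations.\<close>

lemma policy_deviation:
  assumes i: "i \<in> players G" and \<sigma>: "\<sigma> \<in> strategies G i"
    and r: "r \<in> borel_measurable (states G)" "\<And>x. x \<in> \<X> \<Longrightarrow> \<bar>r x\<bar> \<le> R"
    and step: "\<And>x d. x \<in> \<X> \<Longrightarrow> d \<in> acts G i \<Longrightarrow> val c p x \<le> Qval c p i x d + r x"
    and J: "(\<lambda>t. (1 - discount G) * (discount G ^ t * (\<integral>\<omega>. c (\<omega> t) \<partial>play_measure G ((stat (policy p))(i := \<sigma>))))) sums J"
    and D: "(\<lambda>t. discount G ^ t * (\<integral>\<omega>. r (fst (\<omega> t)) \<partial>play_measure G ((stat (policy p))(i := \<sigma>)))) sums D"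
  shows "(\<integral>x. val c p x \<partial>init G) \<le> J + D"
proof -
  have "(stat (policy p))(i := \<sigma>) \<in> (\<Pi> i\<in>players G. strategies G i)"
    using policy_strategies[OF p] \<sigma> by (auto simp: Pi_iff)
  then interpret csg_play G "(stat (policy p))(i := \<sigma>)"
    by unfold_locales
  show ?thesis
  proof (rule discounted_cost_ge[OF V r c b J _ D])
    fix t :: nat and \<omega> x assume \<omega>: "\<omega> \<in> space (hist t)" and x: "x \<in> \<X>"
    have s: "\<sigma> t (\<omega>, x) \<in> space (prob_algebra (act_space G i))"
      using \<sigma> \<omega> x by (intro measurable_space[of "\<sigma> t" "history_space G t"])
        (auto simp: strategies_def history_space_def space_pair_measure)
    have eq: "act_kernel t (\<omega>, x) = PiM (players G) ((\<lambda>j. policy p j x)(i := \<sigma> t (\<omega>, x)))"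
      by (rule PiM_cong) (auto simp: stationary_def)
    have ss: "prob_space (\<sigma> t (\<omega>, x))" "sets (\<sigma> t (\<omega>, x)) = sets (act_space G i)" "space (\<sigma> t (\<omega>, x)) = acts G i"
      using s by (auto simp: space_prob_algebra dest: sets_eq_imp_space_eq)
    interpret s: prob_space "\<sigma> t (\<omega>, x)" by fact
    have "integrable (\<sigma> t (\<omega>, x)) (Qval c p i x)"
      using measurable_Qval[OF x i] ss abs_Qval_le[OF x i]
      by (intro bounded_integrable[OF s.finite_measure_axioms, of _ b])
        (auto simp: measurable_cong_sets[OF ss(2) refl])
    then have "(\<integral>d. val c p x - r x \<partial>\<sigma> t (\<omega>, x)) \<le> (\<integral>d. Qval c p i x d \<partial>\<sigma> t (\<omega>, x))"
      using step[OF x] ss(3) by (intro integral_mono) (auto simp: algebra_simps)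
    then have "val c p x \<le> (\<integral>d. Qval c p i x d \<partial>\<sigma> t (\<omega>, x)) + r x"
      by (simp add: s.prob_space)
    also have "(\<integral>d. Qval c p i x d \<partial>\<sigma> t (\<omega>, x)) = (\<integral>a. lookahead c (val c p) (x, a) \<partial>act_kernel t (\<omega>, x))"
      unfolding eq by (rule integral_lookahead_deviation[OF x i s, symmetric])
    finally show "val c p x \<le> (\<integral>a. lookahead c (val c p) (x, a) \<partial>act_kernel t (\<omega>, x)) + r x" .
  qed
qed

end

end

section \<open>Approximation by finitely many cells and actions\<close>

text \<open>The metric on functions is a sum of coordinate distances, capped at 1 and weighted by
  \<open>(1/2)^n\<close>, over an enumeration of the index type. Each term is at most
  \<open>(1/2)^n * dist u v\<close>, and the geometric series contributes the factor 2.\<close>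

lemma dist_fun_upd_le:
  fixes a :: "'i::countable \<Rightarrow> 'a::metric_space"
  shows "dist (a(i := u)) (a(i := v)) \<le> 2 * dist u v"
proof -
  have le: "(1/2)^n * min (dist ((a(i := u)) (from_nat n)) ((a(i := v)) (from_nat n))) 1 \<le> (1/2)^n * dist u v" for n
    by (intro mult_left_mono) (auto simp: min_le_iff_disj)
  have sg: "(\<lambda>n. (1/2)^n * dist u v) sums (2 * dist u v)"
    using sums_mult2[OF geometric_sums[of "1/2::real"]] by simp
  have "summable (\<lambda>n. (1/2)^n * min (dist ((a(i := u)) (from_nat n)) ((a(i := v)) (from_nat n))) 1)"
    by (rule summable_comparison_test'[OF sums_summable[OF sg], of 0]) (use le in simp)
  from suminf_le[OF le this sums_summable[OF sg]] show ?thesis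
    unfolding dist_fun_def sums_unique[OF sg, symmetric] .
qed

section \<open>Cells, action nets and tails under continuity and the density condition\<close>

locale csg_density = csg_game G for G :: "('x, 'a::metric_space) csg" +
  fixes \<mu> :: "'x measure" and \<delta> :: "'x \<Rightarrow> 'x \<Rightarrow> (nat \<Rightarrow> 'a) \<Rightarrow> real"
  assumes A1: "\<forall>x\<in>\<X>. \<forall>i\<in>players G. \<forall>l\<in>\<L>.
      continuous_on (\<A>) (cost G i l x)"
    and A2_mu: "\<mu> \<in> space (prob_algebra (states G))"
    and A2_measurable: "(\<lambda>(x, y, a). \<delta> x y a) \<in>
      borel_measurable (states G \<Otimes>\<^sub>M states G \<Otimes>\<^sub>M profile_space G)"
    and A2_nonneg: "\<forall>x\<in>\<X>. \<forall>y\<in>\<X>. \<forall>a\<in>\<A>. 0 \<le> \<delta> x y a"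
    and A2_density: "\<forall>x\<in>\<X>. \<forall>a\<in>\<A>. \<forall>B\<in>sets (states G).
      emeasure (transition G x a) B = (\<integral>\<^sup>+y\<in>B. ennreal (\<delta> x y a) \<partial>\<mu>)"
    and A2_continuous: "\<forall>x\<in>\<X>. \<forall>a\<in>\<A>. \<forall>s.
      (\<forall>n. s n \<in> \<A>) \<and> s \<longlonglongrightarrow> a \<longrightarrow>
      (\<lambda>n. \<integral>y. \<bar>\<delta> x y (s n) - \<delta> x y a\<bar> \<partial>\<mu>) \<longlonglongrightarrow> 0"
begin

lemma mu: "prob_space \<mu>" "sets \<mu> = sets (states G)" "space \<mu> = \<X>"
  using A2_mu by (auto simp: space_prob_algebra dest: sets_eq_imp_space_eq)

sublocale mu: prob_space \<mu> by (rule mu)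

lemma compact_acts: "i \<in> players G \<Longrightarrow> compact (acts G i)"
  and acts_nonempty: "i \<in> players G \<Longrightarrow> acts G i \<noteq> {}"
  using game by (auto simp: constrained_stochastic_game_def)

text \<open>Extensional functions form a full product in which every index outside
  \<open>players G\<close> carries the singleton \<open>{undefined}\<close>, so Tychonoff's theorem
  applies in the whole function type.\<close>

lemma compact_profiles: "compact (\<A>)"
proof -
  have "\<A> = Pi\<^sub>E UNIV (\<lambda>i. if i \<in> players G then acts G i else {undefined})"
    by (fastforce simp: profiles_def PiE_iff extensional_def split: if_splits)
  moreover have "compactin (product_topology (\<lambda>_. euclidean) UNIV) (Pi\<^sub>E UNIV (\<lambda>i. if i \<in> players G then acts G i else {undefined}))"
    by (subst compactin_PiE) (auto simp: compact_acts)
  ultimately show ?thesis by (simp add: euclidean_product_topology)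
qed

lemma measurable_delta:
  assumes "a \<in> \<A>"
  shows "(\<lambda>(x, y). \<delta> x y a) \<in> borel_measurable (states G \<Otimes>\<^sub>M \<mu>)"
proof -
  have "(\<lambda>z. (fst z, snd z, a)) \<in> states G \<Otimes>\<^sub>M states G \<rightarrow>\<^sub>M states G \<Otimes>\<^sub>M states G \<Otimes>\<^sub>M profile_space G"
    using assms by simp
  from measurable_compose[OF this A2_measurable]
  show ?thesis
    unfolding measurable_cong_sets[OF sets_pair_measure_cong[OF refl mu(2)] refl] by (simp add: case_prod_beta')
qed

lemma measurable_delta_state:
  assumes "x \<in> \<X>" "a \<in> \<A>"
  shows "(\<lambda>y. \<delta> x y a) \<in> borel_measurable \<mu>"
  using measurable_compose[OF measurable_Pair1'[OF assms(1)] measurable_delta[OF assms(2)]] by simp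

lemma transition_eq_density:
  assumes "x \<in> \<X>" "a \<in> \<A>"
  shows "transition G x a = density \<mu> (\<lambda>y. ennreal (\<delta> x y a))"
proof (rule measure_eqI)
  show "sets (transition G x a) = sets (density \<mu> (\<lambda>y. ennreal (\<delta> x y a)))"
    using transition_prob[OF assms] mu by simp
  fix B assume "B \<in> sets (transition G x a)"
  then have "B \<in> sets (states G)" using transition_prob[OF assms] by simp
  then show "emeasure (transition G x a) B = emeasure (density \<mu> (\<lambda>y. ennreal (\<delta> x y a))) B"
    using assms A2_density measurable_delta_state[OF assms] mu(2) by (subst emeasure_density) auto
qed

lemma integrable_delta:
  assumes "x \<in> \<X>" "a \<in> \<A>"
  shows "integrable \<mu> (\<lambda>y. \<delta> x y a)"
proof (rule integrableI_nonneg)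
  show "(\<lambda>y. \<delta> x y a) \<in> borel_measurable \<mu>" by (rule measurable_delta_state[OF assms])
  show "AE y in \<mu>. 0 \<le> \<delta> x y a" using A2_nonneg assms mu(3) by (intro AE_I2) auto
  interpret prob_space "transition G x a" by (rule transition_prob[OF assms])
  have "(\<integral>\<^sup>+y. ennreal (\<delta> x y a) \<partial>\<mu>) = (\<integral>\<^sup>+y\<in>\<X>. ennreal (\<delta> x y a) \<partial>\<mu>)"
    using mu(3) by (intro nn_integral_cong) auto
  also have "\<dots> = emeasure (transition G x a) (\<X>)"
    using A2_density assms by auto
  also have "\<dots> = 1"
    using emeasure_space_1 transition_prob(3)[OF assms] by simp
  finally show "(\<integral>\<^sup>+y. ennreal (\<delta> x y a) \<partial>\<mu>) < \<infinity>" by simp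
qed

lemma integral_transition:
  fixes v :: "'x \<Rightarrow> real"
  assumes x: "x \<in> \<X>" "a \<in> \<A>" and v: "v \<in> borel_measurable (states G)"
  shows "(\<integral>y. v y \<partial>transition G x a) = (\<integral>y. \<delta> x y a * v y \<partial>\<mu>)"
proof -
  have "v \<in> borel_measurable \<mu>" using v by (simp add: measurable_cong_sets[OF mu(2) refl])
  moreover have "AE y in \<mu>. 0 \<le> \<delta> x y a" using A2_nonneg x mu(3) by (intro AE_I2) auto
  ultimately show ?thesis
    unfolding transition_eq_density[OF x] by (subst integral_density) (auto intro: measurable_delta_state x)
qed

lemma integral_transition_diff_le:
  fixes v :: "'x \<Rightarrow> real"
  assumes x: "x \<in> \<X>" "a \<in> \<A>" and x': "x' \<in> \<X>" "a' \<in> \<A>"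
    and v: "v \<in> borel_measurable (states G)" and B: "\<And>y. y \<in> \<X> \<Longrightarrow> \<bar>v y\<bar> \<le> B"
  shows "\<bar>(\<integral>y. v y \<partial>transition G x a) - (\<integral>y. v y \<partial>transition G x' a')\<bar>
    \<le> B * L1_dist \<mu> (\<lambda>y. \<delta> x y a) (\<lambda>y. \<delta> x' y a')"
  unfolding integral_transition[OF x v] integral_transition[OF x' v]
  using v B mu by (intro integral_diff_le_L1_dist integrable_delta x x') (auto simp: measurable_cong_sets[OF mu(2) refl])

lemma transition_measure_diff_le:
  assumes x: "x \<in> \<X>" "a \<in> \<A>" and x': "x' \<in> \<X>" "a' \<in> \<A>"
    and E: "E \<in> sets (states G)"
  shows "\<bar>measure (transition G x a) E - measure (transition G x' a') E\<bar>
    \<le> L1_dist \<mu> (\<lambda>y. \<delta> x y a) (\<lambda>y. \<delta> x' y a')"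
proof -
  have "measure (transition G x a) E = (\<integral>y. indicator E y \<partial>transition G x a)"
    if "x \<in> \<X>" "a \<in> \<A>" for x a
    using sets.sets_into_space[OF E] transition_prob(3)[OF that] by (simp add: Int_absorb2)
  from this[OF x] this[OF x'] show ?thesis
    using integral_transition_diff_le[OF x x', of "indicator E" 1] E by (auto split: split_indicator)
qed

text \<open>The density and all cost functions are treated uniformly, as \<open>L\<^sup>1(\<mu>)\<close>-valued functions of the actions.\<close>

definition kern :: "(nat \<times> nat) option \<Rightarrow> (nat \<Rightarrow> 'a) \<Rightarrow> 'x \<Rightarrow> 'x \<Rightarrow> real" where
  "kern j a x y = (case j of None \<Rightarrow> \<delta> x y a | Some (i, l) \<Rightarrow> cost G i l x a)"

definition kinds :: "(nat \<times> nat) option set" where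
  "kinds = insert None (Some ` (players G \<times> \<L>))"

lemma finite_kinds: "finite kinds"
  by (simp add: kinds_def players_def constraints_def)

lemma kern_None: "kern None a x = (\<lambda>y. \<delta> x y a)"
  by (rule ext) (simp add: kern_def)

text \<open>A cost does not depend on the second state and \<open>\<mu>\<close> has mass 1, so the
  L1 distance reduces to a difference of numbers. This is what lets costs and density share one
  estimate.\<close>

lemma L1_dist_kern_Some: "L1_dist \<mu> (kern (Some (i, l)) a x) (kern (Some (i, l)) a' x') = \<bar>cost G i l x a - cost G i l x' a'\<bar>"
  by (simp add: L1_dist_def kern_def mu.prob_space)

lemma kern_measurable:
  assumes "j \<in> kinds" "a \<in> \<A>"
  shows "(\<lambda>(x, y). kern j a x y) \<in> borel_measurable (states G \<Otimes>\<^sub>M \<mu>)"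
proof (cases j)
  case None
  then show ?thesis using measurable_delta[OF assms(2)] by (simp add: kern_None)
next
  case (Some il)
  then obtain i l where j: "j = Some (i, l)" "i \<in> players G" "l \<in> \<L>"
    using assms(1) by (auto simp: kinds_def)
  have "(\<lambda>z. (fst z, a)) \<in> states G \<Otimes>\<^sub>M \<mu> \<rightarrow>\<^sub>M \<K>"
    unfolding stage_space_def using assms(2) by (intro measurable_Pair measurable_fst measurable_const) simp
  from measurable_compose[OF this measurable_cost[OF j(2,3)]] show ?thesis
    by (simp add: j kern_def case_prod_beta')
qed

lemma kern_integrable:
  assumes "j \<in> kinds" "x \<in> \<X>" "a \<in> \<A>"
  shows "integrable \<mu> (kern j a x)"
proof (cases j)
  case None
  then show ?thesis using integrable_delta[OF assms(2,3)] by (simp add: kern_None)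
qed (auto simp: kern_def[abs_def])

lemma kern_continuous:
  assumes "j \<in> kinds" "x \<in> \<X>" "a \<in> \<A>" "\<And>n. s n \<in> \<A>" "s \<longlonglongrightarrow> a"
  shows "(\<lambda>n. L1_dist \<mu> (kern j (s n) x) (kern j a x)) \<longlonglongrightarrow> 0"
proof (cases j)
  case None
  then show ?thesis using A2_continuous assms by (simp add: kern_None L1_dist_def)
next
  case (Some il)
  then obtain i l where j: "j = Some (i, l)" "i \<in> players G" "l \<in> \<L>"
    using assms(1) by (auto simp: kinds_def)
  have "continuous_on (\<A>) (cost G i l x)" using A1 j assms(2) by auto
  then have "(\<lambda>n. cost G i l x (s n)) \<longlonglongrightarrow> cost G i l x a"
    using assms(3-5) by (auto simp: continuous_on_sequentially o_def)
  then show ?thesis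
    unfolding j L1_dist_kern_Some by (intro tendsto_rabs_zero) (simp add: LIM_zero_iff)
qed

lemma states_nonempty: "\<X> \<noteq> {}"
  using mu.not_empty mu(3) by simp

lemma cells_exist:
  assumes "0 < e"
  shows "\<exists>C. C \<in> states G \<rightarrow>\<^sub>M count_space (UNIV :: nat set) \<and>
    (\<forall>x\<in>\<X>. \<forall>x'\<in>\<X>. C x = C x' \<longrightarrow>
      (\<forall>j\<in>kinds. \<forall>a\<in>\<A>. L1_dist \<mu> (kern j a x) (kern j a x') \<le> e))"
proof -
  have cg: "countably_generated \<mu>"
    using game mu by (simp add: constrained_stochastic_game_def countably_generated_def)
  have "\<exists>C. C \<in> states G \<rightarrow>\<^sub>M count_space (UNIV :: nat set) \<and>
    (\<forall>x\<in>\<X>. \<forall>x'\<in>\<X>. C x = C x' \<longrightarrow>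
      (\<forall>a\<in>\<A>. L1_dist \<mu> (kern j a x) (kern j a x') \<le> e))" if "j \<in> kinds" for j
    using that
    by (intro L1_continuous_family_countable_partition mu cg compact_profiles states_nonempty \<open>0 < e\<close>
        kern_measurable kern_integrable kern_continuous)
  then have "\<forall>j\<in>kinds. \<exists>C. C \<in> states G \<rightarrow>\<^sub>M count_space (UNIV :: nat set) \<and>
    (\<forall>x\<in>\<X>. \<forall>x'\<in>\<X>. C x = C x' \<longrightarrow>
      (\<forall>a\<in>\<A>. L1_dist \<mu> (kern j a x) (kern j a x') \<le> e))" by blast
  from bchoice[OF this] obtain C where C: "\<And>j. j \<in> kinds \<Longrightarrow> C j \<in> states G \<rightarrow>\<^sub>M count_space (UNIV :: nat set)"
    "\<And>j x x' a. j \<in> kinds \<Longrightarrow> x \<in> \<X> \<Longrightarrow> x' \<in> \<X> \<Longrightarrow> C j x = C j x' \<Longrightarrow>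
      a \<in> \<A> \<Longrightarrow> L1_dist \<mu> (kern j a x) (kern j a x') \<le> e"
    by blast
  obtain D where D: "D \<in> states G \<rightarrow>\<^sub>M count_space (UNIV :: nat set)"
    "\<forall>x x'. D x = D x' \<longrightarrow> (\<forall>j\<in>kinds. C j x = C j x')"
    using finite_common_refinement[where J=kinds and C=C, OF finite_kinds C(1)] by blast
  then show ?thesis using C(2) by blast
qed

lemma kern_unif:
  assumes X: "finite X" "X \<subseteq> \<X>" and "0 < e"
  shows "\<exists>d>0. \<forall>x\<in>X. \<forall>j\<in>kinds. \<forall>a\<in>\<A>. \<forall>a'\<in>\<A>. dist a a' < d \<longrightarrow>
    L1_dist \<mu> (kern j a x) (kern j a' x) < e"
proof -
  have "\<exists>d>0. \<forall>a\<in>\<A>. \<forall>a'\<in>\<A>. dist a a' < d \<longrightarrow> L1_dist \<mu> (kern j a x) (kern j a' x) < e"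
    if "j \<in> kinds" "x \<in> X" for j x
  proof -
    have x: "x \<in> \<X>" using that X by auto
    show ?thesis
      using L1_uniformly_continuous[of "\<A>" \<mu> "\<lambda>a. kern j a x", OF compact_profiles
          kern_integrable[OF that(1) x] kern_continuous[OF that(1) x] \<open>0 < e\<close>] by blast
  qed
  then have "\<forall>z\<in>kinds \<times> X. \<exists>d>0. \<forall>a\<in>\<A>. \<forall>a'\<in>\<A>. dist a a' < d \<longrightarrow>
      L1_dist \<mu> (kern (fst z) a (snd z)) (kern (fst z) a' (snd z)) < e"
    by auto
  from bchoice[OF this] obtain d where d: "\<forall>z\<in>kinds \<times> X. 0 < d z \<and> (\<forall>a\<in>\<A>. \<forall>a'\<in>\<A>. dist a a' < d z \<longrightarrow>
      L1_dist \<mu> (kern (fst z) a (snd z)) (kern (fst z) a' (snd z)) < e)" ..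
  \<comment> \<open>The 1 keeps the minimum well defined when \<open>X\<close> is empty.\<close>
  let ?d = "Min (insert 1 (d ` (kinds \<times> X)))"
  have fin: "finite (insert 1 (d ` (kinds \<times> X)))" using X(1) finite_kinds by simp
  have "0 < ?d" using fin d by (subst Min_gr_iff) auto
  moreover have "L1_dist \<mu> (kern j a x) (kern j a' x) < e"
    if "x \<in> X" "j \<in> kinds" "a \<in> \<A>" "a' \<in> \<A>" "dist a a' < ?d" for x j a a'
  proof -
    have "?d \<le> d (j, x)" using that fin by (intro Min_le) auto
    with that bspec[OF d, of "(j, x)"] show ?thesis by auto
  qed
  ultimately show ?thesis by blast
qed

text \<open>The modulus of continuity in the actions depends on the state, so one net serves only
  finitely many states; it is used at the representatives of cells, and the cells transfer the
  estimate to other states. The radius \<open>d / 2\<close> offsets the factor 2 of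
  \<open>dist_fun_upd_le\<close>.\<close>

lemma action_nets_exist:
  assumes X: "finite X" "X \<subseteq> \<X>" and "0 < e"
  shows "\<exists>S. \<forall>i\<in>players G. finite (S i) \<and> S i \<subseteq> acts G i \<and> S i \<noteq> {} \<and>
    (\<forall>b\<in>acts G i. \<exists>b'\<in>S i. \<forall>x\<in>X. \<forall>j\<in>kinds. \<forall>a\<in>\<A>.
      L1_dist \<mu> (kern j (a(i := b)) x) (kern j (a(i := b')) x) < e)"
proof -
  obtain d where d: "0 < d" "\<And>x j a a'. x \<in> X \<Longrightarrow> j \<in> kinds \<Longrightarrow> a \<in> \<A> \<Longrightarrow> a' \<in> \<A> \<Longrightarrow> dist a a' < d \<Longrightarrow>
    L1_dist \<mu> (kern j a x) (kern j a' x) < e"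
    using kern_unif[OF assms] by blast
  have "\<exists>F. finite F \<and> F \<subseteq> acts G i \<and> F \<noteq> {} \<and> (\<forall>b\<in>acts G i. \<exists>b'\<in>F. dist b b' < d / 2)" if i: "i \<in> players G" for i
  proof -
    obtain F where F: "finite F" "F \<subseteq> acts G i" "\<And>b. b \<in> acts G i \<Longrightarrow> \<exists>b'\<in>F. dist b b' < d / 2"
      using compact_finite_net[OF compact_acts[OF i], of "d / 2"] d(1) by auto
    moreover have "F \<noteq> {}" using F(3) acts_nonempty[OF i] by blast
    ultimately show ?thesis by blast
  qed
  then have "\<forall>i\<in>players G. \<exists>F. finite F \<and> F \<subseteq> acts G i \<and> F \<noteq> {} \<and> (\<forall>b\<in>acts G i. \<exists>b'\<in>F. dist b b' < d / 2)" by blast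
  from bchoice[OF this] obtain S where S: "\<And>i. i \<in> players G \<Longrightarrow> finite (S i)" "\<And>i. i \<in> players G \<Longrightarrow> S i \<subseteq> acts G i"
    "\<And>i. i \<in> players G \<Longrightarrow> S i \<noteq> {}" "\<And>i b. i \<in> players G \<Longrightarrow> b \<in> acts G i \<Longrightarrow> \<exists>b'\<in>S i. dist b b' < d / 2"
    by blast
  have net: "\<exists>b'\<in>S i. \<forall>x\<in>X. \<forall>j\<in>kinds. \<forall>a\<in>\<A>. L1_dist \<mu> (kern j (a(i := b)) x) (kern j (a(i := b')) x) < e"
    if i: "i \<in> players G" and b: "b \<in> acts G i" for i b
  proof -
    obtain b' where b': "b' \<in> S i" "dist b b' < d / 2" using S(4)[OF i b] by blast
    then have b'a: "b' \<in> acts G i" using S(2)[OF i] by auto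
    have dist: "dist (a(i := b)) (a(i := b')) < d" for a :: "nat \<Rightarrow> 'a"
      using dist_fun_upd_le[of a i b b'] b'(2) by simp
    have "L1_dist \<mu> (kern j (a(i := b)) x) (kern j (a(i := b')) x) < e"
      if "x \<in> X" "j \<in> kinds" "a \<in> \<A>" for x j a
      by (rule d(2)[OF that(1,2) upd_profiles[OF that(3) i b] upd_profiles[OF that(3) i b'a] dist])
    with b'(1) show ?thesis by blast
  qed
  show ?thesis
    by (rule exI[of _ S], intro ballI conjI net S(1-3))
qed

lemma finite_cell_tail:
  assumes C: "C \<in> states G \<rightarrow>\<^sub>M count_space (UNIV :: nat set)" and P: "prob_space P" "sets P = sets (states G)" and "0 < e"
  shows "\<exists>K. measure P {y \<in> \<X>. K < C y} < e"
proof -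
  interpret prob_space P by fact
  note [measurable] = C
  have sp: "space P = \<X>" using sets_eq_imp_space_eq[OF P(2)] .
  define A where "A K = {y \<in> \<X>. K < C y}" for K
  have "A K \<in> sets (states G)" for K unfolding A_def by measurable
  then have "range A \<subseteq> sets P" using P(2) by auto
  moreover have "decseq A" by (auto simp: decseq_def A_def)
  ultimately have "(\<lambda>K. measure P (A K)) \<longlonglongrightarrow> measure P (\<Inter>K. A K)"
    by (rule finite_Lim_measure_decseq)
  moreover have "(\<Inter>K. A K) = {}" by (auto simp: A_def)
  ultimately have "\<forall>\<^sub>F K in sequentially. measure P (A K) < e"
    using \<open>0 < e\<close> by (intro order_tendstoD) auto
  then show ?thesis unfolding A_def by (meson eventually_happens trivial_limit_sequentially)
qed

text \<open>By compactness and the L1-continuity of the density, the transition laws from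
  \<open>x\<close> are within \<open>e / 2\<close> of those of finitely many profiles, and finitely
  many laws have small tails beyond a common index.\<close>

lemma uniform_cell_tail:
  assumes C[measurable]: "C \<in> states G \<rightarrow>\<^sub>M count_space (UNIV :: nat set)" and x: "x \<in> \<X>" and e: "0 < e"
  shows "\<exists>K. \<forall>a\<in>\<A>. measure (transition G x a) {y \<in> \<X>. K < C y} \<le> e"
proof -
  have "0 < e / 2" using e by simp
  then obtain d where d: "0 < d" "\<And>a a'. a \<in> \<A> \<Longrightarrow> a' \<in> \<A> \<Longrightarrow> dist a a' < d \<Longrightarrow>
    L1_dist \<mu> (kern None a x) (kern None a' x) < e / 2"
    using kern_unif[of "{x}" "e / 2"] x by (auto simp: kinds_def)
  obtain F where F: "finite F" "F \<subseteq> \<A>" "\<And>a. a \<in> \<A> \<Longrightarrow> \<exists>a'\<in>F. dist a a' < d"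
    using compact_finite_net[OF compact_profiles d(1)] by auto
  let ?A = "\<lambda>K. {y \<in> \<X>. K < C y}"
  have A[measurable]: "?A K \<in> sets (states G)" for K by measurable
  have "\<exists>K. measure (transition G x a) (?A K) < e / 2" if "a \<in> F" for a
    using that F(2) transition_prob[OF x] e by (intro finite_cell_tail C) auto
  then obtain K where K: "\<And>a. a \<in> F \<Longrightarrow> measure (transition G x a) (?A (K a)) < e / 2" by metis
  have "measure (transition G x a) (?A (Max (K ` F))) \<le> e" if a: "a \<in> \<A>" for a
  proof -
    obtain a' where a': "a' \<in> F" "dist a a' < d" using F(3)[OF a] by blast
    then have a'p: "a' \<in> \<A>" using F(2) by auto
    interpret prob_space "transition G x a'" by (rule transition_prob[OF x a'p])
    have "K a' \<le> Max (K ` F)" using F(1) a'(1) by (intro Max_ge) auto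
    then have "measure (transition G x a') (?A (Max (K ` F))) \<le> measure (transition G x a') (?A (K a'))"
      using A by (intro finite_measure_mono) (auto simp: transition_prob(2)[OF x a'p])
    moreover have "\<bar>measure (transition G x a) (?A (Max (K ` F))) - measure (transition G x a') (?A (Max (K ` F)))\<bar> < e / 2"
      using transition_measure_diff_le[OF x a x a'p A, of "Max (K ` F)"] d(2)[OF a a'p a'(2)] by (simp add: kern_None)
    ultimately show ?thesis using K[OF a'(1)] by linarith
  qed
  then show ?thesis by blast
qed

text \<open>The thresholds are found recursively, with reference to the cells but not to any
  strategy. Of the bound \<open>2 * e\<close>, one \<open>e\<close> is the tail at a single state of
  the cell, and the other is the variation of the transition law within the cell.\<close>

lemma finite_cells_suffice:
  assumes C[measurable]: "C \<in> states G \<rightarrow>\<^sub>M count_space (UNIV :: nat set)" and e: "0 < e"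
    and cells: "\<And>x x' a. x \<in> \<X> \<Longrightarrow> x' \<in> \<X> \<Longrightarrow> C x = C x' \<Longrightarrow> a \<in> \<A> \<Longrightarrow>
      L1_dist \<mu> (kern None a x) (kern None a x') \<le> e"
  obtains K :: "nat \<Rightarrow> nat" where "mono K"
    "measure (init G) {y \<in> \<X>. K 0 < C y} \<le> 2 * e"
    "\<And>t x a. x \<in> \<X> \<Longrightarrow> C x \<le> K t \<Longrightarrow> a \<in> \<A> \<Longrightarrow>
      measure (transition G x a) {y \<in> \<X>. K (Suc t) < C y} \<le> 2 * e"
proof -
  let ?A = "\<lambda>K. {y \<in> \<X>. K < C y}"
  have A[measurable]: "?A K \<in> sets (states G)" for K by measurable
  have "\<exists>K. measure (init G) (?A K) < e"
    using game e by (intro finite_cell_tail C) (auto simp: constrained_stochastic_game_def space_prob_algebra)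
  then obtain K0 where K0: "measure (init G) (?A K0) < e" by blast
  have "\<exists>R. \<forall>x\<in>\<X>. C x = k \<longrightarrow> (\<forall>a\<in>\<A>. measure (transition G x a) (?A R) \<le> 2 * e)" for k
  proof (cases "\<exists>x\<in>\<X>. C x = k")
    case True
    then obtain z where z: "z \<in> \<X>" "C z = k" by blast
    obtain R where R: "\<And>a. a \<in> \<A> \<Longrightarrow> measure (transition G z a) (?A R) \<le> e"
      using uniform_cell_tail[OF C z(1) e] by blast
    have "measure (transition G x a) (?A R) \<le> 2 * e" if x: "x \<in> \<X>" "C x = k" and a: "a \<in> \<A>" for x a
      using transition_measure_diff_le[OF x(1) a z(1) a A, of R] cells[OF x(1) z(1) _ a] R[OF a] x(2) z(2)
      by (simp add: kern_None)
    then show ?thesis by blast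
  qed auto
  then have "\<forall>k. \<exists>R. \<forall>x\<in>\<X>. C x = k \<longrightarrow> (\<forall>a\<in>\<A>. measure (transition G x a) (?A R) \<le> 2 * e)" ..
  from choice[OF this] obtain R where
    "\<forall>k. \<forall>x\<in>\<X>. C x = k \<longrightarrow> (\<forall>a\<in>\<A>. measure (transition G x a) (?A (R k)) \<le> 2 * e)" ..
  then have R: "\<And>x a. x \<in> \<X> \<Longrightarrow> a \<in> \<A> \<Longrightarrow> measure (transition G x a) (?A (R (C x))) \<le> 2 * e"
    by simp
  \<comment> \<open>Only finitely many cells lie below the present threshold, so their indices
    \<open>R\<close> have a maximum; the outer \<open>max\<close> makes the thresholds
    monotone.\<close>
  define K where "K = rec_nat K0 (\<lambda>_ k. max k (Max (R ` {..k})))"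
  have K_Suc: "K (Suc t) = max (K t) (Max (R ` {..K t}))" and K_0: "K 0 = K0" for t by (simp_all add: K_def)
  show ?thesis
  proof (rule that[of K])
    show "mono K" by (rule incseq_SucI) (simp add: K_Suc)
    show "measure (init G) (?A (K 0)) \<le> 2 * e" using K0 e by (simp add: K_0)
    fix t x a assume x: "x \<in> \<X>" "C x \<le> K t" and a: "a \<in> \<A>"
    interpret prob_space "transition G x a" by (rule transition_prob[OF x(1) a])
    have "R (C x) \<le> Max (R ` {..K t})" using x(2) by (intro Max_ge) auto
    then have "R (C x) \<le> K (Suc t)" by (simp add: K_Suc)
    then have "measure (transition G x a) (?A (K (Suc t))) \<le> measure (transition G x a) (?A (R (C x)))"
      using A by (intro finite_measure_mono) (auto simp: transition_prob(2)[OF x(1) a])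
    also have "\<dots> \<le> 2 * e" by (rule R[OF x(1) a])
    finally show "measure (transition G x a) (?A (K (Suc t))) \<le> 2 * e" .
  qed
qed

end

section \<open>Selection of near-optimal actions and linearity of values\<close>

text \<open>A continuous selection of approximate minimizers: \<open>d\<close> gets positive weight iff \<open>f d < f e + \<tau>\<close> for all \<open>e\<close>.\<close>

definition near_min_weight :: "'a set \<Rightarrow> real \<Rightarrow> ('a \<Rightarrow> real) \<Rightarrow> 'a \<Rightarrow> real" where
  "near_min_weight S \<tau> f d = (if d \<in> S then \<Prod>e\<in>S. max 0 (\<tau> - (f d - f e)) else 0)"

definition near_min_pmf :: "'a set \<Rightarrow> real \<Rightarrow> ('a \<Rightarrow> real) \<Rightarrow> 'a pmf" where
  "near_min_pmf S \<tau> f = embed_pmf (\<lambda>d. near_min_weight S \<tau> f d / (\<Sum>e\<in>S. near_min_weight S \<tau> f e))"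

lemma near_min_weight_nonneg: "0 \<le> near_min_weight S \<tau> f d"
  by (auto simp: near_min_weight_def intro: prod_nonneg)

text \<open>An exact minimizer of \<open>f\<close> on \<open>S\<close> has positive factors only, so
  the normalization never divides by 0.\<close>

lemma sum_near_min_weight_pos:
  assumes S: "finite S" "S \<noteq> {}" and \<tau>: "0 < \<tau>"
  shows "0 < (\<Sum>e\<in>S. near_min_weight S \<tau> f e)"
proof -
  obtain d where d: "d \<in> S" "\<And>e. e \<in> S \<Longrightarrow> f d \<le> f e"
    using ex_min_if_finite[of "f ` S"] S by (metis (no_types, lifting) arg_min_if_finite(1) arg_min_least)
  have "0 < near_min_weight S \<tau> f d"
  proof -
    have "0 < max 0 (\<tau> - (f d - f e))" if "e \<in> S" for e
      using d(2)[OF that] \<tau> by simp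
    then show ?thesis using d(1) by (auto simp: near_min_weight_def intro: prod_pos)
  qed
  then show ?thesis using S d(1) by (intro sum_pos2[of S d]) (auto simp: near_min_weight_nonneg)
qed

lemma pmf_near_min:
  assumes S: "finite S" "S \<noteq> {}" and \<tau>: "0 < \<tau>"
  shows "pmf (near_min_pmf S \<tau> f) d = near_min_weight S \<tau> f d / (\<Sum>e\<in>S. near_min_weight S \<tau> f e)"
  unfolding near_min_pmf_def
proof (rule pmf_embed_pmf)
  let ?W = "\<Sum>e\<in>S. near_min_weight S \<tau> f e"
  have W: "0 < ?W" by (rule sum_near_min_weight_pos[OF assms])
  show "0 \<le> near_min_weight S \<tau> f d / ?W" for d
    using W by (simp add: near_min_weight_nonneg)
  have "(\<integral>\<^sup>+d. ennreal (near_min_weight S \<tau> f d / ?W) \<partial>count_space UNIV) = (\<Sum>d\<in>S. ennreal (near_min_weight S \<tau> f d / ?W))"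
    using S by (intro nn_integral_count_space') (auto simp: near_min_weight_def)
  also have "\<dots> = ennreal (\<Sum>d\<in>S. near_min_weight S \<tau> f d / ?W)"
    using W by (intro sum_ennreal) (simp add: near_min_weight_nonneg)
  also have "(\<Sum>d\<in>S. near_min_weight S \<tau> f d / ?W) = 1"
    using W by (simp flip: sum_divide_distrib)
  finally show "(\<integral>\<^sup>+d. ennreal (near_min_weight S \<tau> f d / ?W) \<partial>count_space UNIV) = 1" by simp
qed

lemma set_near_min_pmf:
  assumes S: "finite S" "S \<noteq> {}" and \<tau>: "0 < \<tau>" and d: "d \<in> set_pmf (near_min_pmf S \<tau> f)"
  shows "d \<in> S" "\<And>e. e \<in> S \<Longrightarrow> f d < f e + \<tau>"
proof -
  have *: "near_min_weight S \<tau> f d \<noteq> 0"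
    using d by (auto simp: set_pmf_iff pmf_near_min[OF S \<tau>])
  then show "d \<in> S" by (auto simp: near_min_weight_def split: if_splits)
  fix e assume e: "e \<in> S"
  have "max 0 (\<tau> - (f d - f e)) \<noteq> 0"
    using * e S(1) by (auto simp: near_min_weight_def prod_zero_iff split: if_splits)
  then show "f d < f e + \<tau>" by (simp add: max_def split: if_splits)
qed

lemma pmf_near_min_continuous:
  assumes S: "finite S" "S \<noteq> {}" and \<tau>: "0 < \<tau>" and lim: "\<And>e. e \<in> S \<Longrightarrow> (\<lambda>m. F m e) \<longlonglongrightarrow> f e"
  shows "(\<lambda>m. pmf (near_min_pmf S \<tau> (F m)) d) \<longlonglongrightarrow> pmf (near_min_pmf S \<tau> f) d"
proof -
  have w: "(\<lambda>m. near_min_weight S \<tau> (F m) e) \<longlonglongrightarrow> near_min_weight S \<tau> f e" for e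
  proof (cases "e \<in> S")
    case True
    then show ?thesis unfolding near_min_weight_def by (auto intro!: tendsto_intros tendsto_prod lim)
  qed (simp add: near_min_weight_def)
  show ?thesis
    unfolding pmf_near_min[OF S \<tau>]
    using sum_near_min_weight_pos[OF S \<tau>, of f] by (intro tendsto_divide tendsto_sum w) simp
qed

context csg_play
begin

lemma combined_cost_sums:
  assumes L: "finite L"
    and c: "\<And>l. l \<in> L \<Longrightarrow> (\<lambda>z. cost G i l (fst z) (snd z)) \<in> borel_measurable \<K>"
    and b: "\<And>l z. l \<in> L \<Longrightarrow> z \<in> space \<K> \<Longrightarrow> \<bar>cost G i l (fst z) (snd z)\<bar> \<le> b"
  shows "(\<lambda>t. (1 - discount G) * (discount G ^ t * (\<integral>\<omega>. (\<Sum>l\<in>L. w l * cost G i l (fst (\<omega> t)) (snd (\<omega> t))) \<partial>play))) sums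
    (\<Sum>l\<in>L. w l * discounted_cost G i l \<pi>)"
proof -
  have int: "integrable play (\<lambda>\<omega>. cost G i l (fst (\<omega> t)) (snd (\<omega> t)))" if "l \<in> L" for l t
    by (rule integrable_play[OF c[OF that] b[OF that]])
  have "(\<lambda>t. \<Sum>l\<in>L. w l * ((1 - discount G) * (discount G ^ t * (\<integral>\<omega>. cost G i l (fst (\<omega> t)) (snd (\<omega> t)) \<partial>play)))) sums
      (\<Sum>l\<in>L. w l * discounted_cost G i l \<pi>)"
    by (intro sums_sum sums_mult discounted_cost_sums[OF c b])
  moreover have "(\<integral>\<omega>. (\<Sum>l\<in>L. w l * cost G i l (fst (\<omega> t)) (snd (\<omega> t))) \<partial>play) =
      (\<Sum>l\<in>L. w l * (\<integral>\<omega>. cost G i l (fst (\<omega> t)) (snd (\<omega> t)) \<partial>play))" for t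
    using int by simp
  ultimately show ?thesis by (simp add: sum_distrib_left mult_ac)
qed

lemma abs_discounted_cost_le:
  assumes c: "(\<lambda>z. cost G i l (fst z) (snd z)) \<in> borel_measurable \<K>"
    and b: "\<And>z. z \<in> space \<K> \<Longrightarrow> \<bar>cost G i l (fst z) (snd z)\<bar> \<le> b"
  shows "\<bar>discounted_cost G i l \<pi>\<bar> \<le> b"
proof -
  have g: "(\<lambda>t. discount G ^ t * b) sums (1 / (1 - discount G) * b)"
    using discount_pos discount_less_1 by (intro sums_mult2 geometric_sums) auto
  have *: "\<bar>\<Sum>t. discount G ^ t * cost G i l (fst (\<omega> t)) (snd (\<omega> t))\<bar> \<le> 1 / (1 - discount G) * b"
    if "\<omega> \<in> space play" for \<omega>
    unfolding sums_unique[OF g] real_norm_def[symmetric]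
    using b[OF component_play[OF that]] discount_pos
    by (intro norm_suminf_le sums_summable[OF g]) (simp add: abs_mult mult_left_mono)
  have "\<bar>\<integral>\<omega>. (\<Sum>t. discount G ^ t * cost G i l (fst (\<omega> t)) (snd (\<omega> t))) \<partial>play\<bar> \<le> 1 / (1 - discount G) * b"
    by (rule abs_integral_le_bound[OF play.prob_space_axioms *])
  from mult_left_mono[OF this, of "1 - discount G"] show ?thesis
    unfolding discounted_cost_def using discount_less_1 by (simp add: abs_mult)
qed

end

section \<open>Linearity of values under fixed weights\<close>

context csg_cells
begin

context
  fixes c :: "'l \<Rightarrow> 'x \<times> (nat \<Rightarrow> 'a) \<Rightarrow> real" and b :: real and L :: "'l set" and w :: "'l \<Rightarrow> real" and p
  assumes c: "\<And>l. l \<in> L \<Longrightarrow> c l \<in> borel_measurable \<K>"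
    and b: "\<And>l z. l \<in> L \<Longrightarrow> z \<in> space \<K> \<Longrightarrow> \<bar>c l z\<bar> \<le> b" and b0: "0 \<le> b"
    and p: "p \<in> mixed" and L: "finite L" and w0: "\<And>l. l \<in> L \<Longrightarrow> 0 \<le> w l"
begin

text \<open>The strategy is fixed, so evaluation is linear in the cost, although optimization would
  not be. The Brouwer table is built from the separate costs and the deviation estimate from their
  weighted sum; linearity connects the two.\<close>

lemma value_iter_sum:
  "x \<in> \<X> \<Longrightarrow>
    value_iter (\<lambda>z. \<Sum>l\<in>L. w l * c l z) p n x = (\<Sum>l\<in>L. w l * value_iter (c l) p n x)"
proof (induction n arbitrary: x)
  case 0 then show ?case by (simp add: value_iter_def)
next
  case (Suc n)
  have "lookahead (\<lambda>z. \<Sum>l\<in>L. w l * c l z) (value_iter (\<lambda>z. \<Sum>l\<in>L. w l * c l z) p n) (x, a) =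
      (\<Sum>l\<in>L. w l * lookahead (c l) (value_iter (c l) p n) (x, a))" if "a \<in> nets" for a
    using Suc that nets_profiles
    by (intro lookahead_sum[where b=b] measurable_value_iter[OF c b b0] abs_value_iter_le[OF c b b0 p]) auto
  then show ?case
    unfolding value_iter_def funpow.simps o_apply bellman_def
    by (simp add: value_iter_def[symmetric] sum_distrib_left mult_ac sum.swap[of _ L nets])
qed

lemma measurable_combined: "(\<lambda>z. \<Sum>l\<in>L. w l * c l z) \<in> borel_measurable \<K>"
  by (intro borel_measurable_sum borel_measurable_times borel_measurable_const c)

lemma abs_combined_le:
  assumes "z \<in> space \<K>"
  shows "\<bar>\<Sum>l\<in>L. w l * c l z\<bar> \<le> sum w L * b"
  unfolding sum_distrib_right
  by (rule order_trans[OF sum_abs]) (auto intro!: sum_mono mult_left_mono b assms simp: abs_mult w0)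

lemma combined_bound_nonneg: "0 \<le> sum w L * b"
  using w0 b0 by (intro mult_nonneg_nonneg sum_nonneg)

lemma val_sum:
  assumes x: "x \<in> \<X>"
  shows "val (\<lambda>z. \<Sum>l\<in>L. w l * c l z) p x = (\<Sum>l\<in>L. w l * val (c l) p x)"
proof (rule LIMSEQ_unique)
  show "(\<lambda>n. value_iter (\<lambda>z. \<Sum>l\<in>L. w l * c l z) p n x) \<longlonglongrightarrow> val (\<lambda>z. \<Sum>l\<in>L. w l * c l z) p x"
    by (rule value_iter_lim[OF measurable_combined abs_combined_le combined_bound_nonneg p x])
  show "(\<lambda>n. value_iter (\<lambda>z. \<Sum>l\<in>L. w l * c l z) p n x) \<longlonglongrightarrow> (\<Sum>l\<in>L. w l * val (c l) p x)"
    unfolding value_iter_sum[OF x]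
    by (intro tendsto_sum tendsto_mult tendsto_const value_iter_lim[OF c b b0 p x])
qed

lemma Qval_sum:
  assumes x: "x \<in> \<X>" and i: "i \<in> players G" and d: "d \<in> acts G i"
  shows "Qval (\<lambda>z. \<Sum>l\<in>L. w l * c l z) p i x d = (\<Sum>l\<in>L. w l * Qval (c l) p i x d)"
proof -
  have "lookahead (\<lambda>z. \<Sum>l\<in>L. w l * c l z) (val (\<lambda>z. \<Sum>l\<in>L. w l * c l z) p) (x, a(i := d)) =
      (\<Sum>l\<in>L. w l * lookahead (c l) (val (c l) p) (x, a(i := d)))" if "a \<in> nets" for a
    using that nets_profiles
    by (intro lookahead_sum[where b=b] measurable_val[OF c b b0 p] abs_val_le[OF c b b0 p] val_sum x upd_profiles i d) auto
  then show ?thesis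
    unfolding Qval_def by (simp add: sum_distrib_left mult_ac sum.swap[of _ L nets])
qed

end

lemma Qval_continuous:
  assumes c: "c \<in> borel_measurable \<K>" and b: "\<And>z. z \<in> space \<K> \<Longrightarrow> \<bar>c z\<bar> \<le> b" and b0: "0 \<le> b"
    and p: "\<And>m. P m \<in> mixed" "p \<in> mixed"
    and lim: "\<And>k i a. i \<in> players G \<Longrightarrow> a \<in> S i \<Longrightarrow> (\<lambda>m. pmf (P m k i) a) \<longlonglongrightarrow> pmf (p k i) a"
    and x: "x \<in> \<X>" "i \<in> players G" "d \<in> acts G i"
  shows "(\<lambda>m. Qval c (P m) i x d) \<longlonglongrightarrow> Qval c p i x d"
  unfolding Qval_def
proof (intro tendsto_sum tendsto_mult)
  fix a assume a: "a \<in> nets"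
  show "(\<lambda>m. weight (P m) x a) \<longlonglongrightarrow> weight p x a"
    unfolding weight_def using a by (intro tendsto_prod lim) (auto simp: nets_def)
  show "(\<lambda>m. lookahead c (val c (P m)) (x, a(i := d))) \<longlonglongrightarrow> lookahead c (val c p) (x, a(i := d))"
    using a nets_profiles by (intro lookahead_continuous[OF c b b0 p lim x(1)] upd_profiles x) auto
qed

end

section \<open>Equilibria of the Lagrangian game\<close>

context csg_density
begin

text \<open>The difference splits into the present cost and the transition law; the latter is tested
  against a function bounded by \<open>B\<close>, hence the factor \<open>B\<close> at the L1
  distance of the densities.\<close>

lemma lookahead_diff_le:
  assumes x: "x \<in> \<X>" "a \<in> \<A>" and x': "x' \<in> \<X>" "a' \<in> \<A>"
    and v: "v \<in> borel_measurable (states G)" and B: "\<And>y. y \<in> \<X> \<Longrightarrow> \<bar>v y\<bar> \<le> B" and B0: "0 \<le> B"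
    and c: "\<bar>c (x, a) - c (x', a')\<bar> \<le> e" and \<delta>: "L1_dist \<mu> (kern None a x) (kern None a' x') \<le> g"
  shows "\<bar>lookahead c v (x, a) - lookahead c v (x', a')\<bar> \<le> e + B * g"
proof -
  have \<alpha>: "0 \<le> discount G" "discount G \<le> 1" using discount_pos discount_less_1 by auto
  have "lookahead c v (x, a) - lookahead c v (x', a') = (1 - discount G) * (c (x, a) - c (x', a')) +
      discount G * ((\<integral>y. v y \<partial>transition G x a) - (\<integral>y. v y \<partial>transition G x' a'))"
    by (simp add: lookahead_def algebra_simps)
  also have "\<bar>\<dots>\<bar> \<le> (1 - discount G) * \<bar>c (x, a) - c (x', a')\<bar> +
      discount G * \<bar>(\<integral>y. v y \<partial>transition G x a) - (\<integral>y. v y \<partial>transition G x' a')\<bar>"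
    using \<alpha> by (intro order_trans[OF abs_triangle_ineq]) (simp add: abs_mult)
  also have "\<dots> \<le> 1 * e + 1 * (B * g)"
  proof (rule add_mono; rule mult_mono)
    have "\<bar>(\<integral>y. v y \<partial>transition G x a) - (\<integral>y. v y \<partial>transition G x' a')\<bar> \<le> B * L1_dist \<mu> (kern None a x) (kern None a' x')"
      unfolding kern_None by (rule integral_transition_diff_le[OF x x' v B])
    also have "\<dots> \<le> B * g" by (rule mult_left_mono[OF \<delta> B0])
    finally show "\<bar>(\<integral>y. v y \<partial>transition G x a) - (\<integral>y. v y \<partial>transition G x' a')\<bar> \<le> B * g" .
  qed (use \<alpha> c in auto)
  finally show ?thesis by simp
qed

text \<open>
  The multipliers \<open>lam i l\<close> may depend on the costs of the strategy itself. The fixed point is taken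
  over tables \<open>u\<close> of \<open>Q\<close>-values at representatives of finitely many cells and for the actions of a finite net:
  from \<open>u\<close> one forms near-optimal mixed actions, and from these the true \<open>Q\<close>-values in the game.
\<close>

lemma stationary_lagrangian_equilibrium:
  fixes lam :: "nat \<Rightarrow> nat \<Rightarrow> real \<Rightarrow> real"
  assumes b: "0 < b" "\<And>i l x a. i \<in> players G \<Longrightarrow> l \<in> \<L> \<Longrightarrow> x \<in> \<X> \<Longrightarrow>
      a \<in> \<A> \<Longrightarrow> \<bar>cost G i l x a\<bar> \<le> b"
    and lam: "\<And>i l. continuous_on UNIV (lam i l)" "\<And>i l J. 0 \<le> lam i l J" "\<And>i l J. lam i l J \<le> M" and M: "0 < M"
    and \<epsilon>: "0 < \<epsilon>"
  defines "J \<equiv> discounted_cost G"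
  shows "\<exists>\<phi>\<in>(\<Pi> i\<in>players G. stationary_strategies G i). \<forall>i\<in>players G. \<forall>\<sigma>\<in>strategies G i.
    (\<Sum>l\<in>\<L>. lam i l (J i l (stat \<phi>)) * J i l (stat \<phi>))
    \<le> (\<Sum>l\<in>\<L>. lam i l (J i l (stat \<phi>)) * J i l ((stat \<phi>)(i := \<sigma>))) + \<epsilon>"
proof -
  let ?\<alpha> = "discount G"
  have finL: "finite \<L>" by (simp add: constraints_def)
  note \<alpha> = discount_pos discount_less_1
  \<comment> \<open>\<open>\<Lambda>\<close> bounds the sum of all multipliers, the one of index 0
    included. Consequently \<open>B\<close> bounds the weighted cost, its values and its
    Q-values.\<close>
  define \<Lambda> where "\<Lambda> = real (card \<L>) * M"
  have \<Lambda>: "0 < \<Lambda>" unfolding \<Lambda>_def using M finL by (simp add: card_gt_0_iff)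
  define B where "B = \<Lambda> * b"
  have B: "0 < B" using \<Lambda> b(1) by (simp add: B_def)
  \<comment> \<open>Three errors of size at most \<open>\<tau>\<close> occur: the choice of
    near-minimizers, the stages after \<open>T\<close>, and all terms proportional to
    \<open>\<gamma>\<close> together. Summation over time divides them by
    \<open>1 - discount G\<close>.\<close>
  define \<tau> where "\<tau> = \<epsilon> * (1 - ?\<alpha>) / 4"
  have \<tau>: "0 < \<tau>" using \<epsilon> \<alpha> by (simp add: \<tau>_def)
  have "(\<lambda>t. ?\<alpha> ^ t * (2 * B * ?\<alpha>)) \<longlonglongrightarrow> 0"
    using \<alpha> by (intro tendsto_mult_left_zero LIMSEQ_power_zero) auto
  then have "\<forall>\<^sub>F t in sequentially. ?\<alpha> ^ t * (2 * B * ?\<alpha>) < \<tau>" using \<tau> by (intro order_tendstoD) auto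
  then obtain T where T: "2 * B * ?\<alpha> ^ Suc T < \<tau>"
    by (auto simp: eventually_sequentially mult_ac)
  \<comment> \<open>Solves \<open>\<gamma>_eq\<close>: three comparisons of Q-values at
    \<open>(\<Lambda> + B) * \<gamma>\<close> each, and \<open>Suc T\<close> exits of probability
    \<open>2 * \<gamma>\<close> at a loss of \<open>2 * B\<close> each, add up to
    \<open>\<tau>\<close>.\<close>
  define \<gamma> where "\<gamma> = \<tau> / (3 * (\<Lambda> + B) + 4 * B * real (Suc T))"
  have den: "0 < 3 * (\<Lambda> + B) + 4 * B * real (Suc T)" using \<Lambda> B by (intro add_pos_pos mult_pos_pos) auto
  then have \<gamma>: "0 < \<gamma>" using \<tau> by (simp add: \<gamma>_def)
  have \<gamma>_eq: "3 * (\<Lambda> + B) * \<gamma> + 4 * B * real (Suc T) * \<gamma> = \<tau>"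
    using den unfolding distrib_right[symmetric] by (simp add: \<gamma>_def del: of_nat_Suc)

  obtain C where C[measurable]: "C \<in> states G \<rightarrow>\<^sub>M count_space (UNIV :: nat set)"
    and cells: "\<And>x x' j a. x \<in> \<X> \<Longrightarrow> x' \<in> \<X> \<Longrightarrow> C x = C x' \<Longrightarrow> j \<in> kinds \<Longrightarrow>
      a \<in> \<A> \<Longrightarrow> L1_dist \<mu> (kern j a x) (kern j a x') \<le> \<gamma>"
    using cells_exist[OF \<gamma>] by blast
  have None: "None \<in> kinds" by (simp add: kinds_def)
  obtain K :: "nat \<Rightarrow> nat" where K: "mono K"
    "measure (init G) {y \<in> \<X>. K 0 < C y} \<le> 2 * \<gamma>"
    "\<And>t x a. x \<in> \<X> \<Longrightarrow> C x \<le> K t \<Longrightarrow> a \<in> \<A> \<Longrightarrow>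
      measure (transition G x a) {y \<in> \<X>. K (Suc t) < C y} \<le> 2 * \<gamma>"
    using finite_cells_suffice[OF C \<gamma> cells[OF _ _ _ None]] by blast
  define n where "n = K T"
  \<comment> \<open>An index without states receives an arbitrary state, so that
    \<open>rep k\<close> is a state for every \<open>k\<close>.\<close>
  define rep where "rep k = (if \<exists>x\<in>\<X>. C x = k then SOME x. x \<in> \<X> \<and> C x = k
    else SOME x. x \<in> \<X>)" for k
  have rep: "rep k \<in> \<X>" for k
    using states_nonempty someI_ex[of "\<lambda>x. x \<in> \<X> \<and> C x = k"] some_in_eq[of "\<X>"]
    unfolding rep_def by auto
  have C_rep: "C (rep (C x)) = C x" if "x \<in> \<X>" for x
    using someI_ex[of "\<lambda>z. z \<in> \<X> \<and> C z = C x"] that unfolding rep_def by auto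
  have "finite (rep ` {..n})" "rep ` {..n} \<subseteq> \<X>" using rep by auto
  from action_nets_exist[OF this \<gamma>] obtain S where S': "\<forall>i\<in>players G. finite (S i) \<and> S i \<subseteq> acts G i \<and> S i \<noteq> {} \<and>
    (\<forall>d\<in>acts G i. \<exists>d'\<in>S i. \<forall>x\<in>rep ` {..n}. \<forall>j\<in>kinds. \<forall>a\<in>\<A>.
      L1_dist \<mu> (kern j (a(i := d)) x) (kern j (a(i := d')) x) < \<gamma>)" ..
  have S: "finite (S i)" "S i \<subseteq> acts G i" "S i \<noteq> {}" if "i \<in> players G" for i
    using bspec[OF S' that] by simp_all
  have net: "\<exists>d'\<in>S i. \<forall>x\<in>rep ` {..n}. \<forall>j\<in>kinds. \<forall>a\<in>\<A>.
      L1_dist \<mu> (kern j (a(i := d)) x) (kern j (a(i := d')) x) < \<gamma>" if "i \<in> players G" "d \<in> acts G i" for i d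
    using bspec[OF S' that(1)] that(2) by simp
  interpret cc: csg_cells G C S
    by unfold_locales (use C S in auto)

  define cst where "cst i l z = cost G i l (fst z) (snd z)" for i l and z :: "'x \<times> (nat \<Rightarrow> 'a)"
  have cm: "cst i l \<in> borel_measurable \<K>" if "i \<in> players G" "l \<in> \<L>" for i l
    unfolding cst_def[abs_def] by (rule measurable_cost[OF that])
  have cb: "\<bar>cst i l z\<bar> \<le> b" if "i \<in> players G" "l \<in> \<L>" "z \<in> space \<K>" for i l z
    using that b(2) by (auto simp: cst_def)
  have b0: "0 \<le> b" using b(1) by simp

  \<comment> \<open>The table has entries only for indices up to \<open>n\<close>. Beyond
    \<open>n\<close> the law of index \<open>n\<close> is copied; no optimality is claimed there,
    and the exit bound absorbs the loss.\<close>
  define P where "P u k i = near_min_pmf (S i) \<tau> (\<lambda>d. u (i, min k n, d))" for u :: "nat \<times> nat \<times> 'a \<Rightarrow> real" and k i :: nat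
  have P: "P u \<in> cc.mixed" for u
    using set_near_min_pmf(1)[OF S(1,3) \<tau>] unfolding cc.mixed_def P_def by auto
  define Jv where "Jv u i l = (\<integral>x. cc.val (cst i l) (P u) x \<partial>init G)" for u i l
  \<comment> \<open>The table \<open>u\<close> enters only through the strategy \<open>P u\<close>.
    Multipliers and Q-values are those of the full game under that strategy, so \<open>F\<close>
    takes values in the box for every \<open>u\<close>.\<close>
  define F where "F u z = (case z of (i, k, d) \<Rightarrow> \<Sum>l\<in>\<L>. lam i l (Jv u i l) * cc.Qval (cst i l) (P u) i (rep k) d)" for u z
  define I where "I = (SIGMA i:players G. {..n} \<times> S i)"
  have finI: "finite I" unfolding I_def using S(1) by (intro finite_SigmaI) auto
  have BB: "- B < B" using B by simp
  have F_range: "F u z \<in> {- B..B}" if "z \<in> I" for u z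
  proof -
    obtain i k d where z: "z = (i, k, d)" "i \<in> players G" "d \<in> S i"
      using \<open>z \<in> I\<close> unfolding I_def by blast
    have "\<bar>F u z\<bar> \<le> (\<Sum>l\<in>\<L>. M * b)"
      unfolding F_def z prod.case
    proof (rule order_trans[OF sum_abs], rule sum_mono)
      fix l assume l: "l \<in> \<L>"
      have "\<bar>cc.Qval (cst i l) (P u) i (rep k) d\<bar> \<le> b"
        using S(2) z by (intro cc.abs_Qval_le[OF cm[OF z(2) l] cb[OF z(2) l] b0 P rep]) auto
      then show "\<bar>lam i l (Jv u i l) * cc.Qval (cst i l) (P u) i (rep k) d\<bar> \<le> M * b"
        using lam M by (auto simp: abs_mult intro!: mult_mono)
    qed
    also have "\<dots> = B" by (simp add: B_def \<Lambda>_def)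
    finally show ?thesis by auto
  qed
  have F_cont: "(\<lambda>m. F (X m) z) \<longlonglongrightarrow> F u z"
    if lim: "\<And>z. z \<in> I \<Longrightarrow> (\<lambda>m. X m z) \<longlonglongrightarrow> u z" and z: "z \<in> I" for X u z
  proof -
    have Plim: "(\<lambda>m. pmf (P (X m) k i) d) \<longlonglongrightarrow> pmf (P u k i) d" if "i \<in> players G" "d \<in> S i" for k i d
      unfolding P_def using that S by (intro pmf_near_min_continuous \<tau> lim) (auto simp: I_def)
    obtain i k d where zi: "z = (i, k, d)" "i \<in> players G" "d \<in> S i" using z by (auto simp: I_def)
    have d: "d \<in> acts G i" using S(2) zi by auto
    show ?thesis unfolding F_def zi prod.case
    proof (intro tendsto_sum tendsto_mult)
      fix l assume l: "l \<in> \<L>"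
      note c = cm[OF zi(2) l] cb[OF zi(2) l] b0
      show "(\<lambda>m. cc.Qval (cst i l) (P (X m)) i (rep k) d) \<longlonglongrightarrow> cc.Qval (cst i l) (P u) i (rep k) d"
        by (rule cc.Qval_continuous[OF c P P Plim rep zi(2) d])
      have "(\<lambda>m. Jv (X m) i l) \<longlonglongrightarrow> Jv u i l"
        unfolding Jv_def by (rule cc.integral_init_continuous[OF c P P Plim])
      then show "(\<lambda>m. lam i l (Jv (X m) i l)) \<longlonglongrightarrow> lam i l (Jv u i l)"
        by (rule continuous_on_tendsto_compose[OF lam(1)]) auto
    qed
  qed
  obtain u where u: "\<And>z. z \<in> I \<Longrightarrow> F u z = u z"
  proof (rule brouwer_finite_box[OF finI BB, of F])
    show "F x z \<in> {- B..B}" if "z \<in> I" for x z by (rule F_range[OF that])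
    show "(\<lambda>m. F (X m) z) \<longlonglongrightarrow> F x z" if "\<And>z. z \<in> I \<Longrightarrow> (\<lambda>m. X m z) \<longlonglongrightarrow> x z" "z \<in> I" for X x z
      by (rule F_cont[OF that])
    fix x assume "\<And>z. z \<in> I \<Longrightarrow> F x z = x z"
    then show thesis by (rule that)
  qed

  define p where "p = P u"
  have p: "p \<in> cc.mixed" unfolding p_def by (rule P)
  define \<pi> where "\<pi> = stat (cc.policy p)"
  \<comment> \<open>The numbers at which \<open>F\<close> evaluates the multipliers are the actual
    costs of the policy; from here on the multipliers can be treated as constants
    \<open>w l\<close>.\<close>
  have J_eq: "J i l \<pi> = Jv u i l" if "i \<in> players G" "l \<in> \<L>" for i l
  proof -
    interpret csg_play G \<pi>
      unfolding \<pi>_def by unfold_locales (rule cc.policy_strategies[OF p])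
    have "(\<lambda>t. (1 - ?\<alpha>) * (?\<alpha> ^ t * (\<integral>\<omega>. cst i l (\<omega> t) \<partial>play))) sums J i l \<pi>"
      unfolding J_def cst_def using cb[OF that] cm[OF that] by (intro discounted_cost_sums) (auto simp: cst_def[abs_def])
    from cc.integral_val_policy[OF cm[OF that] cb[OF that] b0 p this[unfolded \<pi>_def]]
    show ?thesis unfolding Jv_def p_def[symmetric] \<pi>_def ..
  qed
  have "(\<Sum>l\<in>\<L>. lam i l (J i l \<pi>) * J i l \<pi>) \<le> (\<Sum>l\<in>\<L>. lam i l (J i l \<pi>) * J i l (\<pi>(i := \<sigma>))) + \<epsilon>"
    if i: "i \<in> players G" and \<sigma>: "\<sigma> \<in> strategies G i" for i \<sigma>
  proof -
    define w where "w l = lam i l (J i l \<pi>)" for l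
    have w: "0 \<le> w l" "w l \<le> M" for l using lam by (auto simp: w_def)
    have sw: "sum w \<L> \<le> \<Lambda>" using sum_mono[of \<L> w "\<lambda>_. M"] w by (simp add: \<Lambda>_def)
    define c where "c z = (\<Sum>l\<in>\<L>. w l * cst i l z)" for z
    note args = cm[OF i] cb[OF i] b0 p finL w(1)
    have c_meas: "c \<in> borel_measurable \<K>"
      unfolding c_def[abs_def] by (rule cc.measurable_combined[OF args]) 
    have c_bound: "\<bar>c z\<bar> \<le> B" if "z \<in> space \<K>" for z
    proof -
      have "\<bar>c z\<bar> \<le> sum w \<L> * b" unfolding c_def by (rule cc.abs_combined_le[OF args that])
      also have "\<dots> \<le> B" unfolding B_def using sw b0 by (rule mult_right_mono)
      finally show ?thesis .
    qed
    have B0: "0 \<le> B" using B by simp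
    have V: "cc.val c p \<in> borel_measurable (states G)" "\<And>x. x \<in> \<X> \<Longrightarrow> \<bar>cc.val c p x\<bar> \<le> B"
      by (rule cc.measurable_val[OF c_meas c_bound B0 p] cc.abs_val_le[OF c_meas c_bound B0 p]; assumption)+
    let ?Q = "cc.Qval c p i"
    \<comment> \<open>The fixed-point equation in use: the table whose near-minimizers the policy
      draws consists of the Q-values of that very policy for the weighted cost.\<close>
    have Q_u: "?Q (rep k) d = u (i, k, d)" if k: "k \<le> n" and d: "d \<in> S i" for k d
    proof -
      have "?Q (rep k) d = (\<Sum>l\<in>\<L>. w l * cc.Qval (cst i l) p i (rep k) d)"
        unfolding c_def[abs_def] using S(2)[OF i] d by (intro cc.Qval_sum[OF args rep i]) auto
      also have "\<dots> = F u (i, k, d)"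
        unfolding F_def prod.case w_def p_def[symmetric] by (intro sum.cong refl) (simp add: J_eq[OF i])
      also have "\<dots> = u (i, k, d)" using k d i by (intro u) (auto simp: I_def)
      finally show ?thesis .
    qed
    have look: "\<bar>lookahead c (cc.val c p) (x, a) - lookahead c (cc.val c p) (x', a')\<bar> \<le> (\<Lambda> + B) * \<gamma>"
      if x: "x \<in> \<X>" "a \<in> \<A>" and x': "x' \<in> \<X>" "a' \<in> \<A>"
        and close: "\<And>j. j \<in> kinds \<Longrightarrow> L1_dist \<mu> (kern j a x) (kern j a' x') \<le> \<gamma>" for x a x' a'
    proof -
      have "\<bar>c (x, a) - c (x', a')\<bar> = \<bar>\<Sum>l\<in>\<L>. w l * (cst i l (x, a) - cst i l (x', a'))\<bar>"
        by (simp add: c_def sum_subtractf right_diff_distrib)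
      also have "\<dots> \<le> (\<Sum>l\<in>\<L>. w l * \<gamma>)"
      proof (rule order_trans[OF sum_abs], rule sum_mono)
        fix l assume l: "l \<in> \<L>"
        have "Some (i, l) \<in> kinds" using i l by (auto simp: kinds_def)
        from close[OF this] show "\<bar>w l * (cst i l (x, a) - cst i l (x', a'))\<bar> \<le> w l * \<gamma>"
          using w(1)[of l] by (simp add: L1_dist_kern_Some cst_def abs_mult mult_left_mono)
      qed
      also have "\<dots> \<le> \<Lambda> * \<gamma>" using sw \<gamma> by (simp flip: sum_distrib_right)
      finally have "\<bar>c (x, a) - c (x', a')\<bar> \<le> \<Lambda> * \<gamma>" .
      from lookahead_diff_le[OF x x' V B0 this close[OF None]] show ?thesis
        by (simp add: distrib_right )
    qed
    \<comment> \<open>Within a cell the policy is constant, so the weights agree and only the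
      look-ahead terms differ.\<close>
    have Q_diff: "\<bar>?Q x d - ?Q x' d'\<bar> \<le> (\<Lambda> + B) * \<gamma>"
      if x: "x \<in> \<X>" "d \<in> acts G i" and x': "x' \<in> \<X>" "d' \<in> acts G i" and eq: "C x = C x'"
        and close: "\<And>j a. j \<in> kinds \<Longrightarrow> a \<in> \<A> \<Longrightarrow> L1_dist \<mu> (kern j (a(i := d)) x) (kern j (a(i := d')) x') \<le> \<gamma>" for x d x' d'
    proof -
      have "cc.weight p x = cc.weight p x'" by (simp add: cc.weight_def eq fun_eq_iff)
      then have "?Q x d - ?Q x' d' = (\<Sum>a\<in>cc.nets. cc.weight p x a *
          (lookahead c (cc.val c p) (x, a(i := d)) - lookahead c (cc.val c p) (x', a(i := d'))))"
        by (simp add: cc.Qval_def sum_subtractf right_diff_distrib)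
      also have "\<bar>\<dots>\<bar> \<le> (\<Lambda> + B) * \<gamma>"
        using cc.nets_profiles by (intro cc.abs_sum_weight_le[OF p] look upd_profiles x x' i close) auto
      finally show ?thesis .
    qed
    \<comment> \<open>Three changes at \<open>(\<Lambda> + B) * \<gamma>\<close> each: from
      \<open>x\<close> to the representative for the action drawn, from the net action to
      \<open>d\<close> at the representative, and from the representative back to \<open>x\<close>
      for \<open>d\<close>. The summand \<open>\<tau>\<close> is the tolerance of the
      near-minimizers.\<close>
    define \<rho> where "\<rho> = 3 * (\<Lambda> + B) * \<gamma> + \<tau>"
    have step: "cc.val c p x \<le> ?Q x d + \<rho>" if x: "x \<in> \<X>" "C x \<le> n" and d: "d \<in> acts G i" for x d
    proof -
      let ?x = "rep (C x)"
      note r = rep[of "C x"] C_rep[OF x(1)]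
      have near: "\<bar>?Q x e - ?Q ?x e\<bar> \<le> (\<Lambda> + B) * \<gamma>" if "e \<in> acts G i" for e
        using that r by (intro Q_diff x cells upd_profiles i) auto
      obtain d' where d': "d' \<in> S i" "\<And>j a. j \<in> kinds \<Longrightarrow> a \<in> \<A> \<Longrightarrow>
          L1_dist \<mu> (kern j (a(i := d)) ?x) (kern j (a(i := d')) ?x) < \<gamma>"
        using net[OF i d] x(2) by blast
      then have d'a: "d' \<in> acts G i" using S(2)[OF i] by auto
      have "\<bar>?Q ?x d - ?Q ?x d'\<bar> \<le> (\<Lambda> + B) * \<gamma>"
        using d'(2) by (intro Q_diff r(1) d d'a refl) (auto intro: less_imp_le)
      have *: "pmf (p (C x) i) e * ?Q x e \<le> pmf (p (C x) i) e * (?Q x d + \<rho>)" if e: "e \<in> S i" for e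
      proof (cases "pmf (p (C x) i) e = 0")
        case False
        then have "e \<in> set_pmf (near_min_pmf (S i) \<tau> (\<lambda>d. u (i, C x, d)))"
          using x(2) by (simp add: p_def P_def set_pmf_iff min_absorb1)
        then have "u (i, C x, e) < u (i, C x, d') + \<tau>"
          using d'(1) by (rule set_near_min_pmf(2)[OF S(1,3)[OF i] \<tau>])
        then have "?Q ?x e < ?Q ?x d' + \<tau>" using Q_u[OF x(2)] e d'(1) by simp
        moreover have "e \<in> acts G i" using S(2)[OF i] e by auto
        ultimately have "?Q x e \<le> ?Q x d + \<rho>"
          using near[of e] near[OF d] \<open>\<bar>?Q ?x d - ?Q ?x d'\<bar> \<le> (\<Lambda> + B) * \<gamma>\<close> unfolding \<rho>_def by linarith
        then show ?thesis by (intro mult_left_mono) auto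
      qed simp
      have "cc.val c p x = (\<Sum>e\<in>S i. pmf (p (C x) i) e * ?Q x e)"
        by (rule cc.val_eq_sum_Qval[OF c_meas c_bound B0 p x(1) i])
      also have "\<dots> \<le> (\<Sum>e\<in>S i. pmf (p (C x) i) e * (?Q x d + \<rho>))"
        by (rule sum_mono) (rule *)
      also have "\<dots> = ?Q x d + \<rho>"
      proof -
        have "(\<Sum>e\<in>S i. pmf (p (C x) i) e) = 1"
          using p i S(1) by (intro sum_pmf_eq_1) (auto simp: cc.mixed_def)
        then show ?thesis by (simp flip: sum_distrib_right)
      qed
      finally show ?thesis .
    qed
    define U where "U t = {y \<in> \<X>. K t < C y}" for t
    have U: "U t \<in> sets (states G)" for t unfolding U_def by measurable
    \<comment> \<open>On \<open>U T\<close>, that is beyond cell \<open>n\<close>, it is only known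
      that the value and the Q-value both lie in \<open>{- B..B}\<close>; hence the slack
      \<open>2 * B\<close>.\<close>
    define r where "r x = \<rho> + 2 * B * indicator (U T) x" for x
    have \<rho>0: "0 \<le> \<rho>" using \<Lambda> B \<gamma> \<tau> by (simp add: \<rho>_def)
    have r: "r \<in> borel_measurable (states G)" "\<And>x. x \<in> \<X> \<Longrightarrow> \<bar>r x\<bar> \<le> \<rho> + 2 * B"
      using U[of T] \<rho>0 B0 by (auto simp: r_def[abs_def] split: split_indicator)
    have step': "cc.val c p x \<le> ?Q x d + r x" if x: "x \<in> \<X>" and d: "d \<in> acts G i" for x d
    proof (cases "C x \<le> n")
      case True
      then show ?thesis using step[OF x True d] x by (simp add: r_def U_def n_def)
    next
      case False
      then have "r x = \<rho> + 2 * B" using x by (simp add: r_def U_def n_def)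
      with V(2)[OF x] cc.abs_Qval_le[OF c_meas c_bound B0 p x i d] \<rho>0 show ?thesis by linarith
    qed
    have strat: "\<pi>(i := \<sigma>) \<in> (\<Pi> i\<in>players G. strategies G i)"
      using cc.policy_strategies[OF p] \<sigma> by (auto simp: Pi_iff \<pi>_def)
    interpret dev: csg_play G "\<pi>(i := \<sigma>)"
      by unfold_locales (rule strat)
    have "\<exists>D. (\<lambda>t. ?\<alpha> ^ t * (\<integral>\<omega>. \<rho> + 2 * B * indicator (U T) (fst (\<omega> t)) \<partial>dev.play)) sums D \<and>
      D \<le> (\<rho> + 2 * B * (real (Suc T) * (2 * \<gamma>)) + 2 * B * ?\<alpha> ^ Suc T) / (1 - ?\<alpha>)"
    proof (rule dev.discounted_exit_le[OF U])
      show "U T \<subseteq> U t" if "t \<le> T" for t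
        using monoD[OF K(1) that] by (auto simp: U_def)
      show "measure (init G) (U 0) \<le> 2 * \<gamma>"
        using K(2) by (simp add: U_def)
      show "measure (transition G x a) (U (Suc t)) \<le> 2 * \<gamma>" if "x \<in> \<X>" "x \<notin> U t" "a \<in> \<A>" for t x a
        using K(3)[of x t a] that by (simp add: U_def)
    qed (use \<gamma> \<rho>0 B0 in auto)
    then obtain D where D: "(\<lambda>t. ?\<alpha> ^ t * (\<integral>\<omega>. \<rho> + 2 * B * indicator (U T) (fst (\<omega> t)) \<partial>dev.play)) sums D"
      and D_le: "D \<le> (\<rho> + 2 * B * (real (Suc T) * (2 * \<gamma>)) + 2 * B * ?\<alpha> ^ Suc T) / (1 - ?\<alpha>)"
      by blast
    have "\<rho> + 2 * B * (real (Suc T) * (2 * \<gamma>)) + 2 * B * ?\<alpha> ^ Suc T =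
        (3 * (\<Lambda> + B) * \<gamma> + 4 * B * real (Suc T) * \<gamma>) + \<tau> + 2 * B * ?\<alpha> ^ Suc T"
      unfolding \<rho>_def by simp
    also have "\<dots> \<le> \<epsilon> * (1 - ?\<alpha>)" unfolding \<gamma>_eq using T \<tau> unfolding \<tau>_def by linarith
    finally have "(\<rho> + 2 * B * (real (Suc T) * (2 * \<gamma>)) + 2 * B * ?\<alpha> ^ Suc T) / (1 - ?\<alpha>) \<le> \<epsilon>"
      using \<alpha> by (subst pos_divide_le_eq) auto
    with D_le have "D \<le> \<epsilon>" by (rule order_trans)
    have "(\<Sum>l\<in>\<L>. w l * J i l \<pi>) = (\<integral>x. cc.val c p x \<partial>init G)"
    proof -
      interpret pl: csg_play G \<pi>
        unfolding \<pi>_def by unfold_locales (rule cc.policy_strategies[OF p])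
      have "(\<lambda>t. (1 - ?\<alpha>) * (?\<alpha> ^ t * (\<integral>\<omega>. c (\<omega> t) \<partial>pl.play))) sums (\<Sum>l\<in>\<L>. w l * J i l \<pi>)"
        unfolding c_def cst_def J_def
        using cm[OF i] cb[OF i] by (intro pl.combined_cost_sums[where b=b] finL) (auto simp: cst_def[abs_def])
      from cc.integral_val_policy[OF c_meas c_bound B0 p this[unfolded \<pi>_def]]
      show ?thesis by (simp add: \<pi>_def)
    qed
    also have "\<dots> \<le> (\<Sum>l\<in>\<L>. w l * J i l (\<pi>(i := \<sigma>))) + D"
    proof (rule cc.policy_deviation[OF c_meas c_bound B0 p i \<sigma> r step'])
      show "(\<lambda>t. (1 - ?\<alpha>) * (?\<alpha> ^ t * (\<integral>\<omega>. c (\<omega> t) \<partial>play_measure G ((stat (cc.policy p))(i := \<sigma>))))) sums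
          (\<Sum>l\<in>\<L>. w l * J i l (\<pi>(i := \<sigma>)))"
        unfolding c_def cst_def J_def \<pi>_def[symmetric]
        using cm[OF i] cb[OF i] by (intro dev.combined_cost_sums[where b=b] finL) (auto simp: cst_def[abs_def])
      show "(\<lambda>t. ?\<alpha> ^ t * (\<integral>\<omega>. r (fst (\<omega> t)) \<partial>play_measure G ((stat (cc.policy p))(i := \<sigma>)))) sums D"
        using D unfolding r_def \<pi>_def .
    qed
    finally show ?thesis using \<open>D \<le> \<epsilon>\<close> by (simp add: w_def)
  qed
  moreover have "cc.policy p \<in> (\<Pi> i\<in>players G. stationary_strategies G i)"
    using cc.policy_stationary[OF p] by auto
  ultimately show ?thesis unfolding \<pi>_def by blast
qed

end

section \<open>From the Lagrangian equilibrium to the constrained game\<close>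

theorem theorem2p3:
  fixes G :: "('x, 'a::metric_space) csg"
    and \<mu> :: "'x measure"
    and \<delta> :: "'x \<Rightarrow> 'x \<Rightarrow> (nat \<Rightarrow> 'a) \<Rightarrow> real"
    and \<epsilon> :: real
  assumes game: "constrained_stochastic_game G"
    and A1: "\<forall>x\<in>space (states G). \<forall>i\<in>players G. \<forall>l\<in>insert 0 (constraints G).
      continuous_on (profiles G) (cost G i l x)"
    and A2_mu: "\<mu> \<in> space (prob_algebra (states G))"
    and A2_measurable: "(\<lambda>(x, y, a). \<delta> x y a) \<in>
      borel_measurable (states G \<Otimes>\<^sub>M states G \<Otimes>\<^sub>M profile_space G)"
    and A2_nonneg: "\<forall>x\<in>space (states G). \<forall>y\<in>space (states G). \<forall>a\<in>profiles G. 0 \<le> \<delta> x y a"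
    and A2_density: "\<forall>x\<in>space (states G). \<forall>a\<in>profiles G. \<forall>B\<in>sets (states G).
      emeasure (transition G x a) B = (\<integral>\<^sup>+y\<in>B. ennreal (\<delta> x y a) \<partial>\<mu>)"
    and A2_continuous: "\<forall>x\<in>space (states G). \<forall>a\<in>profiles G. \<forall>s.
      (\<forall>n. s n \<in> profiles G) \<and> s \<longlonglongrightarrow> a \<longrightarrow>
      (\<lambda>n. \<integral>y. \<bar>\<delta> x y (s n) - \<delta> x y a\<bar> \<partial>\<mu>) \<longlonglongrightarrow> 0"
    and A3: "\<forall>\<phi> \<in> (\<Pi> i\<in>players G. stationary_strategies G i). \<forall>i\<in>players G.
      \<exists>\<sigma>\<in>strategies G i. \<forall>l\<in>constraints G.
        discounted_cost G i l ((\<lambda>j. stationary (\<phi> j))(i := \<sigma>)) \<le> bound G i l"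
    and eps: "0 < \<epsilon>"
  shows "\<exists>\<phi>. stationary_approximate_equilibrium G \<epsilon> \<phi>"
proof -
  interpret csg_density G \<mu> \<delta>
    using game A1 A2_mu A2_measurable A2_nonneg A2_density A2_continuous by unfold_locales
  let ?J = "discounted_cost G"
  obtain b where b: "0 < b" "\<And>i l x a. i \<in> players G \<Longrightarrow> l \<in> \<L> \<Longrightarrow> x \<in> \<X> \<Longrightarrow>
      a \<in> \<A> \<Longrightarrow> \<bar>cost G i l x a\<bar> \<le> b"
    using game unfolding constrained_stochastic_game_def by blast
  \<comment> \<open>The quotient alone would give
    \<open>M * \<epsilon> = 2 * b + \<epsilon>\<close>; the summand 1 makes the inequality strict.
    That \<open>1 \<le> M\<close> is required because index 0 has multiplier 1.\<close>
  define M where "M = 1 + (2 * b + \<epsilon>) / \<epsilon>"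
  have M: "1 \<le> M" "2 * b + \<epsilon> < M * \<epsilon>" using b(1) eps by (auto simp: M_def field_simps)
  define lam where "lam i l J = (if l = 0 then 1 else M * max 0 (min 1 ((J - bound G i l) / \<epsilon>)))" for i l :: nat and J :: real
  have lam_cont: "continuous_on UNIV (lam i l)" for i l
  proof (cases "l = 0")
    case False
    then have "lam i l = (\<lambda>J. M * max 0 (min 1 ((J - bound G i l) / \<epsilon>)))" by (simp add: lam_def fun_eq_iff)
    then show ?thesis using eps by (auto intro!: continuous_intros)
  qed (simp add: lam_def[abs_def])
  have lam_nonneg: "0 \<le> lam i l J" and lam_le: "lam i l J \<le> M" for i l J
    using M(1) by (auto simp: lam_def mult_left_le)
  obtain \<phi> where \<phi>: "\<phi> \<in> (\<Pi> i\<in>players G. stationary_strategies G i)"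
    and opt: "\<And>i \<sigma>. i \<in> players G \<Longrightarrow> \<sigma> \<in> strategies G i \<Longrightarrow>
      (\<Sum>l\<in>\<L>. lam i l (?J i l (stat \<phi>)) * ?J i l (stat \<phi>))
      \<le> (\<Sum>l\<in>\<L>. lam i l (?J i l (stat \<phi>)) * ?J i l ((stat \<phi>)(i := \<sigma>))) + \<epsilon>"
    using stationary_lagrangian_equilibrium[OF b lam_cont lam_nonneg lam_le _ eps] M(1) by force
  define \<pi> where "\<pi> = stat \<phi>"
  have \<pi>: "\<pi> \<in> (\<Pi> i\<in>players G. strategies G i)"
    using \<phi> stationary_in_strategies by (auto simp: \<pi>_def Pi_iff)
  have J_bound: "\<bar>?J i 0 \<pi>'\<bar> \<le> b" if "\<pi>' \<in> (\<Pi> i\<in>players G. strategies G i)" "i \<in> players G" for \<pi>' i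
  proof -
    interpret csg_play G \<pi>' by unfold_locales (rule that(1))
    show ?thesis
      using measurable_cost that(2) b(2) by (intro abs_discounted_cost_le) auto
  qed
  \<comment> \<open>The constraint part does not mention \<open>\<sigma>\<close>, but its proof
    compares with such a strategy; that \<open>feasible G i \<pi>\<close> is nonempty is supplied
    separately.\<close>
  have main: "(\<forall>l\<in>constraints G. ?J i l \<pi> \<le> bound G i l + \<epsilon>) \<and> ?J i 0 \<pi> - \<epsilon> \<le> ?J i 0 (\<pi>(i := \<sigma>))"
    if i: "i \<in> players G" and \<sigma>: "\<sigma> \<in> feasible G i \<pi>" for i \<sigma>
  proof -
    have \<sigma>s: "\<sigma> \<in> strategies G i" and \<sigma>b: "\<And>l. l \<in> constraints G \<Longrightarrow> ?J i l (\<pi>(i := \<sigma>)) \<le> bound G i l"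
      using \<sigma> by (auto simp: feasible_def)
    have dev: "\<pi>(i := \<sigma>) \<in> (\<Pi> i\<in>players G. strategies G i)"
      using \<pi> \<sigma>s by (auto simp: Pi_iff)
    have fin: "finite (constraints G)" "0 \<notin> constraints G" by (auto simp: constraints_def)
    define m where "m l = lam i l (?J i l \<pi>)" for l
    have m0: "m 0 = 1" by (simp add: m_def lam_def)
    have le1: "?J i 0 \<pi> + (\<Sum>l\<in>constraints G. m l * ?J i l \<pi>) \<le> ?J i 0 (\<pi>(i := \<sigma>)) + (\<Sum>l\<in>constraints G. m l * ?J i l (\<pi>(i := \<sigma>))) + \<epsilon>"
      using opt[OF i \<sigma>s] fin m0 unfolding \<pi>_def[symmetric] m_def[symmetric] by simp
    have le2: "(\<Sum>l\<in>constraints G. m l * ?J i l (\<pi>(i := \<sigma>))) \<le> (\<Sum>l\<in>constraints G. m l * bound G i l)"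
      using lam_nonneg \<sigma>b by (intro sum_mono mult_left_mono) (auto simp: m_def)
    \<comment> \<open>The multipliers on both sides are the same numbers, fixed by
      \<open>\<pi>\<close>. Hence the constraint costs of the deviation can be replaced by their
      bounds and moved to the left.\<close>
    have le: "?J i 0 \<pi> + (\<Sum>l\<in>constraints G. m l * (?J i l \<pi> - bound G i l)) \<le> ?J i 0 (\<pi>(i := \<sigma>)) + \<epsilon>"
      unfolding right_diff_distrib sum_subtractf using le1 le2 by linarith
    have l0: "l \<noteq> 0" if "l \<in> constraints G" for l using that fin(2) by metis
    \<comment> \<open>Complementary slackness by construction: the multiplier is 0 wherever the
      difference is not positive.\<close>
    have nonneg: "0 \<le> m l * (?J i l \<pi> - bound G i l)" if "l \<in> constraints G" for l
    proof (cases "?J i l \<pi> \<le> bound G i l")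
      case True
      then have "(?J i l \<pi> - bound G i l) / \<epsilon> \<le> 0" using eps by (simp add: divide_le_0_iff)
      then have "m l = 0" using l0[OF that] by (simp add: m_def lam_def)
      then show ?thesis by simp
    qed (use lam_nonneg in \<open>simp add: m_def\<close>)
    have "?J i l \<pi> \<le> bound G i l + \<epsilon>" if l: "l \<in> constraints G" for l
    proof (rule ccontr)
      assume "\<not> ?thesis"
      then have gt: "\<epsilon> < ?J i l \<pi> - bound G i l" by simp
      then have "1 \<le> (?J i l \<pi> - bound G i l) / \<epsilon>" using eps by simp
      then have "m l = M" using l0[OF l] by (simp add: m_def lam_def)
      have "M * \<epsilon> \<le> M * (?J i l \<pi> - bound G i l)" using gt M(1) by (intro mult_left_mono) auto
      with M(2) have "2 * b + \<epsilon> < m l * (?J i l \<pi> - bound G i l)" unfolding \<open>m l = M\<close> by linarith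
      also have "\<dots> \<le> (\<Sum>l\<in>constraints G. m l * (?J i l \<pi> - bound G i l))"
        using l fin nonneg by (intro member_le_sum) auto
      finally show False
        using le J_bound[OF \<pi> i] J_bound[OF dev i] by linarith
    qed
    moreover have "?J i 0 \<pi> - \<epsilon> \<le> ?J i 0 (\<pi>(i := \<sigma>))"
    proof -
      have "0 \<le> (\<Sum>l\<in>constraints G. m l * (?J i l \<pi> - bound G i l))" by (rule sum_nonneg) (rule nonneg)
      with le show ?thesis by linarith
    qed
    ultimately show ?thesis by blast
  qed
  have feas: "feasible G i \<pi> \<noteq> {}" if "i \<in> players G" for i
    using A3 \<phi> that unfolding feasible_def \<pi>_def by blast
  have "stationary_approximate_equilibrium G \<epsilon> \<phi>"
    unfolding stationary_approximate_equilibrium_def Let_def \<pi>_def[symmetric]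
  proof (intro conjI \<phi> ballI)
    fix i l assume i: "i \<in> players G" and l: "l \<in> constraints G"
    then show "?J i l \<pi> \<le> bound G i l + \<epsilon>" using main[OF i] feas[OF i] by blast
  next
    fix i assume i: "i \<in> players G"
    \<comment> \<open>A real infimum is bounded below in this way only over a nonempty set, which
      (A3) guarantees.\<close>
    show "?J i 0 \<pi> - \<epsilon> \<le> (INF \<sigma>\<in>feasible G i \<pi>. ?J i 0 (\<pi>(i := \<sigma>)))"
      using main[OF i] feas[OF i] by (intro cINF_greatest) auto
  qed
  then show ?thesis by (rule exI[of _ \<phi>])
qed

end
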